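(* Let $d\ge 1$, let $X$ be an affine building whose apartments are Coxeter complexes attached to Coxeter systems of type $\widetilde{A}_d$, equipped with a fixed orientation, and let $\mathcal{F}$ be a cohomological coefficient system on $X$. Let $1\le k\le d$ and suppose that $\mathcal{F}$ satisfies the condition $\mathcal{S}(k)$. Then $H^k(X,\mathcal{F})=0$.
   Context: Building and orientation. $X^j$ denotes the set of $j$-simplices of $X$; a simplex is identified with its set of vertices; two vertices $x,y$ are incident if $\{x,y\}\in X^1$. The fixed orientation of $X$ distinguishes for each simplex a cyclic ordering on its set of vertices. A pointed $k$-simplex is an enumeration $(x_0,\ldots,x_k)$ of the vertices of a $k$-simplex in its distinguished cyclic ordering. For every apartment $A$ of $X$ (not distinguished from its geometric realization) there is an identification of $A$ with $\mathbb{R}^{d+1}/\mathbb{R}(1,\ldots,1)$ such that, with $e_0,\ldots,e_d$ the standard basis: the set of vertices of $A$ is $\mathbb{Z}^{d+1}/\mathbb{Z}(1,\ldots,1)$; and a tuple $(x_0,\ldots,x_k)$ of vertices of $A$ is a pointed $k$-simplex if and only if there is a sequence $\emptyset\ne J_0\subsetneq\cdots\subsetneq J_{k-1}\subsetneq\{0,\ldots,d\}$ such that $\sum_{j\in J_t}e_j$ represents $x_t-x_k$ for all $0\le t\le k-1$. Stability. For a pointed $k$-simplex $(x_0,\ldots,x_k)$ let $\ell((x_0,\ldots,x_k))$ be the maximal $r$ such that there is a pointed $r$-simplex $(y_0,\ldots,y_r)$ with $y_0=x_0$ and $y_r=x_k$. For a pointed $(k-1)$-simplex $\widehat{\eta}=(x_1,\ldots,x_k)$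 let $N_{\widehat{\eta}}=\{z\in X^0 : (z,x_1,\ldots,x_k)\text{ is a pointed }k\text{-simplex}\}$; write $(z,\widehat{\eta})=(z,x_1,\ldots,x_k)$. On $N_{\widehat{\eta}}$ set $u_1\le u_2$ iff $u_1=u_2$ or $(u_1,u_2,\widehat{\eta})$ is a pointed $(k+1)$-simplex. For $u_1,u_2\in N_{\widehat{\eta}}$ let $W^{\widehat{\eta}}_{u_1,u_2}=\{u\in N_{\widehat{\eta}} : u\le u_1,\ u\le u_2\}$. If this set is nonempty, it contains a (unique) element $u$ with $\ell((u,\widehat{\eta}))<\ell((w,\widehat{\eta}))$ for all other $w\in W^{\widehat{\eta}}_{u_1,u_2}$; this element is denoted $[\widehat{\eta}|u_1,u_2]$. If $W^{\widehat{\eta}}_{u_1,u_2}=\emptyset$, then $[\widehat{\eta}|u_1,u_2]$ is undefined. A subset $M_0\subset N_{\widehat{\eta}}$ is stable with respect to $\widehat{\eta}$ if for any $u_1,u_2\in M_0$ the vertex $[\widehat{\eta}|u_1,u_2]$ is defined and belongs to $M_0$. Coefficient systems. A cohomological coefficient system (ccs) $\mathcal{F}$ on $X$ assigns to every simplex $\tau$ an abelian group $\mathcal{F}(\tau)$ and to every face inclusion $\tau\subset\sigma$ a homomorphism $r^\tau_\sigma:\mathcal{F}(\tau)\to\mathcal{F}(\sigma)$ such that $r^\sigma_\rho\circ r^\tau_\sigma=r^\tau_\rho$ whenever $\tau\subset\sigma\subset\rho$, and $r^\tau_\tau=\mathrm{id}$. $C^k(X,\mathcal{F})=\prod_{\tau\in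 X^k}\mathcal{F}(\tau)$, and $\partial=\partial^{k+1}:C^k(X,\mathcal{F})\to C^{k+1}(X,\mathcal{F})$ is $(\partial c)_\tau=\sum_{\tau'\subset\tau}[\tau:\tau']\,r^{\tau'}_\tau(c_{\tau'})$, where $\tau'$ runs over the codimension one faces of $\tau$ and $[\tau:\tau']=\pm1$ is the incidence number with respect to a fixed labelling of $X$ by vertex types. $H^k(X,\mathcal{F})$ is the $k$-th cohomology of the complex $(C^\bullet(X,\mathcal{F}),\partial)$. Condition $\mathcal{S}(k)$ (for $1\le k\le d$): for any pointed $(k-1)$-simplex $\widehat{\eta}$ with underlying $(k-1)$-simplex $\eta$ and any subset $M_0\subset N_{\widehat{\eta}}$ stable with respect to $\widehat{\eta}$, the subquotient complex of $C^\bullet(X,\mathcal{F})$ $$\mathcal{F}(\eta)\xrightarrow{\partial^k}\prod_{z\in M_0}\mathcal{F}(\{z\}\cup\eta)\xrightarrow{\partial^{k+1}}\prod_{z,z'\in M_0,\ \{z,z'\}\in X^1}\mathcal{F}(\{z,z'\}\cup\eta)$$ is exact (at the middle term). Here the first term is regarded as a subgroup of $C^{k-1}(X,\mathcal{F})$, the second as a direct summand of $C^k(X,\mathcal{F})$, the third as a quotient of $C^{k+1}(X,\mathcal{F})$. *)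

theory Defs
  imports "HOL-Algebra.FiniteProduct" "HOL-Algebra.Product_Groups"
begin

text \<open>A simplex is identified with its nonempty set of vertices; the empty simplex is left out.\<close>

definition simplicial_complex :: "'v set set \<Rightarrow> bool" where
  "simplicial_complex X \<longleftrightarrow>
     (\<forall>\<sigma>\<in>X. finite \<sigma> \<and> \<sigma> \<noteq> {} \<and> (\<forall>\<tau>. \<tau> \<noteq> {} \<and> \<tau> \<subseteq> \<sigma> \<longrightarrow> \<tau> \<in> X))"

definition vertices :: "'v set set \<Rightarrow> 'v set" where
  "vertices X = \<Union>X"

definition simplices :: "'v set set \<Rightarrow> nat \<Rightarrow> 'v set set" where
  "simplices X j = {\<sigma> \<in> X. finite \<sigma> \<and> card \<sigma> = Suc j}"

definition complex_iso :: "('v \<Rightarrow> 'w) \<Rightarrow> 'v set set \<Rightarrow> 'w set set \<Rightarrow> bool" where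
  "complex_iso f K L \<longleftrightarrow> bij_betw f (vertices K) (vertices L) \<and> (\<lambda>\<sigma>. f ` \<sigma>) ` K = L"

text \<open>Coxeter matrices are functions \<open>m\<close> on pairs of generators with \<open>m s s = 1\<close>; the value \<open>0\<close>
  encodes the order \<open>\<infinity>\<close>, since the relation \<open>(s t)\<^sup>0 = 1\<close> is void. The Coxeter group is the set of
  words in the generators modulo the congruence generated by the Coxeter relations; no formal
  inverses are needed because the relations \<open>s s = 1\<close> are among them.\<close>

inductive coxeter_step :: "'s set \<Rightarrow> ('s \<Rightarrow> 's \<Rightarrow> nat) \<Rightarrow> 's list \<Rightarrow> 's list \<Rightarrow> bool"
  for S :: "'s set" and m :: "'s \<Rightarrow> 's \<Rightarrow> nat" where
  "u \<in> lists S \<Longrightarrow> v \<in> lists S \<Longrightarrow> s \<in> S \<Longrightarrow> t \<in> S \<Longrightarrow>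
     coxeter_step S m (u @ concat (replicate (m s t) [s, t]) @ v) (u @ v)"

definition coxeter_eq :: "'s set \<Rightarrow> ('s \<Rightarrow> 's \<Rightarrow> nat) \<Rightarrow> 's list \<Rightarrow> 's list \<Rightarrow> bool" where
  "coxeter_eq S m = equivclp (coxeter_step S m)"

text \<open>The special coset \<open>w W\<^sub>J\<close>, represented by the set of all words whose class lies in it.\<close>

definition special_coset :: "'s set \<Rightarrow> ('s \<Rightarrow> 's \<Rightarrow> nat) \<Rightarrow> 's list \<Rightarrow> 's set \<Rightarrow> 's list set" where
  "special_coset S m w J = {v \<in> lists S. \<exists>u \<in> lists J. coxeter_eq S m v (w @ u)}"

text \<open>The Coxeter complex is the poset of special cosets \<open>w W\<^sub>J\<close>, ordered by reverse inclusion; the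
  nonempty simplices are those with \<open>J \<noteq> S\<close>. The vertices of the simplex \<open>w W\<^sub>J\<close> are the maximal
  proper special cosets containing it, that is, the cosets of \<open>W\<^bsub>S - {s}\<^esub>\<close> for \<open>s \<in> S - J\<close>
  (below, \<open>T = S - J\<close>).\<close>

definition coxeter_complex :: "'s set \<Rightarrow> ('s \<Rightarrow> 's \<Rightarrow> nat) \<Rightarrow> 's list set set set" where
  "coxeter_complex S m =
     {(\<lambda>s. special_coset S m w (S - {s})) ` T | w T. w \<in> lists S \<and> T \<subseteq> S \<and> T \<noteq> {}}"

text \<open>The Coxeter matrix of type \<open>A\<^sub>d\<close> tilde on the generators \<open>0, \<dots>, d\<close>: for \<open>d \<ge> 2\<close> the diagram is
  a cycle with \<open>d + 1\<close> nodes, for \<open>d = 1\<close> it is a single edge labelled \<open>\<infinity>\<close>.\<close>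

definition affine_A_matrix :: "nat \<Rightarrow> nat \<Rightarrow> nat \<Rightarrow> nat" where
  "affine_A_matrix d i j =
     (if i = j then 1
      else if d = 1 then 0
      else if j = Suc i mod Suc d \<or> i = Suc j mod Suc d then 3
      else 2)"

text \<open>A building together with a system \<open>\<A>\<close> of apartments; thickness is not required.\<close>

definition building_affine_A :: "nat \<Rightarrow> 'v set set \<Rightarrow> 'v set set set \<Rightarrow> bool" where
  "building_affine_A d X \<A> \<longleftrightarrow>
     simplicial_complex X \<and> \<A> \<noteq> {} \<and> X = \<Union>\<A> \<and>
     (\<forall>A\<in>\<A>. simplicial_complex A \<and>
        (\<exists>f. complex_iso f A (coxeter_complex {0..d} (affine_A_matrix d)))) \<and>
     (\<forall>\<sigma>\<in>X. \<forall>\<tau>\<in>X. \<exists>A\<in>\<A>. \<sigma> \<in> A \<and> \<tau> \<in> A) \<and>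
     (\<forall>A\<in>\<A>. \<forall>B\<in>\<A>. \<forall>\<sigma>\<in>A \<inter> B. \<forall>\<tau>\<in>A \<inter> B.
        \<exists>f. complex_iso f A B \<and> (\<forall>v\<in>\<sigma> \<union> \<tau>. f v = v))"

text \<open>Only chambers are constrained since every simplex is a
  face of a chamber.\<close>

definition labelling :: "nat \<Rightarrow> 'v set set \<Rightarrow> ('v \<Rightarrow> nat) \<Rightarrow> bool" where
  "labelling d X lab \<longleftrightarrow> (\<forall>C\<in>simplices X d. bij_betw lab C {0..d})"

text \<open>A cyclic ordering of a finite set is a class of enumerations modulo rotation.\<close>

definition cyclic_ordering :: "'v set \<Rightarrow> 'v list set \<Rightarrow> bool" where
  "cyclic_ordering \<sigma> R \<longleftrightarrow>
     (\<exists>xs. distinct xs \<and> set xs = \<sigma> \<and> R = {rotate n xs | n. True})"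

definition pointed :: "'v set set \<Rightarrow> ('v set \<Rightarrow> 'v list set) \<Rightarrow> nat \<Rightarrow> 'v list \<Rightarrow> bool" where
  "pointed X ori k xs \<longleftrightarrow> set xs \<in> X \<and> length xs = Suc k \<and> xs \<in> ori (set xs)"

text \<open>The group \<open>\<int>\<^bsup>d+1\<^esup> / \<int>(1,\<dots>,1)\<close>, as a set of classes.\<close>

definition int_vectors :: "nat \<Rightarrow> (nat \<Rightarrow> int) set" where
  "int_vectors d = {0..d} \<rightarrow>\<^sub>E UNIV"

definition diagonal_rel :: "nat \<Rightarrow> ((nat \<Rightarrow> int) \<times> (nat \<Rightarrow> int)) set" where
  "diagonal_rel d = {(a, b). a \<in> int_vectors d \<and> b \<in> int_vectors d \<and>
     (\<exists>c. \<forall>i\<in>{0..d}. a i = b i + c)}"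

definition apartment_vertices :: "nat \<Rightarrow> (nat \<Rightarrow> int) set set" where
  "apartment_vertices d = int_vectors d // diagonal_rel d"

text \<open>\<open>represents_difference d J p q\<close>: the vector \<open>\<Sum>\<^sub>j\<^sub>\<in>\<^sub>J e\<^sub>j\<close> represents \<open>p - q\<close>.\<close>

definition represents_difference ::
    "nat \<Rightarrow> nat set \<Rightarrow> (nat \<Rightarrow> int) set \<Rightarrow> (nat \<Rightarrow> int) set \<Rightarrow> bool" where
  "represents_difference d J p q \<longleftrightarrow>
     (\<exists>a\<in>p. \<exists>b\<in>q. \<forall>i\<in>{0..d}. a i - b i = (if i \<in> J then 1 else 0))"

definition flag_tuple :: "nat \<Rightarrow> nat \<Rightarrow> (nat \<Rightarrow> int) set list \<Rightarrow> bool" where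
  "flag_tuple d k ps \<longleftrightarrow>
     (\<exists>J :: nat \<Rightarrow> nat set.
        (\<forall>t<k. J t \<noteq> {} \<and> J t \<subset> {0..d}) \<and>
        (\<forall>t. Suc t < k \<longrightarrow> J t \<subset> J (Suc t)) \<and>
        (\<forall>t<k. represents_difference d (J t) (ps ! t) (ps ! k)))"

text \<open>An orientation \<open>ori\<close> assigns to every simplex a cyclic ordering of its vertices, in such a way
  that in suitable coordinates on each apartment the pointed simplices are the ones given by
  flags of subsets of \<open>{0, \<dots>, d}\<close>.\<close>

definition orientation ::
    "nat \<Rightarrow> 'v set set \<Rightarrow> 'v set set set \<Rightarrow> ('v set \<Rightarrow> 'v list set) \<Rightarrow> bool" where
  "orientation d X \<A> ori \<longleftrightarrow>
     (\<forall>\<sigma>\<in>X. cyclic_ordering \<sigma> (ori \<sigma>)) \<and>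
     (\<forall>A\<in>\<A>. \<exists>\<phi>. bij_betw \<phi> (vertices A) (apartment_vertices d) \<and>
        (\<forall>k xs. length xs = Suc k \<and> set xs \<subseteq> vertices A \<longrightarrow>
           (pointed X ori k xs \<longleftrightarrow> flag_tuple d k (map \<phi> xs))))"

definition ell :: "'v set set \<Rightarrow> ('v set \<Rightarrow> 'v list set) \<Rightarrow> 'v list \<Rightarrow> nat" where
  "ell X ori xs = Max {r. \<exists>ys. pointed X ori r ys \<and> hd ys = hd xs \<and> last ys = last xs}"

definition nbrs :: "'v set set \<Rightarrow> ('v set \<Rightarrow> 'v list set) \<Rightarrow> 'v list \<Rightarrow> 'v set" where
  "nbrs X ori \<eta> = {z \<in> vertices X. pointed X ori (length \<eta>) (z # \<eta>)}"

definition nbr_le :: "'v set set \<Rightarrow> ('v set \<Rightarrow> 'v list set) \<Rightarrow> 'v list \<Rightarrow> 'v \<Rightarrow> 'v \<Rightarrow> bool" where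
  "nbr_le X ori \<eta> u1 u2 \<longleftrightarrow> u1 = u2 \<or> pointed X ori (Suc (length \<eta>)) (u1 # u2 # \<eta>)"

definition lower_bounds :: "'v set set \<Rightarrow> ('v set \<Rightarrow> 'v list set) \<Rightarrow> 'v list \<Rightarrow> 'v \<Rightarrow> 'v \<Rightarrow> 'v set" where
  "lower_bounds X ori \<eta> u1 u2 =
     {u \<in> nbrs X ori \<eta>. nbr_le X ori \<eta> u u1 \<and> nbr_le X ori \<eta> u u2}"

text \<open>The vertex \<open>[\<eta>|u1,u2]\<close>, with \<open>None\<close> for ``undefined''. The length of \<open>\<eta>\<close> is one more than the
  dimension of the underlying simplex.\<close>

definition meet_vertex ::
    "'v set set \<Rightarrow> ('v set \<Rightarrow> 'v list set) \<Rightarrow> 'v list \<Rightarrow> 'v \<Rightarrow> 'v \<Rightarrow> 'v option" where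
  "meet_vertex X ori \<eta> u1 u2 =
     (let W = lower_bounds X ori \<eta> u1 u2 in
      if W = {} then None
      else Some (THE u. u \<in> W \<and> (\<forall>w\<in>W. w \<noteq> u \<longrightarrow> ell X ori (u # \<eta>) < ell X ori (w # \<eta>))))"

definition stable :: "'v set set \<Rightarrow> ('v set \<Rightarrow> 'v list set) \<Rightarrow> 'v list \<Rightarrow> 'v set \<Rightarrow> bool" where
  "stable X ori \<eta> M \<longleftrightarrow>
     M \<subseteq> nbrs X ori \<eta> \<and> (\<forall>u1\<in>M. \<forall>u2\<in>M. \<exists>u\<in>M. meet_vertex X ori \<eta> u1 u2 = Some u)"

text \<open>Abelian groups are commutative groups in the sense of HOL-Algebra and hence written
  multiplicatively.\<close>

definition coefficient_system ::
    "'v set set \<Rightarrow> ('v set \<Rightarrow> 'a monoid) \<Rightarrow> ('v set \<Rightarrow> 'v set \<Rightarrow> 'a \<Rightarrow> 'a) \<Rightarrow> bool" where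
  "coefficient_system X F r \<longleftrightarrow>
     (\<forall>\<tau>\<in>X. comm_group (F \<tau>)) \<and>
     (\<forall>\<tau>\<in>X. \<forall>\<sigma>\<in>X. \<tau> \<subseteq> \<sigma> \<longrightarrow> r \<tau> \<sigma> \<in> hom (F \<tau>) (F \<sigma>)) \<and>
     (\<forall>\<tau>\<in>X. \<forall>\<sigma>\<in>X. \<forall>\<rho>\<in>X. \<tau> \<subseteq> \<sigma> \<and> \<sigma> \<subseteq> \<rho> \<longrightarrow>
        (\<forall>a\<in>carrier (F \<tau>). r \<sigma> \<rho> (r \<tau> \<sigma> a) = r \<tau> \<rho> a)) \<and>
     (\<forall>\<tau>\<in>X. \<forall>a\<in>carrier (F \<tau>). r \<tau> \<tau> a = a)"

text \<open>If \<open>\<tau>\<close> has vertices \<open>v\<^sub>0, v\<^sub>1, \<dots>\<close> in the order of their labels and \<open>\<tau>' = \<tau> - {v\<^sub>i}\<close>, then the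
  incidence number is \<open>(-1)\<^sup>i\<close>.\<close>

definition incidence_number :: "('v \<Rightarrow> nat) \<Rightarrow> 'v set \<Rightarrow> 'v set \<Rightarrow> int" where
  "incidence_number lab \<tau> \<tau>' = (-1) ^ card {w \<in> \<tau>. lab w < lab (the_elem (\<tau> - \<tau>'))}"

definition cochains :: "'v set set \<Rightarrow> ('v set \<Rightarrow> 'a monoid) \<Rightarrow> nat \<Rightarrow> ('v set \<Rightarrow> 'a) monoid" where
  "cochains X F k = product_group (simplices X k) F"

text \<open>The map from \<open>k\<close>-cochains to \<open>(k+1)\<close>-cochains.\<close>

definition coboundary ::
    "'v set set \<Rightarrow> ('v \<Rightarrow> nat) \<Rightarrow> ('v set \<Rightarrow> 'a monoid) \<Rightarrow> ('v set \<Rightarrow> 'v set \<Rightarrow> 'a \<Rightarrow> 'a) \<Rightarrow>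
     nat \<Rightarrow> ('v set \<Rightarrow> 'a) \<Rightarrow> 'v set \<Rightarrow> 'a" where
  "coboundary X lab F r k c =
     (\<lambda>\<tau>\<in>simplices X (Suc k).
        finprod (F \<tau>) (\<lambda>\<tau>'. r \<tau>' \<tau> (c \<tau>') [^]\<^bsub>F \<tau>\<^esub> incidence_number lab \<tau> \<tau>')
          {\<tau>' \<in> simplices X k. \<tau>' \<subset> \<tau>})"

definition cohomology ::
    "'v set set \<Rightarrow> ('v \<Rightarrow> nat) \<Rightarrow> ('v set \<Rightarrow> 'a monoid) \<Rightarrow> ('v set \<Rightarrow> 'v set \<Rightarrow> 'a \<Rightarrow> 'a) \<Rightarrow>
     nat \<Rightarrow> ('v set \<Rightarrow> 'a) set monoid" where
  "cohomology X lab F r k =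
     (cochains X F k)
       \<lparr>carrier := kernel (cochains X F k) (cochains X F (Suc k)) (coboundary X lab F r k)\<rparr>
     Mod
     (if k = 0 then {\<one>\<^bsub>cochains X F k\<^esub>}
      else coboundary X lab F r (k - 1) ` carrier (cochains X F (k - 1)))"

text \<open>For sets \<open>T\<close> of \<open>k\<close>-simplices and \<open>T'\<close> of \<open>(k+1)\<close>-simplices, the map between the products over
  \<open>T\<close> and \<open>T'\<close> induced by the coboundary: extend a family on \<open>T\<close> trivially to a cochain, apply the
  coboundary, and project to the components in \<open>T'\<close>.\<close>

definition extend_trivially ::
    "'v set set \<Rightarrow> ('v set \<Rightarrow> 'a monoid) \<Rightarrow> nat \<Rightarrow> 'v set set \<Rightarrow> ('v set \<Rightarrow> 'a) \<Rightarrow> 'v set \<Rightarrow> 'a" where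
  "extend_trivially X F k T c = (\<lambda>\<tau>\<in>simplices X k. if \<tau> \<in> T then c \<tau> else \<one>\<^bsub>F \<tau>\<^esub>)"

definition induced_coboundary ::
    "'v set set \<Rightarrow> ('v \<Rightarrow> nat) \<Rightarrow> ('v set \<Rightarrow> 'a monoid) \<Rightarrow> ('v set \<Rightarrow> 'v set \<Rightarrow> 'a \<Rightarrow> 'a) \<Rightarrow>
     nat \<Rightarrow> 'v set set \<Rightarrow> 'v set set \<Rightarrow> ('v set \<Rightarrow> 'a) \<Rightarrow> 'v set \<Rightarrow> 'a" where
  "induced_coboundary X lab F r k T T' c =
     restrict (coboundary X lab F r k (extend_trivially X F k T c)) T'"

text \<open>In the last product \<open>{z, z'}\<close> runs over unordered pairs, as the factors are factors of the group
  of \<open>(k+1)\<close>-cochains. The first group \<open>F(\<eta>)\<close> is the product over the one-element set \<open>{\<eta>}\<close>.\<close>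

definition condition_S ::
    "'v set set \<Rightarrow> ('v set \<Rightarrow> 'v list set) \<Rightarrow> ('v \<Rightarrow> nat) \<Rightarrow> ('v set \<Rightarrow> 'a monoid) \<Rightarrow>
     ('v set \<Rightarrow> 'v set \<Rightarrow> 'a \<Rightarrow> 'a) \<Rightarrow> nat \<Rightarrow> bool" where
  "condition_S X ori lab F r k \<longleftrightarrow>
     (\<forall>\<eta> M. pointed X ori (k - 1) \<eta> \<and> stable X ori \<eta> M \<longrightarrow>
        (let T0 = {set \<eta>};
             T1 = {{z} \<union> set \<eta> | z. z \<in> M};
             T2 = {{z, z'} \<union> set \<eta> | z z'. z \<in> M \<and> z' \<in> M \<and> {z, z'} \<in> simplices X 1}
         in induced_coboundary X lab F r (k - 1) T0 T1 ` carrier (product_group T0 F)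
            = kernel (product_group T1 F) (product_group T2 F)
                (induced_coboundary X lab F r k T1 T2)))"

end

theory Submission
  imports Defs
begin

text \<open>Fix a vertex \<open>z\<close>. For a vertex \<open>x\<close>, write \<open>v = x - z\<close> in the coordinates of an apartment
  containing both and put \<open>f x = \<Sum>\<^sub>i (v\<^sub>i - min v)\<close>. This does not depend on the apartment, and
  \<open>f\<close> is injective on simplices. A neighbour \<open>u = x + \<Sum>\<^sub>j\<^sub>\<in>\<^sub>J e\<^sub>j\<close> satisfies \<open>f u < f x\<close> if and only
  if \<open>J\<close> contains the set of indices where \<open>v\<close> is minimal, that is, if and only if it equals or lies
  above a certain neighbour of \<open>x\<close>, the gate, which does not depend on the apartment either. Hence
  the enumeration of a simplex \<open>\<eta>\<close> by increasing \<open>f\<close> is pointed, and with respect to it the set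
  \<open>M\<^sub>\<eta>\<close> of all \<open>u\<close> such that \<open>{u} \<union> \<eta>\<close> is a simplex and \<open>f u < f y\<close> for all \<open>y \<in> \<eta>\<close> is stable.

  Every \<open>k\<close>-simplex is \<open>{u} \<union> \<eta>\<close> for exactly one \<open>\<eta>\<close> with \<open>u \<in> M\<^sub>\<eta>\<close>; call \<open>\<Sum>\<^sub>y\<^sub>\<in>\<^sub>\<eta> f y\<close> its rank.
  Suppose a cocycle vanishes on all \<open>k\<close>-simplices of rank less than that of \<open>\<eta>\<close>. For
  \<open>u, w \<in> M\<^sub>\<eta>\<close> the faces of \<open>{u, w} \<union> \<eta>\<close> not containing \<open>\<eta>\<close> have smaller rank, so the condition on the
  coefficient system applied to \<open>M\<^sub>\<eta>\<close> yields an element of \<open>F \<eta>\<close> whose coboundary agrees with the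
  cocycle on the simplices belonging to \<open>\<eta>\<close>. All other \<open>k\<close>-simplices containing \<open>\<eta>\<close> have larger
  rank, so a cocycle can be killed rank by rank.\<close>

subsection \<open>Integer vectors modulo constants\<close>

text \<open>In coordinates \<open>f x\<close> is a directed distance: the least number of steps,
  each subtracting a unit vector, that lead from \<open>x\<close> to \<open>z\<close>. The obstacle
  is to compare it between apartments. The axioms only give isomorphisms fixing two simplices, and
  such a map need not respect the cyclic orders. The labels repair this: inside an apartment they
  depend only on the coordinate sum modulo d+1, so an isomorphism that fixes a chamber can only
  shift these sums by a constant. Even such a map need not match the two coordinate systems index by
  index. Therefore only numbers are transported, namely heights and numbers of minimal coordinates,
  and the gate, being a vertex, needs an induction of its own.

  In the last step all \<eta> of the same rank are treated at once. This is consistent because a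
  k-simplex has a single (k-1)-face of largest rank. The value of the primitive at \<eta> changes
  only at the stage given by the rank of \<eta>, so the infinitely many corrections define a limit
  without any finiteness of the building.\<close>

definition vmin :: "nat \<Rightarrow> (nat \<Rightarrow> int) \<Rightarrow> int" where
  "vmin d v = Min (v ` {0..d})"

definition vmins :: "nat \<Rightarrow> (nat \<Rightarrow> int) \<Rightarrow> nat set" where
  "vmins d v = {i \<in> {0..d}. v i = vmin d v}"

definition height :: "nat \<Rightarrow> (nat \<Rightarrow> int) \<Rightarrow> nat" where
  "height d v = (\<Sum>i\<in>{0..d}. nat (v i - vmin d v))"

lemma vmin_le: "i \<in> {0..d} \<Longrightarrow> vmin d v \<le> v i"
  unfolding vmin_def by (intro Min_le) auto

lemma vmin_eqI:
  assumes "i \<in> {0..d}" "v i = c" "\<And>j. j \<in> {0..d} \<Longrightarrow> c \<le> v j"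
  shows "vmin d v = c"
  unfolding vmin_def using assms by (intro Min_eqI) auto

lemma vmins_nonempty: "vmins d v \<noteq> {}"
proof -
  have "vmin d v \<in> v ` {0..d}"
    unfolding vmin_def by (intro Min_in) auto
  thus ?thesis
    unfolding vmins_def by auto
qed

lemma vmins_subset: "vmins d v \<subseteq> {0..d}"
  by (auto simp: vmins_def)

lemma vmin_shift_superset:
  assumes "\<forall>i\<in>{0..d}. w i = v i + c + (if i \<in> J then 1 else 0)" "vmins d v \<subseteq> J"
  shows "vmin d w = vmin d v + c + 1"
proof -
  obtain i where i: "i \<in> {0..d}" "v i = vmin d v"
    using vmins_nonempty[of d v] by (auto simp: vmins_def)
  show ?thesis
  proof (rule vmin_eqI)
    show "w i = vmin d v + c + 1"
      using i assms by (auto simp: vmins_def)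
    fix j assume j: "j \<in> {0..d}"
    show "vmin d v + c + 1 \<le> w j"
      using vmin_le[OF j, of v] assms j by (cases "v j = vmin d v") (auto simp: vmins_def)
  qed (use i in auto)
qed

lemma vmin_shift_not_superset:
  assumes "\<forall>i\<in>{0..d}. w i = v i + c + (if i \<in> J then 1 else 0)" "\<not> vmins d v \<subseteq> J"
  shows "vmin d w = vmin d v + c"
proof -
  obtain i where i: "i \<in> {0..d}" "v i = vmin d v" "i \<notin> J"
    using assms(2) by (auto simp: vmins_def)
  show ?thesis
  proof (rule vmin_eqI)
    show "w i = vmin d v + c"
      using i assms by auto
    fix j assume j: "j \<in> {0..d}"
    show "vmin d v + c \<le> w j"
      using vmin_le[OF j, of v] assms j by auto
  qed (use i in auto)
qed

text \<open>All minimal entries rise, so the minimum rises with them; relative to it only the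
  entries outside \<open>J\<close> change, each losing 1. The constant \<open>c\<close>
  cancels.\<close>

lemma height_shift_superset:
  assumes w: "\<forall>i\<in>{0..d}. w i = v i + c + (if i \<in> J then 1 else 0)"
    and J: "vmins d v \<subseteq> J"
  shows "height d v = height d w + card ({0..d} - J)"
proof -
  have "height d v = (\<Sum>i\<in>{0..d}. nat (w i - vmin d w) + (if i \<in> J then 0 else 1))"
    unfolding height_def
  proof (rule sum.cong)
    fix i assume i: "i \<in> {0..d}"
    have "i \<notin> J \<Longrightarrow> v i \<noteq> vmin d v"
      using J i by (auto simp: vmins_def)
    thus "nat (v i - vmin d v) = nat (w i - vmin d w) + (if i \<in> J then 0 else 1)"
      using w i vmin_le[OF i, of v] unfolding vmin_shift_superset[OF w J] by auto
  qed simp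
  also have "\<dots> = height d w + (\<Sum>i\<in>{0..d}. if i \<in> J then 0 else 1)"
    by (simp add: height_def sum.distrib)
  also have "(\<Sum>i\<in>{0..d}. if i \<in> J then 0 else 1) = (\<Sum>i\<in>{0..d} - J. 1)"
    by (intro sum.mono_neutral_cong_right) auto
  finally show ?thesis by simp
qed

text \<open>Some minimal entry stays behind, so apart from \<open>c\<close> the minimum does not
  move and every entry in \<open>J\<close> gains 1 above it.\<close>

lemma height_shift_not_superset:
  assumes w: "\<forall>i\<in>{0..d}. w i = v i + c + (if i \<in> J then 1 else 0)"
    and J: "\<not> vmins d v \<subseteq> J"
  shows "height d w = height d v + card ({0..d} \<inter> J)"
proof -
  have "height d w = (\<Sum>i\<in>{0..d}. nat (v i - vmin d v) + (if i \<in> J then 1 else 0))"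
    unfolding height_def
  proof (rule sum.cong)
    fix i assume i: "i \<in> {0..d}"
    thus "nat (w i - vmin d w) = nat (v i - vmin d v) + (if i \<in> J then 1 else 0)"
      using w i vmin_le[OF i, of v] unfolding vmin_shift_not_superset[OF w J] by auto
  qed simp
  also have "\<dots> = height d v + (\<Sum>i\<in>{0..d}. if i \<in> J then 1 else 0)"
    by (simp add: height_def sum.distrib)
  also have "(\<Sum>i\<in>{0..d}. if i \<in> J then 1 else 0) = (\<Sum>i\<in>{0..d} \<inter> J. 1)"
    by (intro sum.mono_neutral_cong_right) auto
  finally show ?thesis by simp
qed

lemma height_eq_0_iff: "height d v = 0 \<longleftrightarrow> (\<forall>i\<in>{0..d}. v i = vmin d v)"
proof -
  have "height d v = 0 \<longleftrightarrow> (\<forall>i\<in>{0..d}. v i \<le> vmin d v)"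
    unfolding height_def by simp
  also have "\<dots> \<longleftrightarrow> (\<forall>i\<in>{0..d}. v i = vmin d v)"
    using vmin_le[of _ d v] by (auto intro: order.antisym)
  finally show ?thesis .
qed

lemma vmins_eq_all_iff: "vmins d v = {0..d} \<longleftrightarrow> height d v = 0"
  unfolding height_eq_0_iff by (auto simp: vmins_def)

text \<open>If all entries are within 1 of the minimum, the height just counts the non-minimal ones.
  This is the case distinction in the uniqueness of gates: either the gate is the target itself, or
  some coordinate leaves room to move the target.\<close>

lemma height_gt_imp_large_entry:
  assumes "height d v \<noteq> card ({0..d} - vmins d v)"
  shows "\<exists>i\<in>{0..d}. v i \<ge> vmin d v + 2"
proof (rule ccontr)
  assume "\<not> ?thesis"
  hence *: "v i = vmin d v \<or> v i = vmin d v + 1" if "i \<in> {0..d}" for i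
    using that vmin_le[OF that, of v] by force
  have "height d v = (\<Sum>i\<in>{0..d} - vmins d v. 1)"
    unfolding height_def using * by (intro sum.mono_neutral_cong_right) (fastforce simp: vmins_def)+
  thus False
    using assms by simp
qed

text \<open>Lowering one entry by 1 is, up to a constant, raising all the others.\<close>

lemma lower_entry_minimal:
  assumes "\<forall>j\<in>{0..d}. w j = v j + c - (if j = i then 1 else 0)" "i \<in> vmins d v"
  shows "height d v \<le> height d w"
proof -
  have "\<not> vmins d v \<subseteq> {0..d} - {i}"
    using assms(2) by auto
  moreover have "\<forall>j\<in>{0..d}. w j = v j + (c - 1) + (if j \<in> {0..d} - {i} then 1 else 0)"
    using assms(1) by auto
  ultimately show ?thesis
    using height_shift_not_superset[of d w v "c - 1" "{0..d} - {i}"] by simp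
qed

text \<open>The complement of \<open>i\<close> contains all minimal entries, so the height drops by
  1. A gap of at least 2 keeps \<open>i\<close> non-minimal after the lowering; with a gap of 1 it
  would join \<open>vmins\<close>.\<close>

lemma lower_entry_not_minimal:
  assumes w: "\<forall>j\<in>{0..d}. w j = v j + c - (if j = i then 1 else 0)"
    and i: "i \<in> {0..d}" "i \<notin> vmins d v"
  shows "height d v = Suc (height d w)"
    and "vmins d v \<subseteq> vmins d w"
    and "v i \<ge> vmin d v + 2 \<Longrightarrow> vmins d w = vmins d v"
proof -
  have w': "\<forall>j\<in>{0..d}. w j = v j + (c - 1) + (if j \<in> {0..d} - {i} then 1 else 0)"
    using w by auto
  have sub: "vmins d v \<subseteq> {0..d} - {i}"
    using i(2) by (auto simp: vmins_def)
  have "{0..d} - ({0..d} - {i}) = {i}"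
    using i by auto
  thus "height d v = Suc (height d w)"
    using height_shift_superset[OF w' sub] by simp
  have m: "vmin d w = vmin d v + c"
    using vmin_shift_superset[OF w' sub] by simp
  show "vmins d v \<subseteq> vmins d w"
    using w i m unfolding vmins_def by auto
  show "v i \<ge> vmin d v + 2 \<Longrightarrow> vmins d w = vmins d v"
  proof -
    assume "v i \<ge> vmin d v + 2"
    hence "w j = vmin d w \<longleftrightarrow> v j = vmin d v" if "j \<in> {0..d}" for j
      using w m that by (cases "j = i") auto
    thus ?thesis
      by (auto simp: vmins_def)
  qed
qed

lemma vmins_indicator:
  assumes "\<forall>i\<in>{0..d}. w i = c + (if i \<in> J then 1 else 0)" "J \<subset> {0..d}"
  shows "{0..d} - vmins d w = J"
proof -
  obtain i where "i \<in> {0..d}" "i \<notin> J"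
    using assms(2) by blast
  hence "vmin d w = c"
    using assms(1) by (intro vmin_eqI) auto
  thus ?thesis
    using assms by (auto simp: vmins_def split: if_splits)
qed

lemma sorted_wrt_psubset_iff:
  "sorted_wrt (\<lambda>u v. f u \<subset> f v) ys \<longleftrightarrow> (\<forall>t. Suc t < length ys \<longrightarrow> f (ys ! t) \<subset> f (ys ! Suc t))"
  by (rule sorted_wrt_iff_nth_Suc_transp) (auto simp: transp_def)

lemma strict_chain_values:
  fixes f :: "nat \<Rightarrow> nat"
  assumes mono: "\<And>t. Suc t < d \<Longrightarrow> f t < f (Suc t)" and bounds: "\<And>t. t < d \<Longrightarrow> 1 \<le> f t \<and> f t \<le> d"
    and "t < d"
  shows "f t = Suc t"
proof -
  have lower: "s < d \<Longrightarrow> Suc s \<le> f s" for s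
    using mono bounds by (induction s) (fastforce simp: Suc_le_eq)+
  have upper: "s < d \<Longrightarrow> f s + (d - Suc s) \<le> d" for s
  proof (induction "d - Suc s" arbitrary: s)
    case 0
    thus ?case using bounds by simp
  next
    case (Suc n)
    hence s: "n = d - Suc (Suc s)" "Suc s < d"
      by auto
    have "f (Suc s) + (d - Suc (Suc s)) \<le> d"
      by (rule Suc.hyps(1)[OF s])
    thus ?case
      using mono[OF s(2)] s(2) by linarith
  qed
  show ?thesis
    using lower[OF assms(3)] upper[OF assms(3)] assms(3) by simp
qed

lemma strictly_sorted_unique:
  fixes f :: "'a \<Rightarrow> 'b :: linorder"
  assumes "sorted_wrt (\<lambda>u v. f u < f v) xs" "sorted_wrt (\<lambda>u v. f u < f v) ys"
    and "set xs = set ys" "inj_on f (set xs)"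
  shows "xs = ys"
proof -
  have "map f xs = map f ys"
    by (rule strict_sorted_equal) (use assms in \<open>simp_all add: sorted_wrt_map\<close>)
  thus ?thesis
    using assms(3,4) by (simp add: inj_on_map_eq_map)
qed

subsection \<open>Coordinates on apartments\<close>

lemma simplicial_complex_face:
  "simplicial_complex X \<Longrightarrow> \<sigma> \<in> X \<Longrightarrow> \<tau> \<subseteq> \<sigma> \<Longrightarrow> \<tau> \<noteq> {} \<Longrightarrow> \<tau> \<in> X"
  unfolding simplicial_complex_def by blast

lemma simplicial_complex_finite: "simplicial_complex X \<Longrightarrow> \<sigma> \<in> X \<Longrightarrow> finite \<sigma>"
  unfolding simplicial_complex_def by blast

section \<open>Incidence in the building and in its apartments\<close>

locale oriented_building =
  fixes d :: nat
    and X :: "'v set set"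
    and \<A> :: "'v set set set"
    and ori :: "'v set \<Rightarrow> 'v list set"
    and lab :: "'v \<Rightarrow> nat"
  assumes building: "building_affine_A d X \<A>"
    and orientation: "orientation d X \<A> ori"
    and labelling: "labelling d X lab"
begin

lemma complex: "simplicial_complex X"
  using building unfolding building_affine_A_def by (elim conjE)

lemma apartment_complex: "A \<in> \<A> \<Longrightarrow> simplicial_complex A"
  using building unfolding building_affine_A_def by (elim conjE) blast

lemma apartment_subset: "A \<in> \<A> \<Longrightarrow> A \<subseteq> X"
  using building unfolding building_affine_A_def by (elim conjE) blast

lemma common_apartment:
  assumes "\<sigma> \<in> X" "\<tau> \<in> X"
  obtains A where "A \<in> \<A>" "\<sigma> \<in> A" "\<tau> \<in> A"
proof -
  have "\<forall>\<sigma>\<in>X. \<forall>\<tau>\<in>X. \<exists>A\<in>\<A>. \<sigma> \<in> A \<and> \<tau> \<in> A"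
    using building unfolding building_affine_A_def by (elim conjE)
  with assms that show ?thesis by blast
qed

lemma apartment_iso:
  assumes "A \<in> \<A>" "B \<in> \<A>" "\<sigma> \<in> A" "\<sigma> \<in> B" "\<tau> \<in> A" "\<tau> \<in> B"
  obtains g where "complex_iso g A B" "\<forall>v\<in>\<sigma> \<union> \<tau>. g v = v"
proof -
  have "\<forall>A\<in>\<A>. \<forall>B\<in>\<A>. \<forall>\<sigma>\<in>A \<inter> B. \<forall>\<tau>\<in>A \<inter> B.
        \<exists>f. complex_iso f A B \<and> (\<forall>v\<in>\<sigma> \<union> \<tau>. f v = v)"
    using building unfolding building_affine_A_def by (elim conjE)
  with assms that show ?thesis by blast
qed

lemma face_in: "\<sigma> \<in> X \<Longrightarrow> \<tau> \<subseteq> \<sigma> \<Longrightarrow> \<tau> \<noteq> {} \<Longrightarrow> \<tau> \<in> X"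
  by (rule simplicial_complex_face[OF complex])

lemma simplex_finite: "\<sigma> \<in> X \<Longrightarrow> finite \<sigma>"
  by (rule simplicial_complex_finite[OF complex])

lemma simplex_nonempty: "\<sigma> \<in> X \<Longrightarrow> \<sigma> \<noteq> {}"
  using complex unfolding simplicial_complex_def by blast

lemma vertices_subset: "\<sigma> \<in> A \<Longrightarrow> \<sigma> \<subseteq> vertices A"
  by (auto simp: vertices_def)

lemma vertex_in:
  assumes "A \<in> \<A>" "v \<in> vertices A"
  shows "{v} \<in> A"
proof -
  obtain \<sigma> where "\<sigma> \<in> A" "{v} \<subseteq> \<sigma>"
    using assms(2) by (auto simp: vertices_def)
  thus ?thesis
    using apartment_complex[OF assms(1)] unfolding simplicial_complex_def by blast
qed

lemma apartment_face: "A \<in> \<A> \<Longrightarrow> \<sigma> \<in> A \<Longrightarrow> \<tau> \<subseteq> \<sigma> \<Longrightarrow> \<tau> \<noteq> {} \<Longrightarrow> \<tau> \<in> A"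
  by (rule simplicial_complex_face[OF apartment_complex])

text \<open>The axioms place \<open>\<sigma>\<close> in some apartment \<open>B\<close>, not in
  \<open>A\<close>. Vertices are added one by one: the isomorphism from \<open>A\<close> to
  \<open>B\<close> that fixes the faces \<open>F\<close> and \<open>{v}\<close> fixes every vertex
  of \<open>insert v F\<close>, so by injectivity the simplex of \<open>A\<close> mapped onto this
  set is the set itself.\<close>

lemma apartment_full:
  assumes A: "A \<in> \<A>" and \<sigma>: "\<sigma> \<in> X" "\<sigma> \<subseteq> vertices A"
  shows "\<sigma> \<in> A"
proof -
  have "\<tau> \<noteq> {} \<Longrightarrow> \<tau> \<subseteq> \<sigma> \<Longrightarrow> \<tau> \<in> A" if "finite \<tau>" for \<tau>
    using that
  proof (induction \<tau> rule: finite_induct)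
    case (insert v F)
    have v: "{v} \<in> A"
      using insert.prems \<sigma>(2) A vertex_in by blast
    show ?case
    proof (cases "F = {}")
      case False
      hence F: "F \<in> A"
        using insert by blast
      have in_X: "insert v F \<in> X"
        using \<sigma>(1) insert.prems face_in by blast
      obtain B where B: "B \<in> \<A>" "insert v F \<in> B"
        by (rule common_apartment[OF in_X in_X])
      have vB: "{v} \<in> B"
        by (rule apartment_face[OF B]) auto
      have FB: "F \<in> B"
        by (rule apartment_face[OF B]) (use False in auto)
      obtain g where g: "complex_iso g A B" "\<forall>u\<in>F \<union> {v}. g u = u"
        by (rule apartment_iso[OF A B(1) F FB v vB])
      obtain \<rho> where \<rho>: "\<rho> \<in> A" "g ` \<rho> = insert v F"
        using g(1) B(2) unfolding complex_iso_def by blast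
      have "g ` insert v F = insert v F"
        using g(2) by force
      moreover have "inj_on g (vertices A)"
        using g(1) by (simp add: complex_iso_def bij_betw_def)
      moreover have "\<rho> \<subseteq> vertices A" "insert v F \<subseteq> vertices A"
        using vertices_subset[OF \<rho>(1)] insert.prems(2) \<sigma>(2) by (blast, blast)
      ultimately have "\<rho> = insert v F"
        using \<rho>(2) inj_on_image_eq_iff by metis
      with \<rho>(1) show ?thesis by simp
    qed (use v in simp)
  qed simp
  thus ?thesis
    using simplex_finite simplex_nonempty \<sigma>(1) by blast
qed

text \<open>The coordinates given by the orientation, with each class modulo the diagonal replaced
  by a chosen integer vector. This is why every equation holds up to an additive constant.\<close>

definition chart :: "'v set set \<Rightarrow> ('v \<Rightarrow> nat \<Rightarrow> int) \<Rightarrow> bool" where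
  "chart A c \<longleftrightarrow>
     (\<forall>x\<in>vertices A. \<forall>y\<in>vertices A. (\<exists>k. \<forall>i\<in>{0..d}. c x i = c y i + k) \<longrightarrow> x = y) \<and>
     (\<forall>v. \<exists>x\<in>vertices A. \<exists>k. \<forall>i\<in>{0..d}. c x i = v i + k) \<and>
     (\<forall>k xs. length xs = Suc k \<and> set xs \<subseteq> vertices A \<longrightarrow>
        (pointed X ori k xs \<longleftrightarrow>
          (\<exists>J. (\<forall>t<k. J t \<noteq> {} \<and> J t \<subset> {0..d}) \<and> (\<forall>t. Suc t < k \<longrightarrow> J t \<subset> J (Suc t)) \<and>
             (\<forall>t<k. \<exists>b. \<forall>i\<in>{0..d}. c (xs ! t) i = c (xs ! k) i + b + (if i \<in> J t then 1 else 0)))))"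

lemma equiv_diagonal_rel: "equiv (int_vectors d) (diagonal_rel d)"
proof (rule equivI)
  show "refl_on (int_vectors d) (diagonal_rel d)"
    by (auto simp: refl_on_def diagonal_rel_def intro: exI[of _ 0])
  show "sym (diagonal_rel d)"
  proof (rule symI)
    fix a b assume "(a, b) \<in> diagonal_rel d"
    then obtain c where "a \<in> int_vectors d" "b \<in> int_vectors d" "\<forall>i\<in>{0..d}. a i = b i + c"
      by (auto simp: diagonal_rel_def)
    hence "\<forall>i\<in>{0..d}. b i = a i + (- c)" "a \<in> int_vectors d" "b \<in> int_vectors d"
      by auto
    thus "(b, a) \<in> diagonal_rel d"
      unfolding diagonal_rel_def by blast
  qed
  show "trans (diagonal_rel d)"
  proof (rule transI)
    fix a b e assume *: "(a, b) \<in> diagonal_rel d" "(b, e) \<in> diagonal_rel d"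
    then obtain c c' where "\<forall>i\<in>{0..d}. a i = b i + c" "\<forall>i\<in>{0..d}. b i = e i + c'"
      unfolding diagonal_rel_def by blast
    hence "\<forall>i\<in>{0..d}. a i = e i + (c + c')"
      by auto
    moreover have "a \<in> int_vectors d" "e \<in> int_vectors d"
      using * unfolding diagonal_rel_def by (blast, blast)
    ultimately show "(a, e) \<in> diagonal_rel d"
      unfolding diagonal_rel_def by blast
  qed
qed (auto simp: diagonal_rel_def)

lemma chart_exists:
  assumes "A \<in> \<A>"
  shows "\<exists>c. chart A c"
proof -
  let ?V = "vertices A"
  obtain \<phi> where \<phi>: "bij_betw \<phi> ?V (apartment_vertices d)"
    and pt: "\<And>k xs. length xs = Suc k \<Longrightarrow> set xs \<subseteq> ?V \<Longrightarrow>
      pointed X ori k xs \<longleftrightarrow> flag_tuple d k (map \<phi> xs)"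
    using orientation assms unfolding orientation_def by blast
  define c where "c x = (SOME a. a \<in> \<phi> x)" for x
  note eq = equiv_diagonal_rel
  have cls: "\<phi> x \<in> int_vectors d // diagonal_rel d" if "x \<in> ?V" for x
    using \<phi> that unfolding apartment_vertices_def bij_betw_def by blast
  have cin: "c x \<in> \<phi> x" if "x \<in> ?V" for x
    using in_quotient_imp_non_empty[OF eq cls[OF that]] unfolding c_def by (simp add: some_in_eq)
  have rel: "a \<in> \<phi> x \<longleftrightarrow> (c x, a) \<in> diagonal_rel d" if "x \<in> ?V" for x a
    using cin[OF that] quotient_eq_iff[OF eq cls[OF that] cls[OF that]]
      in_quotient_imp_closed[OF eq cls[OF that]] by blast
  have repr: "represents_difference d J (\<phi> x) (\<phi> y) \<longleftrightarrow>
      (\<exists>b. \<forall>i\<in>{0..d}. c x i = c y i + b + (if i \<in> J then 1 else 0))"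
    if xy: "x \<in> ?V" "y \<in> ?V" for x y J
  proof
    assume "represents_difference d J (\<phi> x) (\<phi> y)"
    then obtain a b where ab: "a \<in> \<phi> x" "b \<in> \<phi> y"
        "\<forall>i\<in>{0..d}. a i - b i = (if i \<in> J then 1 else 0)"
      unfolding represents_difference_def by blast
    obtain m n where "\<forall>i\<in>{0..d}. c x i = a i + m" "\<forall>i\<in>{0..d}. c y i = b i + n"
      using ab rel xy unfolding diagonal_rel_def by blast
    hence "\<forall>i\<in>{0..d}. c x i = c y i + (m - n) + (if i \<in> J then 1 else 0)"
      using ab(3) by (auto split: if_splits)
    thus "\<exists>b. \<forall>i\<in>{0..d}. c x i = c y i + b + (if i \<in> J then 1 else 0)" ..
  next
    assume "\<exists>b. \<forall>i\<in>{0..d}. c x i = c y i + b + (if i \<in> J then 1 else 0)"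
    then obtain b where b: "\<forall>i\<in>{0..d}. c x i = c y i + b + (if i \<in> J then 1 else 0)" ..
    \<comment> \<open>The representative of the class of \<open>y\<close> shifted so that
      \<open>c x - e\<close> is exactly the indicator of \<open>J\<close>; the restriction keeps it
      extensional, as members of \<open>int_vectors\<close> must be.\<close>
    define e where "e = (\<lambda>i\<in>{0..d}. c y i + b)"
    have "c y \<in> int_vectors d"
      using rel[OF xy(2)] cin[OF xy(2)] by (auto simp: diagonal_rel_def)
    moreover have "e \<in> int_vectors d"
      by (simp add: e_def int_vectors_def)
    moreover have "\<forall>i\<in>{0..d}. c y i = e i + (- b)"
      by (simp add: e_def)
    ultimately have "(c y, e) \<in> diagonal_rel d"
      unfolding diagonal_rel_def by blast
    hence "e \<in> \<phi> y"
      using rel xy by blast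
    thus "represents_difference d J (\<phi> x) (\<phi> y)"
      unfolding represents_difference_def using cin[OF xy(1)] b
      by (intro bexI[of _ "c x"] bexI[of _ e]) (auto simp: e_def)
  qed
  have "x = y" if xy: "x \<in> ?V" "y \<in> ?V" and k: "\<forall>i\<in>{0..d}. c x i = c y i + k" for x y k
  proof -
    have "c x \<in> int_vectors d" "c y \<in> int_vectors d"
      using rel xy cin by (auto simp: diagonal_rel_def)
    hence "(c x, c y) \<in> diagonal_rel d"
      using k unfolding diagonal_rel_def by blast
    hence "\<phi> x = \<phi> y"
      using quotient_eqI[OF eq cls cls] xy cin by blast
    thus ?thesis
      using \<phi> xy by (meson bij_betw_def inj_onD)
  qed
  moreover have "\<exists>x\<in>?V. \<exists>k. \<forall>i\<in>{0..d}. c x i = v i + k" for v :: "nat \<Rightarrow> int"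
  proof -
    define e where "e = restrict v {0..d}"
    have e: "e \<in> int_vectors d"
      by (simp add: e_def int_vectors_def)
    hence "diagonal_rel d `` {e} \<in> apartment_vertices d"
      unfolding apartment_vertices_def by (rule quotientI)
    then obtain x where x: "x \<in> ?V" "\<phi> x = diagonal_rel d `` {e}"
      using \<phi> unfolding bij_betw_def by (metis imageE)
    hence "e \<in> \<phi> x"
      using equiv_class_self[OF eq e] by simp
    hence "(c x, e) \<in> diagonal_rel d"
      using rel[OF x(1)] by simp
    then obtain k where "\<forall>i\<in>{0..d}. c x i = e i + k"
      unfolding diagonal_rel_def by blast
    hence "\<forall>i\<in>{0..d}. c x i = v i + k"
      by (simp add: e_def)
    thus ?thesis
      using x(1) by blast
  qed
  moreover have "pointed X ori k xs \<longleftrightarrow>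
          (\<exists>J. (\<forall>t<k. J t \<noteq> {} \<and> J t \<subset> {0..d}) \<and> (\<forall>t. Suc t < k \<longrightarrow> J t \<subset> J (Suc t)) \<and>
             (\<forall>t<k. \<exists>b. \<forall>i\<in>{0..d}. c (xs ! t) i = c (xs ! k) i + b + (if i \<in> J t then 1 else 0)))"
    if xs: "length xs = Suc k" "set xs \<subseteq> ?V" for k xs
  proof -
    have "represents_difference d J (map \<phi> xs ! t) (map \<phi> xs ! k) \<longleftrightarrow>
        (\<exists>b. \<forall>i\<in>{0..d}. c (xs ! t) i = c (xs ! k) i + b + (if i \<in> J then 1 else 0))" if "t < k" for t J
      using repr[of "xs ! t" "xs ! k" J] that xs by (simp add: subset_iff)
    hence "(\<forall>t<k. represents_difference d (J t) (map \<phi> xs ! t) (map \<phi> xs ! k)) \<longleftrightarrow>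
        (\<forall>t<k. \<exists>b. \<forall>i\<in>{0..d}. c (xs ! t) i = c (xs ! k) i + b + (if i \<in> J t then 1 else 0))" for J
      by blast
    thus ?thesis
      unfolding pt[OF xs] flag_tuple_def by (simp only:)
  qed
  ultimately have "chart A c"
    unfolding chart_def by (intro conjI ballI allI impI; (elim exE conjE)?) (assumption | blast)+
  thus ?thesis
    by (rule exI[of _ c])
qed

definition crd :: "'v set set \<Rightarrow> 'v \<Rightarrow> nat \<Rightarrow> int" where
  "crd A = (SOME c. chart A c)"

lemma chart_crd: "A \<in> \<A> \<Longrightarrow> chart A (crd A)"
  unfolding crd_def by (rule someI_ex[OF chart_exists])

lemma crd_inj:
  assumes "A \<in> \<A>" "x \<in> vertices A" "y \<in> vertices A" "\<forall>i\<in>{0..d}. crd A x i = crd A y i + k"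
  shows "x = y"
proof -
  have "\<forall>x\<in>vertices A. \<forall>y\<in>vertices A. (\<exists>k. \<forall>i\<in>{0..d}. crd A x i = crd A y i + k) \<longrightarrow> x = y"
    using chart_crd[OF assms(1)] unfolding chart_def by (elim conjE)
  with assms show ?thesis by blast
qed

lemma crd_surj:
  assumes "A \<in> \<A>"
  obtains x k where "x \<in> vertices A" "\<forall>i\<in>{0..d}. crd A x i = v i + k"
proof -
  have "\<forall>v. \<exists>x\<in>vertices A. \<exists>k. \<forall>i\<in>{0..d}. crd A x i = v i + k"
    using chart_crd[OF assms] unfolding chart_def by (elim conjE)
  with that show ?thesis by blast
qed

lemma pointed_iff_flag:
  assumes "A \<in> \<A>" "length xs = Suc k" "set xs \<subseteq> vertices A"
  shows "pointed X ori k xs \<longleftrightarrow>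
     (\<exists>J. (\<forall>t<k. J t \<noteq> {} \<and> J t \<subset> {0..d}) \<and> (\<forall>t. Suc t < k \<longrightarrow> J t \<subset> J (Suc t)) \<and>
        (\<forall>t<k. \<exists>b. \<forall>i\<in>{0..d}. crd A (xs ! t) i = crd A (xs ! k) i + b + (if i \<in> J t then 1 else 0)))"
proof -
  note chart_crd[OF assms(1), unfolded chart_def, THEN conjunct2, THEN conjunct2]
  from this[rule_format, of xs k] assms show ?thesis by blast
qed

text \<open>If \<open>u\<close> is a neighbour of \<open>x\<close> in \<open>A\<close> then \<open>dir A x u\<close> is the set \<open>J\<close> such that
  \<open>\<Sum>\<^sub>j\<^sub>\<in>\<^sub>J e\<^sub>j\<close> represents \<open>u - x\<close>; for other \<open>u\<close> it has no such meaning.\<close>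

definition disp :: "'v set set \<Rightarrow> 'v \<Rightarrow> 'v \<Rightarrow> nat \<Rightarrow> int" where
  "disp A x y i = crd A y i - crd A x i"

definition dir :: "'v set set \<Rightarrow> 'v \<Rightarrow> 'v \<Rightarrow> nat set" where
  "dir A x u = {0..d} - vmins d (disp A x u)"

text \<open>The index set need not be quantified: if \<open>u - x\<close> is an indicator up to a
  constant, the set can only be the complement of the minimal entries. That it is nonempty follows
  from \<open>x \<noteq> u\<close>.\<close>

definition nb :: "'v set set \<Rightarrow> 'v \<Rightarrow> 'v \<Rightarrow> bool" where
  "nb A x u \<longleftrightarrow> x \<in> vertices A \<and> u \<in> vertices A \<and> x \<noteq> u \<and>
     (\<exists>c. \<forall>i\<in>{0..d}. crd A u i = crd A x i + c + (if i \<in> dir A x u then 1 else 0))"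

lemma dir_psubset: "dir A x u \<subset> {0..d}"
  unfolding dir_def using vmins_nonempty[of d "disp A x u"] vmins_subset[of d "disp A x u"] by blast

lemma nbI:
  assumes A: "A \<in> \<A>" and xu: "x \<in> vertices A" "u \<in> vertices A" and J: "J \<noteq> {}" "J \<subset> {0..d}"
    and c: "\<forall>i\<in>{0..d}. crd A u i = crd A x i + c + (if i \<in> J then 1 else 0)"
  shows "nb A x u" "dir A x u = J"
proof -
  show dir: "dir A x u = J"
    unfolding dir_def by (rule vmins_indicator[where c = c]) (use c J in \<open>auto simp: disp_def\<close>)
  have "x \<noteq> u"
  proof
    assume "x = u"
    with c have *: "\<forall>i\<in>{0..d}. c + (if i \<in> J then 1 else 0) = 0"
      by auto
    obtain i j where "i \<in> J" "i \<in> {0..d}" "j \<notin> J" "j \<in> {0..d}"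
      using J by blast
    with * have "c + 1 = 0" "c = 0"
      by (metis add_0_right)+
    thus False by simp
  qed
  thus "nb A x u"
    unfolding nb_def dir using xu c by blast
qed

lemma nb_dir_nonempty:
  assumes "A \<in> \<A>" "nb A x u"
  shows "dir A x u \<noteq> {}"
proof
  assume "dir A x u = {}"
  with assms(2) obtain c where "x \<in> vertices A" "u \<in> vertices A" "x \<noteq> u"
      "\<forall>i\<in>{0..d}. crd A u i = crd A x i + c"
    by (auto simp: nb_def)
  with crd_inj[OF assms(1)] show False by blast
qed

lemma nb_inj:
  assumes A: "A \<in> \<A>" and "nb A x u" "nb A x w" "dir A x u = dir A x w"
  shows "u = w"
proof -
  obtain c c' where
    "\<forall>i\<in>{0..d}. crd A u i = crd A x i + c + (if i \<in> dir A x w then 1 else 0)"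
    "\<forall>i\<in>{0..d}. crd A w i = crd A x i + c' + (if i \<in> dir A x w then 1 else 0)"
    using assms unfolding nb_def by metis
  hence "\<forall>i\<in>{0..d}. crd A u i = crd A w i + (c - c')"
    by auto
  moreover have "u \<in> vertices A" "w \<in> vertices A"
    using assms by (auto simp: nb_def)
  ultimately show ?thesis
    using crd_inj[OF A] by blast
qed

lemma ex_nb:
  assumes A: "A \<in> \<A>" and x: "x \<in> vertices A" and J: "J \<noteq> {}" "J \<subset> {0..d}"
  obtains u where "nb A x u" "dir A x u = J"
proof -
  obtain u k where "u \<in> vertices A"
      "\<forall>i\<in>{0..d}. crd A u i = (crd A x i + (if i \<in> J then 1 else 0)) + k"
    using crd_surj[OF A, of "\<lambda>i. crd A x i + (if i \<in> J then 1 else 0)"] by blast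
  thus ?thesis
    using nbI[OF A x _ J, of u k] that by (auto simp: algebra_simps)
qed

text \<open>The sets of the flag are forced to be the directions seen from the last vertex. From
  here on, pointedness means a strict chain of directions at that vertex.\<close>

lemma pointed_snoc_iff:
  assumes A: "A \<in> \<A>" and V: "set ys \<subseteq> vertices A" "x \<in> vertices A"
  shows "pointed X ori (length ys) (ys @ [x]) \<longleftrightarrow>
    (\<forall>y\<in>set ys. nb A x y) \<and> sorted_wrt (\<lambda>u v. dir A x u \<subset> dir A x v) ys"
proof -
  let ?k = "length ys"
  have *: "pointed X ori ?k (ys @ [x]) \<longleftrightarrow>
     (\<exists>J. (\<forall>t<?k. J t \<noteq> {} \<and> J t \<subset> {0..d}) \<and> (\<forall>t. Suc t < ?k \<longrightarrow> J t \<subset> J (Suc t)) \<and>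
        (\<forall>t<?k. \<exists>b. \<forall>i\<in>{0..d}. crd A ((ys @ [x]) ! t) i =
           crd A ((ys @ [x]) ! ?k) i + b + (if i \<in> J t then 1 else 0)))" (is "_ \<longleftrightarrow> (\<exists>J. ?P J)")
    by (rule pointed_iff_flag[OF A]) (use V in auto)
  show ?thesis
    unfolding * sorted_wrt_psubset_iff
  proof
    assume "\<exists>J. ?P J"
    then obtain J where J: "?P J" by blast
    have nb: "nb A x (ys ! t) \<and> dir A x (ys ! t) = J t" if t: "t < ?k" for t
    proof -
      from J t obtain b where b: "J t \<noteq> {}" "J t \<subset> {0..d}"
        "\<forall>i\<in>{0..d}. crd A (ys ! t) i = crd A x i + b + (if i \<in> J t then 1 else 0)"
        by (force simp: nth_append)
      have "ys ! t \<in> vertices A"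
        using V(1) t by auto
      from nbI[OF A V(2) this b] show ?thesis by simp
    qed
    moreover have "\<forall>t. Suc t < ?k \<longrightarrow> J t \<subset> J (Suc t)"
      using J by (elim conjE)
    ultimately show "(\<forall>y\<in>set ys. nb A x y) \<and> (\<forall>t. Suc t < ?k \<longrightarrow> dir A x (ys ! t) \<subset> dir A x (ys ! Suc t))"
      by (auto simp: in_set_conv_nth)
  next
    assume R: "(\<forall>y\<in>set ys. nb A x y) \<and> (\<forall>t. Suc t < ?k \<longrightarrow> dir A x (ys ! t) \<subset> dir A x (ys ! Suc t))"
    have "?P (\<lambda>t. dir A x (ys ! t))"
    proof (intro conjI allI impI)
      fix t assume t: "t < ?k"
      hence nb: "nb A x (ys ! t)"
        using R by simp
      show "dir A x (ys ! t) \<noteq> {}" "dir A x (ys ! t) \<subset> {0..d}"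
        using nb_dir_nonempty[OF A nb] dir_psubset by auto
      show "\<exists>b. \<forall>i\<in>{0..d}. crd A ((ys @ [x]) ! t) i =
           crd A ((ys @ [x]) ! ?k) i + b + (if i \<in> dir A x (ys ! t) then 1 else 0)"
        using nb t unfolding nb_def by (simp add: nth_append)
    qed (use R in blast)
    thus "\<exists>J. ?P J"
      by (rule exI[of _ "\<lambda>t. dir A x (ys ! t)"])
  qed
qed

lemma pointed_edge_iff:
  assumes "A \<in> \<A>" "x \<in> vertices A" "u \<in> vertices A"
  shows "pointed X ori 1 [u, x] \<longleftrightarrow> nb A x u"
  using pointed_snoc_iff[OF assms(1), of "[u]" x] assms by simp

lemma pointed_triangle_iff:
  assumes "A \<in> \<A>" "x \<in> vertices A" "u \<in> vertices A" "w \<in> vertices A"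
  shows "pointed X ori 2 [u, w, x] \<longleftrightarrow> nb A x u \<and> nb A x w \<and> dir A x u \<subset> dir A x w"
  using pointed_snoc_iff[OF assms(1), of "[u, w]" x] assms by (simp add: numeral_2_eq_2)

lemma ori_cyclic: "\<sigma> \<in> X \<Longrightarrow> cyclic_ordering \<sigma> (ori \<sigma>)"
  using orientation unfolding orientation_def by (elim conjE) simp

lemma pointedD:
  assumes "pointed X ori k xs"
  shows "set xs \<in> X" "length xs = Suc k" "distinct xs" "xs \<noteq> []" "set xs \<in> simplices X k"
proof -
  show *: "set xs \<in> X" "length xs = Suc k"
    using assms by (auto simp: pointed_def)
  obtain ys where "distinct ys" "ori (set xs) = {rotate n ys | n. True}"
    using ori_cyclic[OF *(1)] unfolding cyclic_ordering_def by blast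
  thus "distinct xs"
    using assms unfolding pointed_def by auto
  show "xs \<noteq> []"
    using * by auto
  show "set xs \<in> simplices X k"
    using * \<open>distinct xs\<close> by (simp add: simplices_def distinct_card)
qed

text \<open>A cyclic ordering can be rotated until any prescribed vertex comes last. Later the
  vertex farthest from \<open>z\<close> is put there.\<close>

lemma ex_pointed_last:
  assumes "\<sigma> \<in> X" "x \<in> \<sigma>"
  obtains ys where "pointed X ori (length ys) (ys @ [x])" "set (ys @ [x]) = \<sigma>"
proof -
  obtain xs where xs: "distinct xs" "set xs = \<sigma>" "ori \<sigma> = {rotate n xs | n. True}"
    using ori_cyclic[OF assms(1)] unfolding cyclic_ordering_def by blast
  obtain as bs where ab: "xs = as @ x # bs"
    using xs(2) assms(2) by (metis split_list)
  have "bs @ as @ [x] = rotate (length (as @ [x])) xs"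
    unfolding ab using rotate_append[of "as @ [x]" bs] by simp
  hence "bs @ as @ [x] \<in> ori \<sigma>"
    unfolding xs(3) by blast
  moreover have "set (bs @ as @ [x]) = \<sigma>"
    using xs(2) ab by auto
  ultimately show ?thesis
    using that[of "bs @ as"] assms(1) unfolding pointed_def by auto
qed

text \<open>The only enumeration of a two-element simplex ending in \<open>x\<close> is
  \<open>[u, x]\<close>, so every edge is visible as an indicator vector from either end. In
  particular \<open>nb\<close> does not depend on the apartment, although \<open>dir\<close>
  does.\<close>

lemma edge_iff:
  assumes "A \<in> \<A>" "x \<in> vertices A" "u \<in> vertices A"
  shows "nb A x u \<longleftrightarrow> x \<noteq> u \<and> {u, x} \<in> X"
proof
  assume "nb A x u"
  thus "x \<noteq> u \<and> {u, x} \<in> X"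
    using pointed_edge_iff[OF assms] by (auto simp: nb_def pointed_def)
next
  assume *: "x \<noteq> u \<and> {u, x} \<in> X"
  then obtain ys where ys: "pointed X ori (length ys) (ys @ [x])" "set (ys @ [x]) = {u, x}"
    using ex_pointed_last[of "{u, x}" x] by auto
  from pointedD(3)[OF ys(1)] ys(2) * have "distinct ys" "set ys = {u}"
    by auto
  hence "ys = [u]"
    by (cases ys; cases "tl ys") auto
  thus "nb A x u"
    using ys pointed_edge_iff[OF assms] by simp
qed

section \<open>Directed distances within one apartment\<close>

definition ht :: "'v set set \<Rightarrow> 'v \<Rightarrow> 'v \<Rightarrow> nat" where
  "ht A x z = height d (disp A z x)"

definition low :: "'v set set \<Rightarrow> 'v \<Rightarrow> 'v \<Rightarrow> nat set" where
  "low A x z = vmins d (disp A z x)"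

lemma low_nonempty: "low A x z \<noteq> {}"
  by (simp add: low_def vmins_nonempty)

lemma low_subset: "low A x z \<subseteq> {0..d}"
  by (simp add: low_def vmins_subset)

lemma ht_eq_0_iff:
  assumes "A \<in> \<A>" "x \<in> vertices A" "z \<in> vertices A"
  shows "ht A x z = 0 \<longleftrightarrow> x = z"
proof
  assume "ht A x z = 0"
  hence "\<forall>i\<in>{0..d}. crd A x i = crd A z i + vmin d (disp A z x)"
    unfolding ht_def height_eq_0_iff by (simp add: disp_def algebra_simps)
  thus "x = z"
    using crd_inj assms by blast
next
  assume "x = z"
  moreover have "vmin d (disp A z z) = 0"
    by (rule vmin_eqI[of 0]) (auto simp: disp_def)
  ultimately show "ht A x z = 0"
    unfolding ht_def height_eq_0_iff by (simp add: disp_def)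
qed

lemma low_psubset:
  assumes "A \<in> \<A>" "x \<in> vertices A" "z \<in> vertices A" "x \<noteq> z"
  shows "low A x z \<subset> {0..d}"
  using assms ht_eq_0_iff[OF assms(1-3)] vmins_eq_all_iff[of d "disp A z x"] low_subset[of A x z]
  unfolding low_def ht_def by auto

lemma nb_disp:
  assumes "nb A x u"
  obtains c where "\<forall>i\<in>{0..d}. disp A z u i = disp A z x i + c + (if i \<in> dir A x u then 1 else 0)"
  using assms unfolding nb_def disp_def by (force simp: algebra_simps)

lemma ht_superset:
  assumes "nb A x u" "low A x z \<subseteq> dir A x u"
  shows "ht A x z = ht A u z + card ({0..d} - dir A x u)"
proof -
  obtain c where "\<forall>i\<in>{0..d}. disp A z u i = disp A z x i + c + (if i \<in> dir A x u then 1 else 0)"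
    using nb_disp[OF assms(1)] .
  from height_shift_superset[OF this] assms(2) show ?thesis
    by (simp add: ht_def low_def)
qed

lemma ht_not_superset:
  assumes "nb A x u" "\<not> low A x z \<subseteq> dir A x u"
  shows "ht A u z = ht A x z + card (dir A x u)"
proof -
  obtain c where "\<forall>i\<in>{0..d}. disp A z u i = disp A z x i + c + (if i \<in> dir A x u then 1 else 0)"
    using nb_disp[OF assms(1)] .
  moreover have "{0..d} \<inter> dir A x u = dir A x u"
    using dir_psubset by blast
  ultimately show ?thesis
    using height_shift_not_superset[of d "disp A z u" "disp A z x" c "dir A x u"] assms(2)
    by (simp add: ht_def low_def)
qed

lemma finite_dir: "finite (dir A x u)"
  using dir_psubset finite_subset[of "dir A x u" "{0..d}"] by blast

lemma card_dir_le: "card (dir A x u) \<le> d"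
  using psubset_card_mono[OF _ dir_psubset, of A x u] by simp

lemma card_dir_pos: "A \<in> \<A> \<Longrightarrow> nb A x u \<Longrightarrow> 0 < card (dir A x u)"
  using nb_dir_nonempty finite_dir card_gt_0_iff by blast

lemma card_codir: "card ({0..d} - dir A x u) = Suc d - card (dir A x u)"
  using card_Diff_subset[OF finite_dir, of A x u "{0..d}"] dir_psubset[of A x u] by auto

lemma ht_less_iff:
  assumes "A \<in> \<A>" "nb A x u"
  shows "ht A u z < ht A x z \<longleftrightarrow> low A x z \<subseteq> dir A x u"
  using ht_superset[OF assms(2), of z] ht_not_superset[OF assms(2), of z]
    card_codir[of A x u] card_dir_le[of A x u] by force

lemma nb_vertices: "nb A x u \<Longrightarrow> x \<in> vertices A" "nb A x u \<Longrightarrow> u \<in> vertices A"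
  by (auto simp: nb_def)

text \<open>This and its counterpart for \<open>ht A u x\<close> recover the size of a direction
  from heights, which later makes that size independent of the apartment.\<close>

lemma ht_nb_from:
  assumes "A \<in> \<A>" "nb A x u"
  shows "ht A x u = Suc d - card (dir A x u)"
proof -
  obtain c where c: "\<forall>i\<in>{0..d}. crd A u i = crd A x i + c + (if i \<in> dir A x u then 1 else 0)"
    using assms(2) by (auto simp: nb_def)
  have "{0..d} - vmins d (disp A u x) = {0..d} - dir A x u"
  proof (rule vmins_indicator)
    show "\<forall>i\<in>{0..d}. disp A u x i = (- c - 1) + (if i \<in> {0..d} - dir A x u then 1 else 0)"
      using c by (auto simp: disp_def)
    show "{0..d} - dir A x u \<subset> {0..d}"
      using nb_dir_nonempty[OF assms] dir_psubset[of A x u] by blast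
  qed
  hence "low A x u \<subseteq> dir A x u"
    unfolding low_def using vmins_subset[of d "disp A u x"] by blast
  moreover have "ht A u u = 0"
    using ht_eq_0_iff[OF assms(1)] nb_vertices[OF assms(2)] by simp
  ultimately show ?thesis
    using ht_superset[OF assms(2), of u] card_codir by simp
qed

lemma ht_nb_to:
  assumes "A \<in> \<A>" "nb A x u"
  shows "ht A u x = card (dir A x u)"
proof -
  have "ht A x x = 0"
    using ht_eq_0_iff[OF assms(1)] nb_vertices[OF assms(2)] by simp
  hence "low A x x = {0..d}"
    using vmins_eq_all_iff by (simp add: low_def ht_def)
  thus ?thesis
    using ht_not_superset[OF assms(2), of x] dir_psubset[of A x u] \<open>ht A x x = 0\<close> by auto
qed

subsection \<open>Vertex types\<close>

text \<open>Adding a constant vector changes the coordinate sum by a multiple of d+1, so this is a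
  type of the vertex and not only of its representative. Its relation to \<open>lab\<close>, which
  is only known to be bijective on chambers, is established below.\<close>

definition tau :: "'v set set \<Rightarrow> 'v \<Rightarrow> int" where
  "tau A x = (\<Sum>i\<in>{0..d}. crd A x i) mod (int d + 1)"

lemma tau_nb:
  assumes "nb A x u"
  shows "tau A u = (tau A x + int (card (dir A x u))) mod (int d + 1)"
proof -
  obtain c where c: "\<forall>i\<in>{0..d}. crd A u i = crd A x i + c + (if i \<in> dir A x u then 1 else 0)"
    using assms by (auto simp: nb_def)
  have "(\<Sum>i\<in>{0..d}. crd A u i) =
      (\<Sum>i\<in>{0..d}. crd A x i) + (int d + 1) * c + (\<Sum>i\<in>{0..d}. if i \<in> dir A x u then 1 else 0)"
    using c by (simp add: sum.distrib)
  also have "(\<Sum>i\<in>{0..d}. if i \<in> dir A x u then 1 else 0 :: int) = (\<Sum>i\<in>dir A x u. 1)"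
    using dir_psubset[of A x u] by (intro sum.mono_neutral_cong_right) auto
  finally have "(\<Sum>i\<in>{0..d}. crd A u i) =
      ((\<Sum>i\<in>{0..d}. crd A x i) + int (card (dir A x u))) + (int d + 1) * c"
    by simp
  thus ?thesis
    unfolding tau_def by (simp only: mod_mult_self2 mod_add_left_eq)
qed

section \<open>Chambers of an apartment and labels as functions of the type\<close>

definition vert :: "'v set set \<Rightarrow> (nat \<Rightarrow> int) \<Rightarrow> 'v" where
  "vert A v = (SOME x. x \<in> vertices A \<and> (\<exists>k. \<forall>i\<in>{0..d}. crd A x i = v i + k))"

lemma vert_crd:
  assumes "A \<in> \<A>"
  obtains k where "vert A v \<in> vertices A" "\<forall>i\<in>{0..d}. crd A (vert A v) i = v i + k"
proof -
  have "\<exists>x. x \<in> vertices A \<and> (\<exists>k. \<forall>i\<in>{0..d}. crd A x i = v i + k)"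
    using crd_surj[OF assms, of v] by blast
  hence "vert A v \<in> vertices A \<and> (\<exists>k. \<forall>i\<in>{0..d}. crd A (vert A v) i = v i + k)"
    unfolding vert_def by (rule someI_ex)
  thus ?thesis using that by blast
qed

lemma vert_eqI:
  assumes A: "A \<in> \<A>" and x: "x \<in> vertices A" "\<forall>i\<in>{0..d}. crd A x i = v i + k"
  shows "vert A v = x"
proof -
  obtain k' where k': "vert A v \<in> vertices A" "\<forall>i\<in>{0..d}. crd A (vert A v) i = v i + k'"
    using vert_crd[OF A] .
  hence "\<forall>i\<in>{0..d}. crd A (vert A v) i = crd A x i + (k' - k)"
    using x by simp
  thus ?thesis
    using crd_inj[OF A k'(1) x(1)] by blast
qed

lemma vert_cong:
  assumes A: "A \<in> \<A>" and eq: "\<forall>i\<in>{0..d}. v i = w i + c"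
  shows "vert A v = vert A w"
proof -
  obtain k where k: "vert A w \<in> vertices A" "\<forall>i\<in>{0..d}. crd A (vert A w) i = w i + k"
    using vert_crd[OF A] .
  show ?thesis
    by (rule vert_eqI[OF A k(1), where k = "k - c"]) (use k eq in auto)
qed

definition raise :: "'v set set \<Rightarrow> 'v \<Rightarrow> nat set \<Rightarrow> 'v" where
  "raise A x J = vert A (\<lambda>i. crd A x i + (if i \<in> J then 1 else 0))"

lemma raise_nb:
  assumes "A \<in> \<A>" "x \<in> vertices A" "J \<noteq> {}" "J \<subset> {0..d}"
  shows "nb A x (raise A x J)" "dir A x (raise A x J) = J"
proof -
  obtain k where "raise A x J \<in> vertices A"
      "\<forall>i\<in>{0..d}. crd A (raise A x J) i = crd A x i + (if i \<in> J then 1 else 0) + k"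
    unfolding raise_def using vert_crd[OF assms(1)] .
  hence *: "raise A x J \<in> vertices A"
      "\<forall>i\<in>{0..d}. crd A (raise A x J) i = crd A x i + k + (if i \<in> J then 1 else 0)"
    by auto
  show "nb A x (raise A x J)" "dir A x (raise A x J) = J"
    by (rule nbI[OF assms(1,2) *(1) assms(3,4) *(2)])+
qed

text \<open>The prefixes of an ordering of the coordinates form a maximal flag, so every such
  ordering gives a chamber with last vertex \<open>x\<close>.\<close>

lemma pointed_chamber:
  assumes A: "A \<in> \<A>" "x \<in> vertices A" and js: "distinct js" "set js = {0..d}"
  shows "pointed X ori d (map (\<lambda>t. raise A x (set (take (Suc t) js))) [0..<d] @ [x])"
proof -
  have len: "length js = Suc d"
    using js distinct_card by fastforce
  have psub: "set (take s js) \<subset> set (take t js)" if "s < t" "t \<le> Suc d" for s t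
  proof
    show "set (take s js) \<subseteq> set (take t js)"
      using that by (intro set_take_subset_set_take) simp
    have "card (set (take s js)) = s" "card (set (take t js)) = t"
      using js(1) len that by (auto simp: distinct_card)
    thus "set (take s js) \<noteq> set (take t js)"
      using that by auto
  qed
  have raise: "nb A x (raise A x (set (take (Suc t) js)))"
      "dir A x (raise A x (set (take (Suc t) js))) = set (take (Suc t) js)" if "t < d" for t
  proof -
    have "set (take (Suc t) js) \<noteq> {}" "set (take (Suc t) js) \<subset> {0..d}"
      using psub[of 0 "Suc t"] psub[of "Suc t" "Suc d"] that len js(2) by auto
    from raise_nb[OF A this] show "nb A x (raise A x (set (take (Suc t) js)))"
        "dir A x (raise A x (set (take (Suc t) js))) = set (take (Suc t) js)" .
  qed
  let ?ys = "map (\<lambda>t. raise A x (set (take (Suc t) js))) [0..<d]"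
  have sorted: "sorted_wrt (\<lambda>u v. dir A x u \<subset> dir A x v) ?ys"
    unfolding sorted_wrt_map using raise(2) psub
    by (intro sorted_wrt_mono_rel[OF _ sorted_wrt_upt]) auto
  have nbs: "\<forall>y\<in>set ?ys. nb A x y"
    using raise(1) by auto
  hence "set ?ys \<subseteq> vertices A"
    using nb_vertices(2) by blast
  from pointed_snoc_iff[OF A(1) this A(2)] sorted nbs show ?thesis
    by simp
qed

lemma pointed_in_apartment:
  assumes "A \<in> \<A>" "pointed X ori k xs" "set xs \<subseteq> vertices A"
  shows "set xs \<in> A" "card (set xs) = Suc k"
  using apartment_full[OF assms(1) pointedD(1)[OF assms(2)] assms(3)] pointedD(2,3)[OF assms(2)]
  by (auto simp: distinct_card)

lemma chamber_exists:
  assumes "A \<in> \<A>" "x \<in> vertices A"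
  obtains C where "C \<in> A" "x \<in> C" "card C = Suc d"
proof -
  let ?xs = "map (\<lambda>t. raise A x (set (take (Suc t) [0..<Suc d]))) [0..<d] @ [x]"
  have p: "pointed X ori d ?xs"
    by (rule pointed_chamber[OF assms]) auto
  have "raise A x J \<in> vertices A" for J
    unfolding raise_def using vert_crd[OF assms(1)] by metis
  hence "set ?xs \<subseteq> vertices A"
    using assms(2) by auto
  from pointed_in_apartment[OF assms(1) p this] that[of "set ?xs"] show ?thesis
    by simp
qed

definition apartment_labelling :: "'v set set \<Rightarrow> ('v \<Rightarrow> nat) \<Rightarrow> bool" where
  "apartment_labelling A h \<longleftrightarrow> (\<forall>C\<in>A. card C = Suc d \<longrightarrow> bij_betw h C {0..d})"

text \<open>The chambers with vertices \<open>x, x + e\<^sub>i, x + e\<^sub>i + e\<^sub>j, \<dots>\<close> and \<open>x, x + e\<^sub>j, x + e\<^sub>i + e\<^sub>j, \<dots>\<close>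
  differ only in their second vertices.\<close>

lemma label_raise_singleton:
  assumes A: "A \<in> \<A>" "x \<in> vertices A" and h: "apartment_labelling A h"
    and ij: "i \<in> {0..d}" "j \<in> {0..d}" "i \<noteq> j"
  shows "h (raise A x {i}) = h (raise A x {j})"
proof -
  obtain n where d: "d = Suc n"
    using ij by (cases d) auto
  define rest where "rest = sorted_list_of_set ({0..d} - {i, j})"
  define P where "P = (\<lambda>t. raise A x (insert i (insert j (set (take t rest))))) ` {0..<n}"
  define ch where "ch js = set (map (\<lambda>t. raise A x (set (take (Suc t) js))) [0..<d] @ [x])" for js
  have "raise A x J \<in> vertices A" for J
    unfolding raise_def using vert_crd[OF A(1)] by metis
  hence V: "ch js \<subseteq> vertices A" for js
    using A(2) by (auto simp: ch_def)
  have ch: "ch js \<in> A \<and> card (ch js) = Suc d" if "distinct js" "set js = {0..d}" for js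
    using pointed_in_apartment[OF A(1) pointed_chamber[OF A that]] V[of js] unfolding ch_def by blast
  have split: "ch (a # b # rest) = insert (raise A x {a}) (insert x P)" if "{a, b} = {i, j}" for a b
  proof -
    have "insert a (insert b S) = insert i (insert j S)" for S :: "nat set"
      using that by auto
    thus ?thesis
      unfolding ch_def P_def d
      by (simp add: upt_conv_Cons map_Suc_upt[symmetric] del: upt_Suc)
  qed
  have bij: "bij_betw h (insert (raise A x {a}) (insert x P)) {0..d} \<and> raise A x {a} \<notin> insert x P"
    if ab: "{a, b} = {i, j}" for a b
  proof -
    have ds: "distinct (a # b # rest)" "set (a # b # rest) = {0..d}"
      using ab ij by (auto simp: rest_def doubleton_eq_iff)
    note c = ch[OF ds, unfolded split[OF ab]]
    have "card (insert x P) \<le> Suc n"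
      unfolding P_def using card_image_le[of "{0..<n}"] by (auto intro!: card_insert_le_m1)
    hence "raise A x {a} \<notin> insert x P"
      using c d by (auto simp: insert_absorb)
    thus ?thesis
      using c h unfolding apartment_labelling_def by blast
  qed
  \<comment> \<open>The common part \<open>insert x P\<close> uses up all labels but one, and both
    differing vertices must carry the one that remains.\<close>
  have "h (raise A x {a}) \<in> {0..d} - h ` insert x P \<and> {0..d} - h ` insert x P \<subseteq> {h (raise A x {a})}"
    if "{a, b} = {i, j}" for a b
    using bij[OF that] unfolding bij_betw_def inj_on_def by (auto simp: image_iff)
  from this[of i j] this[of j i] show ?thesis
    by (auto simp: insert_commute)
qed

text \<open>Replacing a unit vector \<open>e_j\<close> by \<open>e_0\<close> keeps the label, by the
  comparison of two adjacent chambers at \<open>v - e_j\<close>. All mass can thus be moved into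
  coordinate 0, and the induction is on the mass outside it, which is why nonnegative entries are
  assumed.\<close>

lemma label_vert_nonneg:
  assumes A: "A \<in> \<A>" and h: "apartment_labelling A h"
  shows "\<forall>i\<in>{0..d}. v i \<ge> 0 \<Longrightarrow> h (vert A v) = h (vert A (\<lambda>i. if i = 0 then \<Sum>i\<in>{0..d}. v i else 0))"
proof (induction "\<Sum>i\<in>{1..d}. nat (v i)" arbitrary: v)
  case 0
  hence "\<forall>i\<in>{1..d}. v i \<le> 0"
    by simp
  with 0 have "\<forall>i\<in>{1..d}. v i = 0"
    by (simp add: order.antisym)
  moreover from this have "(\<Sum>i\<in>{0..d}. v i) = v 0"
    by (simp add: sum.atLeast_Suc_atMost)
  ultimately have "\<forall>i\<in>{0..d}. v i = (if i = 0 then \<Sum>i\<in>{0..d}. v i else 0) + 0"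
    by auto
  thus ?case
    using vert_cong[OF A] by metis
next
  case (Suc n)
  have "\<exists>j\<in>{1..d}. nat (v j) \<noteq> 0"
    using Suc.hyps(2) by (metis nat.distinct(1) sum.neutral)
  then obtain j where j: "j \<in> {1..d}" "v j > 0"
    by auto
  define w where "w = v(j := v j - 1)"
  define x where "x = vert A w"
  obtain k where k: "x \<in> vertices A" "\<forall>i\<in>{0..d}. crd A x i = w i + k"
    unfolding x_def using vert_crd[OF A] .
  have raise: "raise A x {a} = vert A (w(a := w a + 1))" for a
    unfolding raise_def by (rule vert_cong[OF A, where c = k]) (use k(2) in auto)
  have "h (vert A v) = h (raise A x {j})"
    unfolding raise by (simp add: w_def)
  also have "\<dots> = h (raise A x {0})"
    using label_raise_singleton[OF A k(1) h, of j 0] j by auto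
  also have "\<dots> = h (vert A (w(0 := w 0 + 1)))"
    unfolding raise ..
  also have "\<dots> = h (vert A (\<lambda>i. if i = 0 then \<Sum>i\<in>{0..d}. (w(0 := w 0 + 1)) i else 0))"
  proof (rule Suc.hyps(1))
    have "(\<Sum>i\<in>{1..d}. nat (v i)) = (\<Sum>i\<in>{1..d}. nat ((w(0 := w 0 + 1)) i) + (if i = j then 1 else 0))"
      using j by (intro sum.cong) (auto simp: w_def)
    also have "\<dots> = (\<Sum>i\<in>{1..d}. nat ((w(0 := w 0 + 1)) i)) + 1"
      using j by (simp add: sum.distrib)
    finally show "n = (\<Sum>i\<in>{1..d}. nat ((w(0 := w 0 + 1)) i))"
      using Suc.hyps(2) by simp
    show "\<forall>i\<in>{0..d}. (w(0 := w 0 + 1)) i \<ge> 0"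
      using Suc.prems j by (auto simp: w_def)
  qed
  also have "(\<Sum>i\<in>{0..d}. (w(0 := w 0 + 1)) i) = (\<Sum>i\<in>{0..d}. v i)"
  proof -
    have "(\<Sum>i\<in>{0..d}. (w(0 := w 0 + 1)) i) =
        (\<Sum>i\<in>{0..d}. v i + (if i = 0 then 1 else 0) - (if i = j then 1 else 0))"
      using j by (intro sum.cong) (auto simp: w_def)
    also have "\<dots> = (\<Sum>i\<in>{0..d}. v i)"
      using j by (simp add: sum.distrib sum_subtractf)
    finally show ?thesis .
  qed
  finally show ?case .
qed

lemma label_eq_if_tau_eq:
  assumes A: "A \<in> \<A>" and h: "apartment_labelling A h"
    and xy: "x \<in> vertices A" "y \<in> vertices A" "tau A x = tau A y"
  shows "h x = h y"
proof -
  define s where "s u = (\<Sum>i\<in>{0..d}. crd A u i)" for u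
  obtain q where q: "s x = s y + (int d + 1) * q"
    using xy(3) unfolding tau_def s_def[symmetric] by (metis mod_eqE)
  \<comment> \<open>Adding \<open>q\<close> to every coordinate of \<open>y\<close> equalises the
    two sums; \<open>N\<close> is large enough to make both resulting vectors nonnegative.\<close>
  define N where "N = \<bar>vmin d (crd A x)\<bar> + \<bar>vmin d (crd A y) + q\<bar>"
  define v where "v i = crd A x i + N" for i
  define w where "w i = crd A y i + (q + N)" for i
  have "x = vert A v"
    by (rule vert_eqI[symmetric, OF A xy(1), where k = "- N"]) (auto simp: v_def)
  moreover have "y = vert A w"
    by (rule vert_eqI[symmetric, OF A xy(2), where k = "- (q + N)"]) (auto simp: w_def)
  moreover have "(\<Sum>i\<in>{0..d}. v i) = (\<Sum>i\<in>{0..d}. w i)"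
    using q unfolding v_def w_def s_def by (simp add: sum.distrib algebra_simps)
  moreover have "\<forall>i\<in>{0..d}. v i \<ge> 0" "\<forall>i\<in>{0..d}. w i \<ge> 0"
    using vmin_le[of _ d "crd A x"] vmin_le[of _ d "crd A y"]
    unfolding v_def w_def N_def by force+
  ultimately show ?thesis
    using label_vert_nonneg[OF A h] by metis
qed

subsection \<open>Independence of the apartment\<close>

lemma pointed_chamber_card_dir:
  assumes A: "A \<in> \<A>" and p: "pointed X ori d (ys @ [x])" and V: "set ys \<subseteq> vertices A" "x \<in> vertices A"
    and t: "t < d"
  shows "nb A x (ys ! t)" "card (dir A x (ys ! t)) = Suc t"
proof -
  have len: "length ys = d"
    using pointedD(2)[OF p] by simp
  have *: "\<forall>y\<in>set ys. nb A x y" "sorted_wrt (\<lambda>u v. dir A x u \<subset> dir A x v) ys"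
    using pointed_snoc_iff[OF A V] p len by auto
  show "nb A x (ys ! t)"
    using *(1) t len by auto
  show "card (dir A x (ys ! t)) = Suc t"
  proof (rule strict_chain_values[where d = d, OF _ _ t])
    fix s assume "Suc s < d"
    hence "dir A x (ys ! s) \<subset> dir A x (ys ! Suc s)"
      using *(2) len unfolding sorted_wrt_psubset_iff by blast
    thus "card (dir A x (ys ! s)) < card (dir A x (ys ! Suc s))"
      by (rule psubset_card_mono[OF finite_dir])
  next
    fix s assume "s < d"
    hence "nb A x (ys ! s)"
      using *(1) len by auto
    thus "1 \<le> card (dir A x (ys ! s)) \<and> card (dir A x (ys ! s)) \<le> d"
      using card_dir_pos[OF A] card_dir_le by (simp add: Suc_le_eq)
  qed
qed

lemma lab_apartment: "A \<in> \<A> \<Longrightarrow> apartment_labelling A lab"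
  using labelling apartment_subset simplex_finite
  unfolding apartment_labelling_def labelling_def simplices_def by blast

lemma iso_vertex: "complex_iso g A B \<Longrightarrow> x \<in> vertices A \<Longrightarrow> g x \<in> vertices B"
  by (auto simp: complex_iso_def bij_betw_def)

lemma iso_simplex: "complex_iso g A B \<Longrightarrow> \<sigma> \<in> A \<Longrightarrow> g ` \<sigma> \<in> B"
  by (auto simp: complex_iso_def)

lemma iso_inj: "complex_iso g A B \<Longrightarrow> inj_on g (vertices A)"
  by (auto simp: complex_iso_def bij_betw_def)

text \<open>The pulled back labelling is again a labelling of \<open>A\<close>, so it too depends
  only on types. This is the only information available on how \<open>g\<close> treats
  types.\<close>

lemma iso_labelling:
  assumes "B \<in> \<A>" "complex_iso g A B"
  shows "apartment_labelling A (lab \<circ> g)"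
  unfolding apartment_labelling_def
proof (intro ballI impI)
  fix C assume C: "C \<in> A" "card C = Suc d"
  have inj: "inj_on g C"
    using iso_inj[OF assms(2)] vertices_subset[OF C(1)] inj_on_subset by blast
  hence "card (g ` C) = Suc d"
    using C(2) by (simp add: card_image)
  hence "bij_betw lab (g ` C) {0..d}"
    using lab_apartment[OF assms(1)] iso_simplex[OF assms(2) C(1)] by (simp add: apartment_labelling_def)
  thus "bij_betw (lab \<circ> g) C {0..d}"
    using bij_betw_trans inj bij_betw_imageI by blast
qed

lemma tau_chamber_cover:
  assumes A: "A \<in> \<A>" and p: "pointed X ori d (ys @ [x])" and V: "set (ys @ [x]) \<subseteq> vertices A"
  shows "\<exists>y\<in>set (ys @ [x]). tau A y = tau A u"
proof -
  \<comment> \<open>The type difference modulo d+1. The value 0 is attained by \<open>x\<close>, and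
    a value \<open>Suc s\<close> by \<open>ys ! s\<close>, whose direction has size
    \<open>Suc s\<close>.\<close>
  define t where "t = nat ((tau A u - tau A x) mod (int d + 1))"
  have "0 \<le> (tau A u - tau A x) mod (int d + 1)" "(tau A u - tau A x) mod (int d + 1) < int d + 1"
    by (rule pos_mod_sign, simp, rule pos_mod_bound, simp)
  hence t: "int t = (tau A u - tau A x) mod (int d + 1)" "t \<le> d"
    unfolding t_def by linarith+
  have "(tau A x + int t) mod (int d + 1) = tau A u mod (int d + 1)"
    unfolding t(1) by (simp add: mod_simps)
  hence u: "(tau A x + int t) mod (int d + 1) = tau A u"
    by (simp add: tau_def)
  show ?thesis
  proof (cases t)
    case 0
    hence "tau A x = tau A u"
      using u by (simp add: tau_def)
    thus ?thesis by auto
  next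
    case (Suc s)
    hence s: "s < d"
      using t(2) by simp
    have "set ys \<subseteq> vertices A" "x \<in> vertices A" "length ys = d"
      using V pointedD(2)[OF p] by auto
    from tau_nb[of A x "ys ! s"] pointed_chamber_card_dir[OF A p this(1,2) s] u Suc s this(3)
    have "tau A (ys ! s) = tau A u"
      by simp
    moreover have "ys ! s \<in> set (ys @ [x])"
      using s \<open>length ys = d\<close> by simp
    ultimately show ?thesis by blast
  qed
qed

text \<open>The isomorphisms of apartments given by the building axioms may reverse the orientation. Those
  fixing a chamber do not: as the labels are determined by the types, they shift types by a constant.\<close>

definition typed_iso :: "('v \<Rightarrow> 'v) \<Rightarrow> 'v set set \<Rightarrow> 'v set set \<Rightarrow> bool" where
  "typed_iso g A B \<longleftrightarrow> A \<in> \<A> \<and> B \<in> \<A> \<and> complex_iso g A B \<and>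
     (\<exists>c. \<forall>x\<in>vertices A. tau B (g x) = (tau A x + c) mod (int d + 1))"

text \<open>Within \<open>C\<close> the sizes of directions are forced by the cyclic order, so the
  types in \<open>A\<close> and in \<open>B\<close> differ by a constant there. For any other
  \<open>x\<close>, let \<open>y\<close> in \<open>C\<close> have the type of \<open>x\<close> in
  \<open>A\<close>, and \<open>y'\<close> in \<open>C\<close> the type of \<open>g x\<close> in
  \<open>B\<close>. Both carry the label of \<open>g x\<close>, and labels are injective on
  \<open>C\<close>; hence \<open>y = y'\<close>.\<close>

lemma typed_iso_if_fixes_chamber:
  assumes A: "A \<in> \<A>" and B: "B \<in> \<A>" and g: "complex_iso g A B"
    and C: "C \<in> A" "C \<in> B" "card C = Suc d" "\<forall>v\<in>C. g v = v"
  shows "typed_iso g A B"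
proof -
  have "C \<in> X" "C \<noteq> {}"
    using C(1) apartment_subset[OF A] simplex_nonempty by auto
  then obtain ys x0 where ys: "pointed X ori (length ys) (ys @ [x0])" "set (ys @ [x0]) = C"
    using ex_pointed_last[of C] by (metis ex_in_conv)
  have len: "length ys = d"
    using pointedD(2,3)[OF ys(1)] ys(2) C(3) distinct_card[of "ys @ [x0]"] by simp
  note p = ys(1)[unfolded len]
  have VA: "set (ys @ [x0]) \<subseteq> vertices A" and VB: "set (ys @ [x0]) \<subseteq> vertices B"
    unfolding ys(2) by (rule vertices_subset[OF C(1)], rule vertices_subset[OF C(2)])
  define c where "c = tau B x0 - tau A x0"
  have shift: "tau B y = (tau A y + c) mod (int d + 1)" if "y \<in> C" for y
  proof (cases "y = x0")
    case True
    thus ?thesis by (simp add: c_def tau_def)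
  next
    case False
    with that ys(2) obtain t where t: "t < d" "y = ys ! t"
      using len by (auto simp: in_set_conv_nth)
    have "tau A y = (tau A x0 + int (Suc t)) mod (int d + 1)"
      using tau_nb[of A x0 y] pointed_chamber_card_dir[OF A p _ _ t(1)] VA t(2) by simp
    moreover have "tau B y = (tau B x0 + int (Suc t)) mod (int d + 1)"
      using tau_nb[of B x0 y] pointed_chamber_card_dir[OF B p _ _ t(1)] VB t(2) by simp
    moreover have "tau A x0 + int (Suc t) + c = tau B x0 + int (Suc t)"
      by (simp add: c_def)
    ultimately show ?thesis
      by (metis mod_add_left_eq)
  qed
  have "tau B (g x) = (tau A x + c) mod (int d + 1)" if x: "x \<in> vertices A" for x
  proof -
    obtain y where y: "y \<in> C" "tau A y = tau A x"
      using tau_chamber_cover[OF A p VA] ys(2) by blast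
    have yV: "y \<in> vertices A" "y \<in> vertices B"
      using subsetD[OF vertices_subset[OF C(1)] y(1)] subsetD[OF vertices_subset[OF C(2)] y(1)] by simp_all
    have "(lab \<circ> g) x = (lab \<circ> g) y"
      by (rule label_eq_if_tau_eq[OF A iso_labelling[OF B g] x yV(1)]) (use y in simp)
    hence lab1: "lab (g x) = lab y"
      using C(4) y(1) by simp
    obtain y' where y': "y' \<in> C" "tau B y' = tau B (g x)"
      using tau_chamber_cover[OF B p VB] ys(2) by blast
    have "lab y' = lab (g x)"
      by (rule label_eq_if_tau_eq[OF B lab_apartment[OF B] _ iso_vertex[OF g x] y'(2)])
        (rule subsetD[OF vertices_subset[OF C(2)] y'(1)])
    hence "lab y' = lab y"
      using lab1 by simp
    moreover have "inj_on lab C"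
      using lab_apartment[OF A] C by (simp add: apartment_labelling_def bij_betw_def)
    ultimately have "y' = y"
      using y(1) y'(1) by (auto dest: inj_onD)
    thus ?thesis
      using y' shift[OF y(1)] y(2) by simp
  qed
  thus ?thesis
    unfolding typed_iso_def using A B g by blast
qed

lemma complex_iso_inv:
  assumes g: "complex_iso g A B"
  shows "complex_iso (inv_into (vertices A) g) B A"
proof -
  let ?h = "inv_into (vertices A) g"
  have bij: "bij_betw g (vertices A) (vertices B)"
    using g by (simp add: complex_iso_def)
  have inv: "?h ` g ` \<sigma> = \<sigma>" if "\<sigma> \<in> A" for \<sigma>
    using inv_into_image_cancel[OF iso_inj[OF g] vertices_subset[OF that]] .
  have "B = (\<lambda>\<sigma>. g ` \<sigma>) ` A"
    using g by (simp add: complex_iso_def)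
  hence "(\<lambda>\<sigma>. ?h ` \<sigma>) ` B = (\<lambda>\<sigma>. ?h ` g ` \<sigma>) ` A"
    by (simp only: image_image)
  also have "\<dots> = A"
    using inv by simp
  finally show ?thesis
    using bij_betw_inv_into[OF bij] by (simp add: complex_iso_def)
qed

lemma typed_iso_inv:
  assumes g: "typed_iso g A B"
  shows "typed_iso (inv_into (vertices A) g) B A"
proof -
  let ?h = "inv_into (vertices A) g"
  obtain c where c: "\<forall>x\<in>vertices A. tau B (g x) = (tau A x + c) mod (int d + 1)"
    and iso: "complex_iso g A B" and AB: "A \<in> \<A>" "B \<in> \<A>"
    using g by (auto simp: typed_iso_def)
  have "tau A (?h y) = (tau B y + (- c)) mod (int d + 1)" if y: "y \<in> vertices B" for y
  proof -
    have "g (?h y) = y" "?h y \<in> vertices A"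
      using iso y by (auto simp: complex_iso_def bij_betw_def f_inv_into_f inv_into_into)
    hence "tau B y = (tau A (?h y) + c) mod (int d + 1)"
      using c by metis
    hence "(tau B y + (- c)) mod (int d + 1) = tau A (?h y) mod (int d + 1)"
      by (simp add: mod_simps)
    thus ?thesis
      by (simp add: tau_def)
  qed
  thus ?thesis
    using AB complex_iso_inv[OF iso] unfolding typed_iso_def by blast
qed

text \<open>The size of a direction is at most \<open>d\<close>, so it is determined by the
  difference of types modulo d+1, which \<open>g\<close> preserves. The direction itself cannot be
  compared, since the coordinates of \<open>A\<close> and \<open>B\<close> are chosen
  independently.\<close>

lemma typed_iso_nb:
  assumes g: "typed_iso g A B" and xu: "nb A x u"
  shows "nb B (g x) (g u)" "card (dir B (g x) (g u)) = card (dir A x u)"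
proof -
  obtain c where c: "\<forall>x\<in>vertices A. tau B (g x) = (tau A x + c) mod (int d + 1)"
    and iso: "complex_iso g A B" and AB: "A \<in> \<A>" "B \<in> \<A>"
    using g by (auto simp: typed_iso_def)
  note V = nb_vertices[OF xu]
  have "x \<noteq> u" "{u, x} \<in> X"
    using xu edge_iff[OF AB(1) V] by auto
  moreover from this have "{u, x} \<in> A"
    using apartment_full[OF AB(1)] V by simp
  ultimately have "g x \<noteq> g u" "{g u, g x} \<in> X"
    using iso_simplex[OF iso, of "{u, x}"] apartment_subset[OF AB(2)] iso_inj[OF iso] V
    by (auto dest: inj_onD)
  thus nb: "nb B (g x) (g u)"
    using edge_iff[OF AB(2) iso_vertex[OF iso V(1)] iso_vertex[OF iso V(2)]] by simp
  have "(tau B (g x) + int (card (dir B (g x) (g u)))) mod (int d + 1) = tau B (g u)"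
    using tau_nb[OF nb] by simp
  also have "\<dots> = (tau A u + c) mod (int d + 1)"
    using c V by simp
  also have "\<dots> = (tau B (g x) + int (card (dir A x u))) mod (int d + 1)"
    using c V by (simp add: tau_nb[OF xu] mod_simps algebra_simps)
  finally have "(int (card (dir B (g x) (g u)))) mod (int d + 1) = (int (card (dir A x u))) mod (int d + 1)"
    by (metis add_diff_cancel_left' mod_diff_left_eq)
  thus "card (dir B (g x) (g u)) = card (dir A x u)"
    using card_dir_le[of A x u] card_dir_le[of B "g x" "g u"] by simp
qed

section \<open>Height and number of minimal coordinates as invariants\<close>

lemma lower_unit_step:
  assumes A: "A \<in> \<A>" and x: "x \<in> vertices A" and i: "i \<in> {0..d} - low A x z"
  obtains u where "nb A x u" "dir A x u = {0..d} - {i}" "ht A x z = Suc (ht A u z)"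
proof -
  have sub: "low A x z \<subseteq> {0..d} - {i}"
    using i low_subset by blast
  hence J: "{0..d} - {i} \<noteq> {}" "{0..d} - {i} \<subset> {0..d}"
    using low_nonempty[of A x z] i by auto
  obtain u where u: "nb A x u" "dir A x u = {0..d} - {i}"
    by (rule ex_nb[OF A x J])
  have "{0..d} - dir A x u = {i}"
    unfolding u(2) using i by blast
  hence "ht A x z = Suc (ht A u z)"
    using ht_superset[OF u(1), of z] sub u(2) by simp
  thus ?thesis
    by (rule that[OF u])
qed

text \<open>A step in a direction of size \<open>d\<close> subtracts a unit vector, and it can bring
  \<open>x\<close> closer to \<open>z\<close> by at most 1. Together with the existence of
  descending steps this makes the height a graph distance.\<close>

lemma ht_unit_step_le:
  assumes "A \<in> \<A>" "nb A x u" "card (dir A x u) = d"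
  shows "ht A x z \<le> Suc (ht A u z)"
  using ht_superset[OF assms(2), of z] ht_not_superset[OF assms(2), of z] card_codir[of A x u] assms(3)
  by (cases "low A x z \<subseteq> dir A x u") simp_all

text \<open>A descending path of unit steps from \<open>x\<close> to \<open>z\<close> in
  \<open>A\<close> is carried to a path of unit steps in \<open>B\<close>, and each of its steps
  lowers the height by at most 1.\<close>

lemma typed_iso_ht_le:
  assumes g: "typed_iso g A B" and z: "z \<in> vertices A"
  shows "x \<in> vertices A \<Longrightarrow> ht B (g x) (g z) \<le> ht A x z"
proof (induction "ht A x z" arbitrary: x)
  have iso: "complex_iso g A B" and A: "A \<in> \<A>" and B: "B \<in> \<A>"
    using g by (auto simp: typed_iso_def)
  {
    case 0
    hence "x = z"
      using ht_eq_0_iff[OF A _ z] by simp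
    moreover have "ht B (g z) (g z) = 0"
      using ht_eq_0_iff[OF B] iso_vertex[OF iso z] by blast
    ultimately show ?case by simp
  next
    case (Suc n)
    hence "x \<noteq> z"
      using ht_eq_0_iff[OF A Suc.prems z] by auto
    then obtain i where i: "i \<in> {0..d} - low A x z"
      using low_psubset[OF A Suc.prems z] by blast
    obtain u where u: "nb A x u" "dir A x u = {0..d} - {i}" "ht A x z = Suc (ht A u z)"
      using lower_unit_step[OF A Suc.prems i] .
    have "card (dir A x u) = d"
      using u(2) i by simp
    hence "ht B (g x) (g z) \<le> Suc (ht B (g u) (g z))"
      using ht_unit_step_le[OF B typed_iso_nb(1)[OF g u(1)]] typed_iso_nb(2)[OF g u(1)] by simp
    also have "\<dots> \<le> Suc (ht A u z)"
      using Suc.hyps u nb_vertices[OF u(1)] by simp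
    finally show ?case
      using u(3) by simp
  }
qed

lemma typed_iso_ht:
  assumes g: "typed_iso g A B" and V: "x \<in> vertices A" "z \<in> vertices A"
  shows "ht B (g x) (g z) = ht A x z"
proof -
  let ?h = "inv_into (vertices A) g"
  have iso: "complex_iso g A B"
    using g by (simp add: typed_iso_def)
  have "?h (g x) = x" "?h (g z) = z"
    using V iso_inj[OF iso] by simp_all
  thus ?thesis
    using typed_iso_ht_le[OF g V(2,1)]
      typed_iso_ht_le[OF typed_iso_inv[OF g] iso_vertex[OF iso V(2)] iso_vertex[OF iso V(1)]] by simp
qed

text \<open>The neighbours obtained by lowering a single coordinate and getting closer to
  \<open>z\<close>. They are counted by the non-minimal coordinates, yet their description uses only
  adjacency, sizes of directions and heights, which typed isomorphisms preserve. This is how the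
  size of \<open>low\<close> is transported.\<close>

definition lower_steps :: "'v set set \<Rightarrow> 'v \<Rightarrow> 'v \<Rightarrow> 'v set" where
  "lower_steps A x z = {u. nb A x u \<and> card (dir A x u) = d \<and> ht A u z < ht A x z}"

lemma lower_steps_bij:
  assumes A: "A \<in> \<A>" and x: "x \<in> vertices A"
  shows "bij_betw (dir A x) (lower_steps A x z) ((\<lambda>i. {0..d} - {i}) ` ({0..d} - low A x z))"
  unfolding bij_betw_def
proof
  show "inj_on (dir A x) (lower_steps A x z)"
    using nb_inj[OF A] by (auto simp: inj_on_def lower_steps_def)
  show "dir A x ` lower_steps A x z = (\<lambda>i. {0..d} - {i}) ` ({0..d} - low A x z)"
  proof (intro equalityI subsetI)
    fix J assume "J \<in> dir A x ` lower_steps A x z"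
    then obtain u where u: "J = dir A x u" "nb A x u" "card (dir A x u) = d" "ht A u z < ht A x z"
      by (auto simp: lower_steps_def)
    have "card ({0..d} - J) = 1"
      using card_codir[of A x u] u(1,3) by simp
    then obtain i where i: "{0..d} - J = {i}"
      by (auto simp: card_1_singleton_iff)
    moreover have "J \<subseteq> {0..d}"
      using dir_psubset u(1) by blast
    ultimately have "J = {0..d} - {i}" "i \<in> {0..d} - J"
      by auto
    moreover have "low A x z \<subseteq> J"
      using ht_less_iff[OF A u(2)] u(1,4) by simp
    ultimately show "J \<in> (\<lambda>i. {0..d} - {i}) ` ({0..d} - low A x z)"
      by blast
  next
    fix J assume "J \<in> (\<lambda>i. {0..d} - {i}) ` ({0..d} - low A x z)"
    then obtain i where i: "J = {0..d} - {i}" "i \<in> {0..d} - low A x z"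
      by blast
    obtain u where "nb A x u" "dir A x u = {0..d} - {i}" "ht A x z = Suc (ht A u z)"
      using lower_unit_step[OF A x i(2)] .
    moreover have "card ({0..d} - {i}) = d"
      using i(2) by simp
    ultimately have "u \<in> lower_steps A x z" "dir A x u = J"
      using i(1) by (simp_all add: lower_steps_def)
    thus "J \<in> dir A x ` lower_steps A x z"
      by blast
  qed
qed

lemma card_lower_steps:
  assumes A: "A \<in> \<A>" and x: "x \<in> vertices A"
  shows "finite (lower_steps A x z)" "card (lower_steps A x z) = card ({0..d} - low A x z)"
proof -
  note bij = lower_steps_bij[OF A x, of z]
  show "finite (lower_steps A x z)"
    using bij_betw_finite[OF bij] by simp
  have "inj_on (\<lambda>i. {0..d} - {i}) ({0..d} - low A x z)"
    by (auto simp: inj_on_def)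
  thus "card (lower_steps A x z) = card ({0..d} - low A x z)"
    using bij_betw_same_card[OF bij] by (simp add: card_image)
qed

lemma typed_iso_card_low_le:
  assumes g: "typed_iso g A B" and V: "x \<in> vertices A" "z \<in> vertices A"
  shows "card ({0..d} - low A x z) \<le> card ({0..d} - low B (g x) (g z))"
proof -
  have iso: "complex_iso g A B" and A: "A \<in> \<A>" and B: "B \<in> \<A>"
    using g by (auto simp: typed_iso_def)
  have "g ` lower_steps A x z \<subseteq> lower_steps B (g x) (g z)"
    using typed_iso_nb[OF g] typed_iso_ht[OF g _ V(2)] V(1) nb_vertices
    by (auto simp: lower_steps_def)
  moreover have "inj_on g (lower_steps A x z)"
    by (rule inj_on_subset[OF iso_inj[OF iso]]) (auto simp: lower_steps_def nb_def)
  ultimately have "card (lower_steps A x z) \<le> card (lower_steps B (g x) (g z))"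
    using card_inj_on_le card_lower_steps(1)[OF B iso_vertex[OF iso V(1)]] by blast
  thus ?thesis
    using card_lower_steps(2)[OF A V(1)] card_lower_steps(2)[OF B iso_vertex[OF iso V(1)]] by simp
qed

lemma typed_iso_card_low:
  assumes g: "typed_iso g A B" and V: "x \<in> vertices A" "z \<in> vertices A"
  shows "card (low B (g x) (g z)) = card (low A x z)"
proof -
  let ?h = "inv_into (vertices A) g"
  have iso: "complex_iso g A B"
    using g by (simp add: typed_iso_def)
  have "?h (g x) = x" "?h (g z) = z"
    using V iso_inj[OF iso] by simp_all
  hence "card ({0..d} - low B (g x) (g z)) = card ({0..d} - low A x z)"
    using typed_iso_card_low_le[OF g V]
      typed_iso_card_low_le[OF typed_iso_inv[OF g] iso_vertex[OF iso V(1)] iso_vertex[OF iso V(2)]] by simp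
  moreover have "card ({0..d} - low E u v) + card (low E u v) = Suc d" for E u v
    using card_Diff_subset[OF finite_subset[OF low_subset] low_subset, of E u v]
      card_mono[OF _ low_subset, of E u v] by simp
  ultimately show ?thesis
    by (metis add_left_cancel)
qed

text \<open>An isomorphism from \<open>A\<close> to \<open>B\<close> fixing \<open>x\<close> and
  \<open>z\<close> might disturb the orientation, and the two apartments need not share a chamber.
  Hence a third one, \<open>E\<close>, is taken that contains a chamber \<open>C\<close> of
  \<open>A\<close> at \<open>z\<close> and a chamber \<open>D\<close> of \<open>B\<close> at
  \<open>x\<close>. The map from \<open>A\<close> to \<open>E\<close> fixes \<open>C\<close> and
  \<open>x\<close>, the map from \<open>B\<close> to \<open>E\<close> fixes \<open>D\<close> and
  \<open>z\<close>. Each fixes a chamber, and both fix \<open>x\<close> and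
  \<open>z\<close>.\<close>

lemma ht_low_indep:
  assumes A: "A \<in> \<A>" "x \<in> vertices A" "z \<in> vertices A" and B: "B \<in> \<A>" "x \<in> vertices B" "z \<in> vertices B"
  shows "ht A x z = ht B x z" "card (low A x z) = card (low B x z)"
proof -
  obtain C where C: "C \<in> A" "z \<in> C" "card C = Suc d"
    using chamber_exists[OF A(1,3)] .
  obtain D where D: "D \<in> B" "x \<in> D" "card D = Suc d"
    using chamber_exists[OF B(1,2)] .
  have "C \<in> X" "D \<in> X"
    using C D apartment_subset A(1) B(1) by auto
  then obtain E where E: "E \<in> \<A>" "C \<in> E" "D \<in> E"
    by (rule common_apartment)
  have x: "{x} \<in> A" "{x} \<in> E" and z: "{z} \<in> B" "{z} \<in> E"
    using vertex_in[OF A(1,2)] vertex_in[OF B(1,3)] apartment_face[OF E(1,3)] apartment_face[OF E(1,2)]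
      C(2) D(2) by auto
  obtain g where g: "complex_iso g A E" "\<forall>v\<in>C \<union> {x}. g v = v"
    by (rule apartment_iso[OF A(1) E(1) C(1) E(2) x])
  obtain g' where g': "complex_iso g' B E" "\<forall>v\<in>D \<union> {z}. g' v = v"
    by (rule apartment_iso[OF B(1) E(1) D(1) E(3) z])
  have t: "typed_iso g A E"
    by (rule typed_iso_if_fixes_chamber[OF A(1) E(1) g(1) C(1) E(2) C(3)]) (use g(2) in simp)
  have t': "typed_iso g' B E"
    by (rule typed_iso_if_fixes_chamber[OF B(1) E(1) g'(1) D(1) E(3) D(3)]) (use g'(2) in simp)
  have eq: "g x = x" "g z = z" "g' x = x" "g' z = z"
    using g(2) g'(2) C(2) D(2) by auto
  show "ht A x z = ht B x z"
    using typed_iso_ht[OF t A(2,3)] typed_iso_ht[OF t' B(2,3)] eq by simp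
  show "card (low A x z) = card (low B x z)"
    using typed_iso_card_low[OF t A(2,3)] typed_iso_card_low[OF t' B(2,3)] eq by simp
qed

subsection \<open>Gates\<close>

text \<open>The apartment is part of the relation because \<open>dir\<close> and \<open>low\<close>
  depend on it; only uniqueness shows that \<open>m\<close> does not.\<close>

definition gate_in :: "'v set set \<Rightarrow> 'v \<Rightarrow> 'v \<Rightarrow> 'v \<Rightarrow> bool" where
  "gate_in B x z m \<longleftrightarrow> B \<in> \<A> \<and> z \<in> vertices B \<and> x \<noteq> z \<and> nb B x m \<and> dir B x m = low B x z"

lemma unit_shift:
  assumes "nb A z w" "dir A z w = {i}"
  obtains c where "\<forall>j\<in>{0..d}. disp A w x j = disp A z x j + c - (if j = i then 1 else 0)"
proof -
  obtain c where c: "\<forall>j\<in>{0..d}. crd A w j = crd A z j + c + (if j \<in> {i} then 1 else 0)"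
    using assms unfolding nb_def by auto
  show ?thesis
    by (rule that[of "- c"]) (use c in \<open>simp add: disp_def\<close>)
qed

lemma common_apartment_vertices:
  assumes "\<sigma> \<in> X" "\<tau> \<in> X"
  obtains A where "A \<in> \<A>" "\<sigma> \<subseteq> vertices A" "\<tau> \<subseteq> vertices A"
proof -
  obtain A where "A \<in> \<A>" "\<sigma> \<in> A" "\<tau> \<in> A"
    by (rule common_apartment[OF assms])
  thus ?thesis
    by (intro that[of A] vertices_subset)
qed

text \<open>By induction on the height: if some entry of \<open>x - z\<close> exceeds the minimum by at least 2,
  then \<open>z\<close> can be moved one unit step towards \<open>x\<close> inside \<open>B\<close> without changing \<open>low\<close>; an
  apartment \<open>E\<close> containing this step and the edge from \<open>x\<close> to \<open>m'\<close> connects \<open>B\<close> and \<open>B'\<close>.\<close>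

lemma gate_unique:
  "gate_in B x z m \<Longrightarrow> gate_in B' x z m' \<Longrightarrow> m = m'"
proof (induction "ht B x z" arbitrary: B B' z m m' rule: less_induct)
  case less
  have B: "B \<in> \<A>" "x \<in> vertices B" "z \<in> vertices B" "nb B x m" "dir B x m = low B x z"
    and B': "B' \<in> \<A>" "x \<in> vertices B'" "z \<in> vertices B'" "nb B' x m'" "dir B' x m' = low B' x z"
    and xz: "x \<noteq> z"
    using less.prems nb_vertices by (auto simp: gate_in_def)
  note V = nb_vertices[OF B(4)] nb_vertices[OF B'(4)]
  note indep = ht_low_indep[OF B(1-3) B'(1-3)]
  have hm: "ht B x z = ht B m z + card ({0..d} - low B x z)"
    using ht_superset[OF B(4), of z] B(5) by simp
  have hm': "ht B' x z = ht B' m' z + card ({0..d} - low B' x z)"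
    using ht_superset[OF B'(4), of z] B'(5) by simp
  have codim: "card ({0..d} - low A u w) = Suc d - card (low A u w)" for A u w
    using card_Diff_subset[OF finite_subset[OF low_subset] low_subset, of A u w] by simp
  show ?case
  proof (cases "ht B x z = card ({0..d} - low B x z)")
    \<comment> \<open>The displacement is an indicator up to a constant, so the step in the gate
      direction ends at \<open>z\<close>, in either apartment.\<close>
    case True
    hence "ht B m z = 0" "ht B' m' z = 0"
      using hm hm' indep codim by simp_all
    thus ?thesis
      using ht_eq_0_iff[OF B(1) V(2) B(3)] ht_eq_0_iff[OF B'(1) V(4) B'(3)] by simp
  next
    case False
    then obtain i where i: "i \<in> {0..d}" "disp B z x i \<ge> vmin d (disp B z x) + 2"
      using height_gt_imp_large_entry[of d "disp B z x"] unfolding ht_def low_def by blast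
    have il: "i \<notin> low B x z"
      using i(2) by (simp add: low_def vmins_def)
    obtain l where "l \<in> low B x z" "l \<in> {0..d}"
      using low_nonempty[of B x z] low_subset[of B x z] by blast
    hence "l \<noteq> i" "{i, l} \<subseteq> {0..d}"
      using i(1) il by auto
    hence "{i} \<subset> {0..d}"
      by blast
    then obtain z' where z': "nb B z z'" "dir B z z' = {i}"
      by (rule ex_nb[OF B(1,3) insert_not_empty])
    obtain c where c: "\<forall>j\<in>{0..d}. disp B z' x j = disp B z x j + c - (if j = i then 1 else 0)"
      by (rule unit_shift[OF z'])
    have down: "ht B x z = Suc (ht B x z')" "low B x z' = low B x z"
      using lower_entry_not_minimal[OF c i(1)] il i(2) by (simp_all add: ht_def low_def)
    note Vz' = nb_vertices(2)[OF z'(1)]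
    have xz': "x \<noteq> z'"
      using down(2) low_psubset[OF B(1-3) xz] ht_eq_0_iff[OF B(1,2) Vz']
        vmins_eq_all_iff[of d "disp B z' x"] by (auto simp: low_def ht_def)
    have gB: "gate_in B x z' m"
      using B Vz' xz' down(2) by (simp add: gate_in_def)
    have "{z', z} \<in> X" "{m', x} \<in> X"
      using edge_iff[OF B(1,3) Vz'] z'(1) edge_iff[OF B'(1) V(3,4)] B'(4) by simp_all
    then obtain E where E: "E \<in> \<A>" "{z', z} \<subseteq> vertices E" "{m', x} \<subseteq> vertices E"
      by (rule common_apartment_vertices)
    hence VE: "x \<in> vertices E" "z \<in> vertices E" "z' \<in> vertices E" "m' \<in> vertices E"
      by auto
    have nbE: "nb E z z'" "nb E x m'"
      using edge_iff[OF E(1) VE(2,3)] edge_iff[OF E(1) VE(1,4)] \<open>{z', z} \<in> X\<close> \<open>{m', x} \<in> X\<close>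
        z'(1) B'(4) by (simp_all add: nb_def)
    have "card (dir E z z') = card (dir B z z')"
      using ht_nb_to[OF E(1) nbE(1)] ht_nb_to[OF B(1) z'(1)]
        ht_low_indep(1)[OF E(1) VE(3,2) B(1) Vz' B(3)] by simp
    then obtain i' where i': "dir E z z' = {i'}"
      using z'(2) by (auto simp: card_1_singleton_iff)
    hence i'd: "i' \<in> {0..d}"
      using dir_psubset[of E z z'] by auto
    obtain c' where c': "\<forall>j\<in>{0..d}. disp E z' x j = disp E z x j + c' - (if j = i' then 1 else 0)"
      by (rule unit_shift[OF nbE(1) i'])
    have indE: "ht E x z = ht B x z" "card (low E x z) = card (low B x z)"
      "ht E x z' = ht B x z'" "card (low E x z') = card (low B x z')"
      using ht_low_indep[OF E(1) VE(1,2) B(1-3)] ht_low_indep[OF E(1) VE(1,3) B(1,2) Vz'] by simp_all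
    \<comment> \<open>Heights are the same in \<open>E\<close> and \<open>B\<close>, so passing from
      \<open>z\<close> to \<open>z'\<close> lowers the height in \<open>E\<close> as well; lowering
      a minimal entry could not do this.\<close>
    have "i' \<notin> low E x z"
      using lower_entry_minimal[OF c'] indE(1,3) down(1) by (auto simp: low_def ht_def)
    hence "low E x z \<subseteq> low E x z'"
      using lower_entry_not_minimal(2)[OF c' i'd] by (simp add: low_def)
    hence lowE: "low E x z = low E x z'"
      using card_subset_eq[OF finite_subset[OF low_subset]] indE(2,4) down(2) by simp
    have "ht E x m' = ht B' x m'" "ht E m' z = ht B' m' z" "ht E x z = ht B' x z"
        "card (low E x z) = card (low B' x z)"
      using ht_low_indep[OF E(1) VE(1,4) B'(1) V(3,4)] ht_low_indep[OF E(1) VE(4,2) B'(1) V(4) B'(3)]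
        ht_low_indep[OF E(1) VE(1,2) B'(1-3)] by simp_all
    note indE' = this
    \<comment> \<open>In \<open>E\<close> the vertex \<open>m'\<close> is recognised as the gate by
      numbers alone: its direction has the size of \<open>low\<close>, and it contains
      \<open>low\<close> because \<open>m'\<close> is closer to \<open>z\<close> than
      \<open>x\<close>.\<close>
    have "card (dir E x m') = card (low E x z)"
      using ht_nb_from[OF E(1) nbE(2)] ht_nb_from[OF B'(1,4)] indE'(1,4) B'(5)
        card_dir_le[of E x m'] card_dir_le[of B' x m'] by simp
    moreover have "low E x z \<subseteq> dir E x m'"
      using ht_less_iff[OF E(1) nbE(2), of z] ht_less_iff[OF B'(1,4), of z] B'(5) indE'(2,3) by simp
    ultimately have "low E x z = dir E x m'"
      using card_subset_eq[OF finite_dir] by metis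
    hence gE: "gate_in E x z' m'"
      using E(1) VE xz' nbE(2) lowE by (simp add: gate_in_def)
    show ?thesis
      by (rule less.hyps[OF _ gB gE]) (use down(1) in simp)
  qed
qed

definition gate :: "'v \<Rightarrow> 'v \<Rightarrow> 'v" where
  "gate x z = (SOME m. \<exists>B. gate_in B x z m)"

lemma gate_in_gate:
  assumes B: "B \<in> \<A>" "x \<in> vertices B" "z \<in> vertices B" and xz: "x \<noteq> z"
  shows "gate_in B x z (gate x z)"
proof -
  obtain m where "nb B x m" "dir B x m = low B x z"
    by (rule ex_nb[OF B(1,2) low_nonempty low_psubset[OF B xz]])
  hence m: "gate_in B x z m"
    using B xz by (simp add: gate_in_def)
  hence "\<exists>m. \<exists>B. gate_in B x z m"
    by blast
  hence "\<exists>B. gate_in B x z (gate x z)"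
    unfolding gate_def by (rule someI_ex)
  then obtain B' where "gate_in B' x z (gate x z)" ..
  from gate_unique[OF m this] m show ?thesis by simp
qed

definition dst :: "'v \<Rightarrow> 'v \<Rightarrow> nat" where
  "dst x z = ht (SOME A. A \<in> \<A> \<and> x \<in> vertices A \<and> z \<in> vertices A) x z"

lemma dst_eq_ht:
  assumes A: "A \<in> \<A>" "x \<in> vertices A" "z \<in> vertices A"
  shows "dst x z = ht A x z"
proof -
  let ?B = "SOME A. A \<in> \<A> \<and> x \<in> vertices A \<and> z \<in> vertices A"
  have "?B \<in> \<A> \<and> x \<in> vertices ?B \<and> z \<in> vertices ?B"
    by (rule someI_ex) (use A in blast)
  thus ?thesis
    unfolding dst_def using ht_low_indep(1)[of ?B x z A] A by blast
qed

text \<open>The right-hand side refers to the building only. It can therefore be verified in an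
  apartment that does not contain \<open>z\<close>, as the proof of stability requires.\<close>

lemma closer_iff_above_gate:
  assumes z: "{z} \<in> X" and ux: "{u, x} \<in> X" "u \<noteq> x" and xz: "x \<noteq> z"
  shows "dst u z < dst x z \<longleftrightarrow> u = gate x z \<or> pointed X ori 2 [gate x z, u, x]"
proof -
  obtain B where "B \<in> \<A>" "{z} \<subseteq> vertices B" "{u, x} \<subseteq> vertices B"
    by (rule common_apartment_vertices[OF z ux(1)])
  hence B: "B \<in> \<A>" "z \<in> vertices B" "u \<in> vertices B" "x \<in> vertices B"
    by auto
  have g: "nb B x (gate x z)" "dir B x (gate x z) = low B x z"
    using gate_in_gate[OF B(1,4,2) xz] by (simp_all add: gate_in_def)
  have nb: "nb B x u"
    using edge_iff[OF B(1,4,3)] ux by simp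
  have "dst u z < dst x z \<longleftrightarrow> dir B x (gate x z) \<subseteq> dir B x u"
    using ht_less_iff[OF B(1) nb] dst_eq_ht[OF B(1,3,2)] dst_eq_ht[OF B(1,4,2)] g(2) by simp
  also have "\<dots> \<longleftrightarrow> u = gate x z \<or> dir B x (gate x z) \<subset> dir B x u"
    using nb_inj[OF B(1) nb g(1)] by blast
  also have "dir B x (gate x z) \<subset> dir B x u \<longleftrightarrow> pointed X ori 2 [gate x z, u, x]"
    using pointed_triangle_iff[OF B(1,4) nb_vertices(2)[OF g(1)] B(3)] nb g(1) by simp
  finally show ?thesis .
qed

text \<open>Passing to a neighbour either lowers the height by the size of the complement of the
  direction or raises it by the size of the direction, and both sizes are positive.\<close>

lemma dst_inj_on_simplex:
  assumes z: "{z} \<in> X" and \<sigma>: "\<sigma> \<in> X"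
  shows "inj_on (\<lambda>x. dst x z) \<sigma>"
proof (rule inj_onI, rule ccontr)
  fix u x assume ux: "u \<in> \<sigma>" "x \<in> \<sigma>" "dst u z = dst x z" "u \<noteq> x"
  obtain B where "B \<in> \<A>" "{z} \<subseteq> vertices B" "\<sigma> \<subseteq> vertices B"
    by (rule common_apartment_vertices[OF z \<sigma>])
  hence B: "B \<in> \<A>" "z \<in> vertices B" "u \<in> vertices B" "x \<in> vertices B"
    using ux by auto
  have "{u, x} \<in> X"
    using face_in[OF \<sigma>] ux by simp
  hence nb: "nb B x u"
    using edge_iff[OF B(1,4,3)] ux(4) by simp
  have "ht B u z \<noteq> ht B x z"
    using ht_superset[OF nb, of z] ht_not_superset[OF nb, of z] card_codir[of B x u]
      card_dir_le[of B x u] card_dir_pos[OF B(1) nb]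
    by (cases "low B x z \<subseteq> dir B x u") simp_all
  thus False
    using ux(3) dst_eq_ht[OF B(1,3,2)] dst_eq_ht[OF B(1,4,2)] by simp
qed

text \<open>Every \<open>y\<close> other than the farthest vertex \<open>x\<close> is closer than
  \<open>x\<close> by the number of coordinates missing from its direction. Growing directions
  therefore mean growing distance.\<close>

lemma pointed_sorted_by_dst:
  assumes z: "{z} \<in> X" and p: "pointed X ori (length ys) (ys @ [x])"
    and max: "\<forall>y\<in>set ys. dst y z \<le> dst x z"
  shows "sorted_wrt (\<lambda>u v. dst u z < dst v z) (ys @ [x])"
proof -
  note \<sigma> = pointedD(1)[OF p]
  obtain B where B: "B \<in> \<A>" "{z} \<subseteq> vertices B" "set (ys @ [x]) \<subseteq> vertices B"
    by (rule common_apartment_vertices[OF z \<sigma>])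
  hence V: "z \<in> vertices B" "set ys \<subseteq> vertices B" "x \<in> vertices B"
    by auto
  have nbs: "\<forall>y\<in>set ys. nb B x y" and chain: "sorted_wrt (\<lambda>u v. dir B x u \<subset> dir B x v) ys"
    using pointed_snoc_iff[OF B(1) V(2,3)] p by auto
  have less: "dst y z < dst x z" if "y \<in> set ys" for y
  proof -
    have "y \<noteq> x"
      using pointedD(3)[OF p] that by auto
    hence "dst y z \<noteq> dst x z"
      using inj_onD[OF dst_inj_on_simplex[OF z \<sigma>], of y x] that by auto
    thus ?thesis
      using max that by (simp add: order.not_eq_order_implies_strict)
  qed
  have eq: "dst x z = dst y z + card ({0..d} - dir B x y)" if y: "y \<in> set ys" for y
  proof -
    have nb: "nb B x y"
      using nbs y by simp
    have d: "dst y z = ht B y z" "dst x z = ht B x z"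
      using dst_eq_ht B(1) V y by auto
    have "low B x z \<subseteq> dir B x y"
      using less[OF y] ht_less_iff[OF B(1) nb, of z] d by simp
    thus ?thesis
      using ht_superset[OF nb, of z] d by simp
  qed
  have "dst u z < dst v z" if "u \<in> set ys" "v \<in> set ys" "dir B x u \<subset> dir B x v" for u v
  proof -
    have "card (dir B x u) < card (dir B x v)"
      by (rule psubset_card_mono[OF finite_dir that(3)])
    thus ?thesis
      using eq[OF that(1)] eq[OF that(2)] card_codir[of B x u] card_codir[of B x v]
        card_dir_le[of B x v] by linarith
  qed
  hence "sorted_wrt (\<lambda>u v. dst u z < dst v z) ys"
    by (rule sorted_wrt_mono_rel[OF _ chain])
  thus ?thesis
    using less by (simp add: sorted_wrt_append)
qed

subsection \<open>Stability\<close>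

text \<open>The directions of the vertices before \<open>x\<close> grow strictly from that of
  \<open>u\<close> and have size at most \<open>d\<close>, so their number is at most d+1 minus the
  size of the first. The apartment \<open>G\<close> containing \<open>zs\<close> may differ from
  \<open>A\<close>, which is why the bound is stated as a height.\<close>

lemma pointed_length_le_ht:
  assumes A: "A \<in> \<A>" and nb: "nb A x u" and p: "pointed X ori r zs" "hd zs = u" "last zs = x"
  shows "r \<le> ht A x u"
proof -
  have zs: "zs = butlast zs @ [x]" "length (butlast zs) = r"
    using pointedD(2,4)[OF p(1)] p(3) by auto
  define us where "us = butlast zs"
  have us: "zs = us @ [x]" "length us = r"
    using zs by (simp_all add: us_def)
  have "us \<noteq> []"
    using us(1) p(2) nb by (auto simp: nb_def)
  hence hd: "us ! 0 = u" "0 < r"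
    using us p(2) by (auto simp: hd_append hd_conv_nth)
  obtain G where G: "G \<in> \<A>" "set zs \<subseteq> vertices G"
    using common_apartment_vertices[OF pointedD(1)[OF p(1)] pointedD(1)[OF p(1)]] .
  hence V: "set us \<subseteq> vertices G" "x \<in> vertices G"
    using us(1) by auto
  have nbs: "\<forall>y\<in>set us. nb G x y" and chain: "sorted_wrt (\<lambda>u v. dir G x u \<subset> dir G x v) us"
    using pointed_snoc_iff[OF G(1) V] p(1) us by auto
  have grow: "t < r \<Longrightarrow> card (dir G x u) + t \<le> card (dir G x (us ! t))" for t
  proof (induction t)
    case (Suc t)
    hence "dir G x (us ! t) \<subset> dir G x (us ! Suc t)"
      using chain us(2) unfolding sorted_wrt_psubset_iff by blast
    hence "card (dir G x (us ! t)) < card (dir G x (us ! Suc t))"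
      by (rule psubset_card_mono[OF finite_dir])
    thus ?case
      using Suc by simp
  qed (use hd in simp)
  have nbG: "nb G x u"
    using nbs hd us(2) by (metis nth_mem)
  have "r \<le> ht G x u"
    using grow[of "r - 1"] card_dir_le[of G x "us ! (r - 1)"] hd(2) ht_nb_from[OF G(1) nbG] by simp
  also have "ht G x u = ht A x u"
    using ht_low_indep(1)[OF G(1) nb_vertices[OF nbG] A nb_vertices[OF nb]] .
  finally show ?thesis .
qed

text \<open>A chamber at \<open>x\<close> whose flag lists the elements of \<open>J\<close> first
  passes through \<open>u\<close>, at position \<open>card J - 1\<close>. Dropping the vertices
  before \<open>u\<close> leaves a pointed simplex of the required length.\<close>

lemma pointed_of_length_ht:
  assumes A: "A \<in> \<A>" and nb: "nb A x u"
  obtains zs where "pointed X ori (ht A x u) zs" "hd zs = u" "last zs = x"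
proof -
  define J where "J = dir A x u"
  note V = nb_vertices[OF nb]
  have J: "J \<noteq> {}" "J \<subset> {0..d}" "finite J" "card J \<le> d" "0 < card J"
    using nb_dir_nonempty[OF A nb] dir_psubset finite_dir card_dir_le card_dir_pos[OF A nb]
    by (auto simp: J_def)
  define n where "n = card J - 1"
  define js where "js = sorted_list_of_set J @ sorted_list_of_set ({0..d} - J)"
  define us where "us = map (\<lambda>t. raise A x (set (take (Suc t) js))) [0..<d]"
  have js: "distinct js" "set js = {0..d}"
    using J by (auto simp: js_def)
  have p: "pointed X ori d (us @ [x])"
    unfolding us_def by (rule pointed_chamber[OF A V(1) js])
  have "raise A x K \<in> vertices A" for K
    unfolding raise_def using vert_crd[OF A] by metis
  hence usV: "set us \<subseteq> vertices A"
    by (auto simp: us_def)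
  have len: "length us = d"
    by (simp add: us_def)
  have "(\<forall>y\<in>set us. nb A x y) \<and> sorted_wrt (\<lambda>u v. dir A x u \<subset> dir A x v) us"
    using pointed_snoc_iff[OF A usV V(1)] p len by simp
  hence "(\<forall>y\<in>set (drop n us). nb A x y) \<and> sorted_wrt (\<lambda>u v. dir A x u \<subset> dir A x v) (drop n us)"
    using sorted_wrt_drop set_drop_subset[of n us] by blast
  hence p': "pointed X ori (length (drop n us)) (drop n us @ [x])"
    using pointed_snoc_iff[OF A _ V(1), of "drop n us"] usV set_drop_subset[of n us] by blast
  have n: "n < d" "Suc n = card J"
    using J by (simp_all add: n_def)
  have "us ! n = raise A x (set (take (card J) js))"
    using n by (simp add: us_def)
  also have "take (card J) js = sorted_list_of_set J"
    by (simp add: js_def)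
  finally have "us ! n = raise A x J"
    using J(3) by simp
  moreover have "raise A x J = u"
    using nb_inj[OF A] raise_nb[OF A V(1) J(1,2)] nb J_def by blast
  ultimately have "hd (drop n us @ [x]) = u"
    using n(1) len by (simp add: hd_append hd_drop_conv_nth)
  moreover have "length (drop n us) = ht A x u"
    using ht_nb_from[OF A nb] n len unfolding J_def by simp
  ultimately show ?thesis
    using that[of "drop n us @ [x]"] p' by simp
qed

text \<open>The value is d+1 minus the size of the direction of \<open>u\<close>, so minimising
  \<open>ell\<close> amounts to maximising the direction.\<close>

lemma ell_eq_ht:
  assumes A: "A \<in> \<A>" and nb: "nb A x u"
  shows "ell X ori (u # ys @ [x]) = ht A x u"
proof -
  let ?R = "{r. \<exists>zs. pointed X ori r zs \<and> hd zs = u \<and> last zs = x}"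
  obtain zs where zs: "pointed X ori (ht A x u) zs" "hd zs = u" "last zs = x"
    by (rule pointed_of_length_ht[OF A nb])
  have le: "r \<le> ht A x u" if "r \<in> ?R" for r
    using that pointed_length_le_ht[OF A nb] by blast
  have "Max ?R = ht A x u"
  proof (rule Max_eqI)
    show "finite ?R"
      using le finite_nat_set_iff_bounded_le by blast
  qed (use le zs in auto)
  thus ?thesis
    by (simp add: ell_def)
qed

section \<open>The order on neighbours as inclusion of directions\<close>

lemma pointed_cons_iff:
  assumes A: "A \<in> \<A>" "set ys \<subseteq> vertices A" "x \<in> vertices A" "u \<in> vertices A"
    and p: "pointed X ori (length ys) (ys @ [x])"
  shows "pointed X ori (Suc (length ys)) (u # ys @ [x]) \<longleftrightarrow>
    nb A x u \<and> (\<forall>y\<in>set ys. dir A x u \<subset> dir A x y)"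
  using pointed_snoc_iff[of A "u # ys" x] pointed_snoc_iff[of A ys x] assms by auto

text \<open>For indices \<open>i\<close> only in the first direction and \<open>j\<close> only in
  the second, the entry of \<open>w - u\<close> at \<open>j\<close> exceeds that at \<open>i\<close>
  by 2, too much for neighbours.\<close>

lemma comparable_nbs:
  assumes A: "A \<in> \<A>" and nbs: "nb A x u" "nb A x w" "nb A u w"
  shows "dir A x u \<subset> dir A x w \<or> dir A x w \<subset> dir A x u"
proof -
  obtain a where a: "\<forall>i\<in>{0..d}. crd A u i = crd A x i + a + (if i \<in> dir A x u then 1 else 0)"
    using nbs(1) by (auto simp: nb_def)
  obtain b where b: "\<forall>i\<in>{0..d}. crd A w i = crd A x i + b + (if i \<in> dir A x w then 1 else 0)"
    using nbs(2) by (auto simp: nb_def)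
  obtain c where c: "\<forall>i\<in>{0..d}. crd A w i = crd A u i + c + (if i \<in> dir A u w then 1 else 0)"
    using nbs(3) by (auto simp: nb_def)
  have "dir A x u \<subseteq> dir A x w \<or> dir A x w \<subseteq> dir A x u"
  proof (rule ccontr)
    assume "\<not> ?thesis"
    then obtain i j where ij: "i \<in> dir A x u" "i \<notin> dir A x w" "j \<in> dir A x w" "j \<notin> dir A x u"
      by blast
    hence "i \<in> {0..d}" "j \<in> {0..d}"
      using dir_psubset by blast+
    hence "crd A w i = crd A x i + b" "crd A u i = crd A x i + a + 1"
        "crd A w j = crd A x j + b + 1" "crd A u j = crd A x j + a"
      using a b ij by simp_all
    moreover have "crd A w i \<ge> crd A u i + c" "crd A w j \<le> crd A u j + c + 1"
      using c \<open>i \<in> {0..d}\<close> \<open>j \<in> {0..d}\<close> by simp_all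
    ultimately show False by linarith
  qed
  moreover have "dir A x u \<noteq> dir A x w"
    using nb_inj[OF A nbs(1,2)] nbs(3) by (auto simp: nb_def)
  ultimately show ?thesis by blast
qed

context
  fixes z x :: 'v and ys :: "'v list" and M :: "'v set"
  assumes z: "{z} \<in> X"
    and p: "pointed X ori (length ys) (ys @ [x])"
    and max: "\<forall>y\<in>set ys. dst y z \<le> dst x z"
  defines "M \<equiv> {u. insert u (set (ys @ [x])) \<in> X \<and> (\<forall>y\<in>set (ys @ [x]). dst u z < dst y z)}"
begin

text \<open>In the larger simplex \<open>x\<close> is still the farthest vertex, so the enumeration
  ending in \<open>x\<close> is sorted by distance. So is \<open>u # ys @ [x]\<close>, and a sorted
  enumeration is unique.\<close>

lemma closer_pointed:
  assumes "u \<in> M"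
  shows "pointed X ori (Suc (length ys)) (u # ys @ [x])"
proof -
  let ?\<sigma> = "insert u (set (ys @ [x]))"
  have u: "?\<sigma> \<in> X" "\<forall>y\<in>set (ys @ [x]). dst u z < dst y z"
    using assms by (auto simp: M_def)
  obtain ws where ws: "pointed X ori (length ws) (ws @ [x])" "set (ws @ [x]) = ?\<sigma>"
    using ex_pointed_last[OF u(1), of x] by auto
  have "set ws \<subseteq> ?\<sigma>"
    using ws(2) by auto
  hence "\<forall>y\<in>set ws. dst y z \<le> dst x z"
    using u(2) max by (auto simp: less_imp_le)
  hence "sorted_wrt (\<lambda>u v. dst u z < dst v z) (ws @ [x])"
    by (rule pointed_sorted_by_dst[OF z ws(1)])
  moreover have "sorted_wrt (\<lambda>u v. dst u z < dst v z) (u # ys @ [x])"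
    using pointed_sorted_by_dst[OF z p max] u(2) by auto
  moreover have "set (ws @ [x]) = set (u # ys @ [x])"
    using ws(2) by simp
  ultimately have "ws @ [x] = u # ys @ [x]"
    by (rule strictly_sorted_unique)
      (use dst_inj_on_simplex[OF z u(1)] ws(2) in \<open>simp only:\<close>)
  moreover have "length ws = Suc (length ys)"
    using arg_cong[OF calculation, of length] by simp
  ultimately show ?thesis
    using ws(1) by simp
qed

text \<open>Once the enumeration is pointed, being closer than the last vertex makes the whole list
  sorted; the comparisons with \<open>ys\<close> then come for free.\<close>

lemma closer_iff:
  "u \<in> M \<longleftrightarrow> pointed X ori (Suc (length ys)) (u # ys @ [x]) \<and> dst u z < dst x z"
proof
  assume "u \<in> M"
  thus "pointed X ori (Suc (length ys)) (u # ys @ [x]) \<and> dst u z < dst x z"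
    using closer_pointed by (auto simp: M_def)
next
  assume u: "pointed X ori (Suc (length ys)) (u # ys @ [x]) \<and> dst u z < dst x z"
  hence "sorted_wrt (\<lambda>u v. dst u z < dst v z) ((u # ys) @ [x])"
    by (intro pointed_sorted_by_dst[OF z]) (use max in auto)
  thus "u \<in> M"
    using u pointedD(1)[of "Suc (length ys)" "u # ys @ [x]"] by (auto simp: M_def)
qed

lemma nbrs_iff: "u \<in> nbrs X ori (ys @ [x]) \<longleftrightarrow> pointed X ori (Suc (length ys)) (u # ys @ [x])"
  using pointedD(1)[of "Suc (length ys)" "u # ys @ [x]"] by (auto simp: nbrs_def vertices_def)

lemma nbr_le_iff:
  "nbr_le X ori (ys @ [x]) u w \<longleftrightarrow> u = w \<or> pointed X ori (Suc (Suc (length ys))) (u # w # ys @ [x])"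
  by (simp add: nbr_le_def)

lemma nbr_le_iff_dir:
  assumes A: "A \<in> \<A>" "set (ys @ [x]) \<subseteq> vertices A" "u \<in> vertices A" "w \<in> vertices A"
    and uw: "nb A x u" "w \<in> nbrs X ori (ys @ [x])"
  shows "nbr_le X ori (ys @ [x]) u w \<longleftrightarrow> dir A x u \<subseteq> dir A x w"
proof -
  have V: "set ys \<subseteq> vertices A" "x \<in> vertices A"
    using A(2) by auto
  have pw: "pointed X ori (Suc (length ys)) (w # ys @ [x])"
    using uw(2) nbrs_iff by simp
  hence w: "nb A x w" "\<forall>y\<in>set ys. dir A x w \<subset> dir A x y"
    using pointed_cons_iff[OF A(1) V A(4) p] by auto
  have "pointed X ori (Suc (Suc (length ys))) (u # w # ys @ [x]) \<longleftrightarrow> dir A x u \<subset> dir A x w"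
    using pointed_cons_iff[of A "w # ys" x u] A V pw uw(1) w(2) by auto
  thus ?thesis
    using nbr_le_iff[of u w] nb_inj[OF A(1) uw(1) w(1)] by auto
qed

lemma nbrs_if_le:
  assumes "w \<in> nbrs X ori (ys @ [x])" "nbr_le X ori (ys @ [x]) u w"
  shows "u \<in> nbrs X ori (ys @ [x])" "{u, w} \<union> set (ys @ [x]) \<in> X"
proof -
  have w: "pointed X ori (Suc (length ys)) (w # ys @ [x])"
    using assms(1) nbrs_iff by simp
  consider "u = w" | "pointed X ori (Suc (Suc (length ys))) (u # w # ys @ [x])"
    using assms(2) nbr_le_iff by blast
  hence "u \<in> nbrs X ori (ys @ [x]) \<and> {u, w} \<union> set (ys @ [x]) \<in> X"
  proof cases
    case 1
    thus ?thesis
      using assms(1) pointedD(1)[OF w] by (simp add: insert_commute)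
  next
    case 2
    obtain A where A: "A \<in> \<A>" "set (u # w # ys @ [x]) \<subseteq> vertices A"
      using common_apartment_vertices[OF pointedD(1)[OF 2] pointedD(1)[OF 2]] .
    have "nb A x u \<and> (\<forall>y\<in>set (w # ys). dir A x u \<subset> dir A x y)"
      using pointed_cons_iff[of A "w # ys" x u] A w 2 by simp
    hence "pointed X ori (Suc (length ys)) (u # ys @ [x])"
      using pointed_cons_iff[of A ys x u] A p by simp
    thus ?thesis
      using nbrs_iff pointedD(1)[OF 2] by (simp add: insert_commute)
  qed
  thus "u \<in> nbrs X ori (ys @ [x])" "{u, w} \<union> set (ys @ [x]) \<in> X"
    by simp_all
qed

text \<open>Adjacent neighbours have comparable directions and so are comparable in the order. The
  pairs in the last term of the exactness condition thus really index (k+1)-simplices.\<close>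

lemma closer_adjacent_simplex:
  assumes "u \<in> M" "w \<in> M" "{u, w} \<in> X"
  shows "{u, w} \<union> set (ys @ [x]) \<in> X"
proof (cases "u = w")
  case False
  have pu: "pointed X ori (Suc (length ys)) (u # ys @ [x])"
    and pw: "pointed X ori (Suc (length ys)) (w # ys @ [x])"
    using assms closer_pointed by auto
  obtain A where A: "A \<in> \<A>" "set (u # ys @ [x]) \<subseteq> vertices A" "set (w # ys @ [x]) \<subseteq> vertices A"
    using common_apartment_vertices[OF pointedD(1)[OF pu] pointedD(1)[OF pw]] .
  have V: "set (ys @ [x]) \<subseteq> vertices A" "u \<in> vertices A" "w \<in> vertices A"
    using A by auto
  have nbs: "nb A x u" "nb A x w"
    using pointed_cons_iff[of A ys x u] pointed_cons_iff[of A ys x w] A pu pw p by auto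
  have "nb A u w"
    using edge_iff[OF A(1) V(2,3)] False assms(3) by (simp add: insert_commute)
  from comparable_nbs[OF A(1) nbs this]
  have "nbr_le X ori (ys @ [x]) u w \<or> nbr_le X ori (ys @ [x]) w u"
    using nbr_le_iff_dir[OF A(1) V(1)] V nbs pu pw nbrs_iff by blast
  thus ?thesis
  proof
    assume "nbr_le X ori (ys @ [x]) u w"
    thus ?thesis
      using nbrs_if_le(2) pw nbrs_iff by blast
  next
    assume "nbr_le X ori (ys @ [x]) w u"
    hence "{w, u} \<union> set (ys @ [x]) \<in> X"
      using nbrs_if_le(2) pu nbrs_iff by blast
    thus ?thesis
      by (simp add: insert_commute)
  qed
qed (use assms in \<open>simp add: M_def insert_commute\<close>)

text \<open>The gate lies below every element of \<open>M\<close>, hence among the lower bounds of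
  \<open>u1\<close> and \<open>u2\<close>. A lower bound \<open>q\<close> with least
  \<open>ell\<close> has the intersection of the two directions as its direction, so it is the
  greatest lower bound. Thus the gate is at or below \<open>q\<close>, and so \<open>q\<close> is
  closer to \<open>z\<close> than \<open>x\<close>. No single apartment need contain
  \<open>u1\<close>, \<open>u2\<close> and \<open>z\<close>, so each comparison chooses its
  own.\<close>

lemma closer_stable: "stable X ori (ys @ [x]) M"
  unfolding stable_def
proof (intro conjI ballI)
  show "M \<subseteq> nbrs X ori (ys @ [x])"
    using closer_pointed nbrs_iff by blast
next
  fix u1 u2 assume u: "u1 \<in> M" "u2 \<in> M"
  let ?\<eta> = "ys @ [x]"
  let ?W = "lower_bounds X ori ?\<eta> u1 u2"
  let ?g = "gate x z"
  have un: "u1 \<in> nbrs X ori ?\<eta>" "u2 \<in> nbrs X ori ?\<eta>"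
    using u closer_pointed nbrs_iff by blast+
  have "dst u1 z < dst x z"
    using u(1) by (simp add: M_def)
  have xz: "x \<noteq> z"
  proof
    assume "x = z"
    obtain A where "A \<in> \<A>" "{z} \<subseteq> vertices A"
      using common_apartment_vertices[OF z z] .
    hence "dst z z = 0"
      using dst_eq_ht ht_eq_0_iff by auto
    thus False
      using \<open>dst u1 z < dst x z\<close> \<open>x = z\<close> by simp
  qed
  have above: "nbr_le X ori ?\<eta> ?g w" if w: "w \<in> M" for w
  proof -
    have pw: "pointed X ori (Suc (length ys)) (w # ys @ [x])" and lt: "dst w z < dst x z"
      using w closer_iff by auto
    obtain A where A: "A \<in> \<A>" "set (w # ys @ [x]) \<subseteq> vertices A" "{z} \<subseteq> vertices A"
      using common_apartment_vertices[OF pointedD(1)[OF pw] z] .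
    have V: "set ?\<eta> \<subseteq> vertices A" "w \<in> vertices A" "x \<in> vertices A" "z \<in> vertices A"
      using A by auto
    have g: "nb A x ?g" "dir A x ?g = low A x z"
      using gate_in_gate[OF A(1) V(3,4) xz] by (simp_all add: gate_in_def)
    have nw: "nb A x w"
      using pointed_cons_iff[of A ys x w] A pw p by auto
    have "dir A x ?g \<subseteq> dir A x w"
      using ht_less_iff[OF A(1) nw, of z] lt dst_eq_ht A(1) V g(2) by simp
    moreover have "w \<in> nbrs X ori ?\<eta>"
      using pw nbrs_iff by simp
    ultimately show ?thesis
      using nbr_le_iff_dir[OF A(1) V(1) nb_vertices(2)[OF g(1)] V(2) g(1)] by simp
  qed
  have gW: "?g \<in> ?W"
    using above[OF u(1)] above[OF u(2)] nbrs_if_le(1)[OF un(1)] by (simp add: lower_bounds_def)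
  then obtain q where q: "q \<in> ?W" "\<And>w. w \<in> ?W \<Longrightarrow> ell X ori (q # ?\<eta>) \<le> ell X ori (w # ?\<eta>)"
    using ex_has_least_nat[of "\<lambda>w. w \<in> ?W" ?g "\<lambda>w. ell X ori (w # ?\<eta>)"] by blast
  have greatest: "pointed X ori 2 [w, q, x] \<and> ell X ori (q # ?\<eta>) < ell X ori (w # ?\<eta>)"
    if w: "w \<in> ?W" "w \<noteq> q" for w
  proof -
    have le: "nbr_le X ori ?\<eta> w u1" "nbr_le X ori ?\<eta> q u2" "nbr_le X ori ?\<eta> w u2" "nbr_le X ori ?\<eta> q u1"
      and wq: "w \<in> nbrs X ori ?\<eta>" "q \<in> nbrs X ori ?\<eta>"
      using w(1) q(1) by (auto simp: lower_bounds_def)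
    \<comment> \<open>An apartment can be prescribed to contain two simplices. Pairing
      \<open>w\<close> with \<open>u1\<close> and \<open>q\<close> with \<open>u2\<close> puts all
      four neighbours into one.\<close>
    obtain A where A: "A \<in> \<A>" "{w, u1} \<union> set ?\<eta> \<subseteq> vertices A" "{q, u2} \<union> set ?\<eta> \<subseteq> vertices A"
      using common_apartment_vertices[OF nbrs_if_le(2)[OF un(1) le(1)] nbrs_if_le(2)[OF un(2) le(2)]] .
    hence V: "set ?\<eta> \<subseteq> vertices A" "x \<in> vertices A" "w \<in> vertices A" "q \<in> vertices A"
        "u1 \<in> vertices A" "u2 \<in> vertices A"
      by auto
    have nb: "nb A x v" if "v \<in> nbrs X ori ?\<eta>" "v \<in> vertices A" for v
      using pointed_cons_iff[of A ys x v] A(1) V(1,2) p that nbrs_iff by auto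
    note nbs = nb[OF wq(1) V(3)] nb[OF wq(2) V(4)] nb[OF un(1) V(5)] nb[OF un(2) V(6)]
    have dirs: "dir A x w \<subseteq> dir A x u1" "dir A x w \<subseteq> dir A x u2"
        "dir A x q \<subseteq> dir A x u1" "dir A x q \<subseteq> dir A x u2"
      using le nbr_le_iff_dir[OF A(1) V(1)] V nbs un by blast+
    \<comment> \<open>The neighbour with direction \<open>K\<close> is itself a lower bound, so by
      minimality \<open>q\<close> has a direction at least as large; being contained in
      \<open>K\<close>, it equals \<open>K\<close>.\<close>
    define K where "K = dir A x u1 \<inter> dir A x u2"
    have K: "K \<noteq> {}" "K \<subset> {0..d}" "finite K"
      using dirs(1,2) nb_dir_nonempty[OF A(1) nbs(1)] dir_psubset[of A x u1] finite_dir[of A x u1]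
      unfolding K_def by (blast, blast, blast)
    obtain v where v: "nb A x v" "dir A x v = K"
      by (rule ex_nb[OF A(1) V(2) K(1,2)])
    have "nbr_le X ori ?\<eta> v u1" "nbr_le X ori ?\<eta> v u2"
      using nbr_le_iff_dir[OF A(1) V(1) nb_vertices(2)[OF v(1)] V(5) v(1) un(1)]
        nbr_le_iff_dir[OF A(1) V(1) nb_vertices(2)[OF v(1)] V(6) v(1) un(2)] v(2) by (auto simp: K_def)
    hence "v \<in> ?W"
      using nbrs_if_le(1)[OF un(1)] by (simp add: lower_bounds_def)
    hence "ht A x q \<le> ht A x v"
      using q(2) ell_eq_ht[OF A(1) v(1)] ell_eq_ht[OF A(1) nbs(2)] by metis
    hence "card K \<le> card (dir A x q)"
      using ht_nb_from[OF A(1) v(1)] ht_nb_from[OF A(1) nbs(2)] v(2)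
        card_dir_le[of A x v] card_dir_le[of A x q] by simp
    hence "dir A x q = K"
      using card_seteq[OF K(3)] dirs(3,4) by (simp add: K_def)
    hence "dir A x w \<subset> dir A x q"
      using dirs(1,2) nb_inj[OF A(1) nbs(1,2)] w(2) by (auto simp: K_def)
    moreover from this have "card (dir A x w) < card (dir A x q)"
      by (rule psubset_card_mono[OF finite_dir])
    ultimately show ?thesis
      using pointed_triangle_iff[OF A(1) V(2-4)] nbs ell_eq_ht[OF A(1) nbs(1)] ell_eq_ht[OF A(1) nbs(2)]
        ht_nb_from[OF A(1) nbs(1)] ht_nb_from[OF A(1) nbs(2)] card_dir_le[of A x q] by simp
  qed
  have "(THE v. v \<in> ?W \<and> (\<forall>w\<in>?W. w \<noteq> v \<longrightarrow> ell X ori (v # ?\<eta>) < ell X ori (w # ?\<eta>))) = q"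
  proof (rule the_equality)
    fix v assume v: "v \<in> ?W \<and> (\<forall>w\<in>?W. w \<noteq> v \<longrightarrow> ell X ori (v # ?\<eta>) < ell X ori (w # ?\<eta>))"
    show "v = q"
    proof (rule ccontr)
      assume "v \<noteq> q"
      hence "ell X ori (v # ?\<eta>) < ell X ori (q # ?\<eta>)"
        using bspec[OF conjunct2[OF v] q(1)] by simp
      thus False
        using q(2)[of v] v by simp
    qed
  qed (use q(1) greatest in blast)
  hence meet: "meet_vertex X ori ?\<eta> u1 u2 = Some q"
    using gW unfolding meet_vertex_def Let_def by auto
  have pq: "pointed X ori (Suc (length ys)) (q # ys @ [x])"
    using q(1) nbrs_iff by (simp add: lower_bounds_def)
  have "{q, x} \<in> X" "q \<noteq> x"
    using face_in[OF pointedD(1)[OF pq]] pointedD(3)[OF pq] by auto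
  moreover have "q = ?g \<or> pointed X ori 2 [?g, q, x]"
    using greatest[OF gW] by blast
  ultimately have "dst q z < dst x z"
    using closer_iff_above_gate[OF z _ _ xz] by blast
  hence "q \<in> M"
    using pq closer_iff by simp
  with meet show "\<exists>u\<in>M. meet_vertex X ori ?\<eta> u1 u2 = Some u"
    by blast
qed

end

end

subsection \<open>The coboundary\<close>

text \<open>The cancellation behind the vanishing of the squared coboundary: the factors for
  \<open>(v, w)\<close> and \<open>(w, v)\<close> are inverse. Adding \<open>a\<close> to the set
  contributes exactly the pairs that involve \<open>a\<close>.\<close>

lemma (in comm_group) finprod_antisymmetric:
  assumes "finite A"
    and "\<And>v w. v \<in> A \<Longrightarrow> w \<in> A \<Longrightarrow> v \<noteq> w \<Longrightarrow> g v w \<in> carrier G \<and> g w v = inv (g v w)"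
  shows "finprod G (\<lambda>v. finprod G (g v) (A - {v})) A = \<one>"
  using assms
proof (induction A rule: finite_induct)
  case (insert a A)
  have car: "g v w \<in> carrier G" if "v \<in> insert a A" "w \<in> insert a A" "v \<noteq> w" for v w
    using insert.prems that by blast
  have inner: "finprod G (g v) (insert a A - {v}) = g v a \<otimes> finprod G (g v) (A - {v})" if v: "v \<in> A" for v
  proof -
    have "insert a A - {v} = insert a (A - {v})"
      using v insert.hyps(2) by auto
    moreover have "finprod G (g v) (insert a (A - {v})) = g v a \<otimes> finprod G (g v) (A - {v})"
      by (rule finprod_insert) (use car v insert.hyps in auto)
    ultimately show ?thesis by simp
  qed
  have closed: "(\<lambda>v. finprod G (g v) (A - {v})) \<in> A \<rightarrow> carrier G" "(\<lambda>v. g v a) \<in> A \<rightarrow> carrier G"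
      "g a \<in> A \<rightarrow> carrier G"
    using car insert.hyps(2) by (auto intro!: finprod_closed)
  have "finprod G (\<lambda>v. finprod G (g v) (insert a A - {v})) A =
      finprod G (\<lambda>v. g v a \<otimes> finprod G (g v) (A - {v})) A"
    by (rule finprod_cong') (use inner closed in \<open>auto simp: Pi_iff\<close>)
  also have "\<dots> = finprod G (\<lambda>v. g v a) A \<otimes> finprod G (\<lambda>v. finprod G (g v) (A - {v})) A"
    using closed by simp
  also have "finprod G (\<lambda>v. finprod G (g v) (A - {v})) A = \<one>"
    by (rule insert.IH, rule insert.prems) blast+
  finally have outer: "finprod G (\<lambda>v. finprod G (g v) (insert a A - {v})) A = finprod G (\<lambda>v. g v a) A"
    using closed by simp
  have "finprod G (\<lambda>v. finprod G (g v) (insert a A - {v})) (insert a A) =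
      finprod G (g a) (insert a A - {a}) \<otimes> finprod G (\<lambda>v. finprod G (g v) (insert a A - {v})) A"
    by (rule finprod_insert) (use car insert.hyps in \<open>auto intro!: finprod_closed\<close>)
  also have "insert a A - {a} = A"
    using insert.hyps by auto
  also have "finprod G (g a) A \<otimes> finprod G (\<lambda>v. finprod G (g v) (insert a A - {v})) A =
      finprod G (\<lambda>v. g a v \<otimes> g v a) A"
    unfolding outer using closed by simp
  also have "\<dots> = \<one>"
  proof (rule finprod_one_eqI)
    fix v assume v: "v \<in> A"
    hence "a \<noteq> v"
      using insert.hyps by auto
    with v have "g v a = inv (g a v)" "g a v \<in> carrier G"
      using insert.prems[of a v] by blast+
    thus "g a v \<otimes> g v a = \<one>" by simp
  qed
  finally show ?case .
qed simp

lemma hom_finprod: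
  assumes G: "comm_group G" and H: "comm_group H" and h: "h \<in> hom G H"
    and f: "f \<in> A \<rightarrow> carrier G" and fin: "finite A"
  shows "h (finprod G f A) = finprod H (\<lambda>x. h (f x)) A"
  using fin f
proof (induction A rule: finite_induct)
  interpret G: comm_group G by (rule G)
  interpret H: comm_group H by (rule H)
  {
    case empty
    show ?case
      using hom_one[OF h] by (simp add: G.group_axioms H.group_axioms)
  next
    case (insert a A)
    hence "h (finprod G f (insert a A)) = h (f a) \<otimes>\<^bsub>H\<^esub> h (finprod G f A)"
      using h by (simp add: hom_mult Pi_iff)
    also have "\<dots> = h (f a) \<otimes>\<^bsub>H\<^esub> finprod H (\<lambda>x. h (f x)) A"
      using insert by (simp add: Pi_iff)
    also have "\<dots> = finprod H (\<lambda>x. h (f x)) (insert a A)"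
      using insert hom_in_carrier[OF h] by (simp add: Pi_iff)
    finally show ?case .
  }
qed

lemma simplices_face:
  assumes "simplicial_complex X" "\<tau> \<in> simplices X (Suc k)" "v \<in> \<tau>"
  shows "\<tau> - {v} \<in> simplices X k"
proof -
  have \<tau>: "\<tau> \<in> X" "finite \<tau>" "card \<tau> = Suc (Suc k)"
    using assms(2) by (auto simp: simplices_def)
  have c: "card (\<tau> - {v}) = Suc k"
    using \<tau> assms(3) by simp
  hence "\<tau> - {v} \<noteq> {}"
    by (metis card.empty nat.distinct(1))
  hence "\<tau> - {v} \<in> X"
    using simplicial_complex_face[OF assms(1) \<tau>(1)] by simp
  thus ?thesis
    using \<tau>(2) c by (simp add: simplices_def)
qed

lemma simplices_subfaces:
  assumes "simplicial_complex X" "\<tau> \<in> simplices X (Suc k)"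
  shows "{\<tau>' \<in> simplices X k. \<tau>' \<subset> \<tau>} = (\<lambda>v. \<tau> - {v}) ` \<tau>"
proof (intro equalityI subsetI)
  fix \<rho> assume \<rho>: "\<rho> \<in> {\<tau>' \<in> simplices X k. \<tau>' \<subset> \<tau>}"
  have "card (\<tau> - \<rho>) = 1"
    using \<rho> assms(2) by (auto simp: simplices_def card_Diff_subset)
  then obtain v where "\<tau> - \<rho> = {v}"
    by (auto simp: card_1_singleton_iff)
  hence "\<rho> = \<tau> - {v}" "v \<in> \<tau>"
    using \<rho> by auto
  thus "\<rho> \<in> (\<lambda>v. \<tau> - {v}) ` \<tau>"
    by blast
qed (use simplices_face[OF assms] in auto)

section \<open>Cochains of a coefficient system, with the building replaced by a function on its
  vertices\<close>

definition closer_set :: "'v set set \<Rightarrow> ('v \<Rightarrow> nat) \<Rightarrow> 'v set \<Rightarrow> 'v set" where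
  "closer_set X f \<eta> = {u. insert u \<eta> \<in> X \<and> (\<forall>y\<in>\<eta>. f u < f y)}"

text \<open>The unique \<eta> to which a simplex belongs: the vertex with the smallest value is
  removed.\<close>

definition base_face :: "('v \<Rightarrow> nat) \<Rightarrow> 'v set \<Rightarrow> 'v set" where
  "base_face f \<sigma> = \<sigma> - {arg_min_on f \<sigma>}"

locale coefficient_complex =
  fixes X :: "'v set set"
    and lab :: "'v \<Rightarrow> nat"
    and F :: "'v set \<Rightarrow> 'a monoid"
    and r :: "'v set \<Rightarrow> 'v set \<Rightarrow> 'a \<Rightarrow> 'a"
  assumes complex: "simplicial_complex X"
    and coefficients: "coefficient_system X F r"
    and lab_inj: "\<sigma> \<in> X \<Longrightarrow> inj_on lab \<sigma>"
begin

lemma F_group: "\<sigma> \<in> X \<Longrightarrow> comm_group (F \<sigma>)"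
  using coefficients unfolding coefficient_system_def by (elim conjE) blast

lemma r_hom: "\<tau> \<in> X \<Longrightarrow> \<sigma> \<in> X \<Longrightarrow> \<tau> \<subseteq> \<sigma> \<Longrightarrow> r \<tau> \<sigma> \<in> hom (F \<tau>) (F \<sigma>)"
  using coefficients unfolding coefficient_system_def by (elim conjE) blast

lemma r_comp:
  "\<tau> \<in> X \<Longrightarrow> \<sigma> \<in> X \<Longrightarrow> \<rho> \<in> X \<Longrightarrow> \<tau> \<subseteq> \<sigma> \<Longrightarrow> \<sigma> \<subseteq> \<rho> \<Longrightarrow> a \<in> carrier (F \<tau>) \<Longrightarrow>
    r \<sigma> \<rho> (r \<tau> \<sigma> a) = r \<tau> \<rho> a"
  using coefficients unfolding coefficient_system_def by (elim conjE) blast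

lemma simplices_in: "\<sigma> \<in> simplices X k \<Longrightarrow> \<sigma> \<in> X"
  by (simp add: simplices_def)

lemma simplices_finite: "\<sigma> \<in> simplices X k \<Longrightarrow> finite \<sigma>"
  by (simp add: simplices_def)

abbreviation D :: "nat \<Rightarrow> ('v set \<Rightarrow> 'a) \<Rightarrow> 'v set \<Rightarrow> 'a" where
  "D k c \<equiv> coboundary X lab F r k c"

definition sg :: "'v set \<Rightarrow> 'v \<Rightarrow> int" where
  "sg \<tau> v = (-1) ^ card {w \<in> \<tau>. lab w < lab v}"

text \<open>Cochains without the requirement to be undefined off the simplices, so that they can be
  given by pointwise formulas. The passage to the product groups is made once, by
  restriction.\<close>

definition vals :: "nat \<Rightarrow> ('v set \<Rightarrow> 'a) \<Rightarrow> bool" where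
  "vals k c \<longleftrightarrow> (\<forall>\<sigma>\<in>simplices X k. c \<sigma> \<in> carrier (F \<sigma>))"

definition summand :: "('v set \<Rightarrow> 'a) \<Rightarrow> 'v set \<Rightarrow> 'v \<Rightarrow> 'a" where
  "summand c \<tau> v = r (\<tau> - {v}) \<tau> (c (\<tau> - {v})) [^]\<^bsub>F \<tau>\<^esub> sg \<tau> v"

lemma r_face_closed:
  assumes \<tau>: "\<tau> \<in> simplices X (Suc k)" and v: "v \<in> \<tau>" and a: "a \<in> carrier (F (\<tau> - {v}))"
  shows "r (\<tau> - {v}) \<tau> a \<in> carrier (F \<tau>)"
  by (rule hom_in_carrier[OF r_hom[OF simplices_in[OF simplices_face[OF complex \<tau> v]] simplices_in[OF \<tau>]] a])
    blast

lemma summand_closed: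
  assumes \<tau>: "\<tau> \<in> simplices X (Suc k)" and v: "v \<in> \<tau>" and c: "vals k c"
  shows "summand c \<tau> v \<in> carrier (F \<tau>)"
proof -
  interpret G: comm_group "F \<tau>"
    by (rule F_group[OF simplices_in[OF \<tau>]])
  show ?thesis
    unfolding summand_def
    using r_face_closed[OF \<tau> v] c simplices_face[OF complex \<tau> v] by (simp add: vals_def)
qed

lemma D_eq:
  assumes \<tau>: "\<tau> \<in> simplices X (Suc k)" and c: "vals k c"
  shows "D k c \<tau> = finprod (F \<tau>) (summand c \<tau>) \<tau>"
proof -
  interpret G: comm_group "F \<tau>"
    by (rule F_group[OF simplices_in[OF \<tau>]])
  let ?f = "\<lambda>\<tau>'. r \<tau>' \<tau> (c \<tau>') [^]\<^bsub>F \<tau>\<^esub> incidence_number lab \<tau> \<tau>'"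
  have inc: "incidence_number lab \<tau> (\<tau> - {v}) = sg \<tau> v" if "v \<in> \<tau>" for v
  proof -
    have "\<tau> - (\<tau> - {v}) = {v}"
      using that by auto
    thus ?thesis
      by (simp add: incidence_number_def sg_def)
  qed
  have "D k c \<tau> = finprod (F \<tau>) ?f ((\<lambda>v. \<tau> - {v}) ` \<tau>)"
    using \<tau> simplices_subfaces[OF complex \<tau>] by (simp add: coboundary_def)
  also have "\<dots> = finprod (F \<tau>) (\<lambda>v. ?f (\<tau> - {v})) \<tau>"
  proof (rule G.finprod_reindex)
    show "?f \<in> (\<lambda>v. \<tau> - {v}) ` \<tau> \<rightarrow> carrier (F \<tau>)"
      using inc summand_closed[OF \<tau> _ c] by (auto simp: summand_def)
    show "inj_on (\<lambda>v. \<tau> - {v}) \<tau>"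
      by (auto simp: inj_on_def)
  qed
  also have "\<dots> = finprod (F \<tau>) (summand c \<tau>) \<tau>"
    by (rule G.finprod_cong') (use inc summand_closed[OF \<tau> _ c] in \<open>auto simp: summand_def\<close>)
  finally show ?thesis .
qed

lemma D_closed:
  assumes \<tau>: "\<tau> \<in> simplices X (Suc k)" and c: "vals k c"
  shows "D k c \<tau> \<in> carrier (F \<tau>)"
proof -
  interpret G: comm_group "F \<tau>"
    by (rule F_group[OF simplices_in[OF \<tau>]])
  show ?thesis
    unfolding D_eq[OF assms] using summand_closed[OF \<tau> _ c] by (intro G.finprod_closed) auto
qed

lemma vals_D: "vals k c \<Longrightarrow> vals (Suc k) (D k c)"
  using D_closed by (simp add: vals_def)

lemma D_cong:
  assumes \<tau>: "\<tau> \<in> simplices X (Suc k)" and c: "vals k c" "vals k c'"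
    and eq: "\<And>v. v \<in> \<tau> \<Longrightarrow> c (\<tau> - {v}) = c' (\<tau> - {v})"
  shows "D k c \<tau> = D k c' \<tau>"
proof -
  interpret G: comm_group "F \<tau>"
    by (rule F_group[OF simplices_in[OF \<tau>]])
  show ?thesis
    unfolding D_eq[OF \<tau> c(1)] D_eq[OF \<tau> c(2)]
    by (rule G.finprod_cong') (use eq summand_closed[OF \<tau> _ c(2)] in \<open>auto simp: summand_def\<close>)
qed

lemma vals_mult:
  assumes "vals k c" "vals k c'"
  shows "vals k (\<lambda>\<sigma>. c \<sigma> \<otimes>\<^bsub>F \<sigma>\<^esub> c' \<sigma>)"
  unfolding vals_def
proof
  fix \<sigma> assume \<sigma>: "\<sigma> \<in> simplices X k"
  interpret G: comm_group "F \<sigma>"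
    by (rule F_group[OF simplices_in[OF \<sigma>]])
  show "c \<sigma> \<otimes>\<^bsub>F \<sigma>\<^esub> c' \<sigma> \<in> carrier (F \<sigma>)"
    using assms \<sigma> by (simp add: vals_def)
qed

lemma vals_inv:
  assumes "vals k c"
  shows "vals k (\<lambda>\<sigma>. inv\<^bsub>F \<sigma>\<^esub> c \<sigma>)"
  unfolding vals_def
proof
  fix \<sigma> assume \<sigma>: "\<sigma> \<in> simplices X k"
  interpret G: comm_group "F \<sigma>"
    by (rule F_group[OF simplices_in[OF \<sigma>]])
  show "inv\<^bsub>F \<sigma>\<^esub> c \<sigma> \<in> carrier (F \<sigma>)"
    using assms \<sigma> by (simp add: vals_def)
qed

lemma D_mult:
  assumes \<tau>: "\<tau> \<in> simplices X (Suc k)" and c: "vals k c" "vals k c'"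
  shows "D k (\<lambda>\<sigma>. c \<sigma> \<otimes>\<^bsub>F \<sigma>\<^esub> c' \<sigma>) \<tau> = D k c \<tau> \<otimes>\<^bsub>F \<tau>\<^esub> D k c' \<tau>"
proof -
  interpret G: comm_group "F \<tau>"
    by (rule F_group[OF simplices_in[OF \<tau>]])
  have "summand (\<lambda>\<sigma>. c \<sigma> \<otimes>\<^bsub>F \<sigma>\<^esub> c' \<sigma>) \<tau> v = summand c \<tau> v \<otimes>\<^bsub>F \<tau>\<^esub> summand c' \<tau> v" if v: "v \<in> \<tau>" for v
  proof -
    note face = simplices_face[OF complex \<tau> v]
    have cv: "c (\<tau> - {v}) \<in> carrier (F (\<tau> - {v}))" "c' (\<tau> - {v}) \<in> carrier (F (\<tau> - {v}))"
      using c face by (auto simp: vals_def)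
    have "r (\<tau> - {v}) \<tau> (c (\<tau> - {v}) \<otimes>\<^bsub>F (\<tau> - {v})\<^esub> c' (\<tau> - {v})) =
        r (\<tau> - {v}) \<tau> (c (\<tau> - {v})) \<otimes>\<^bsub>F \<tau>\<^esub> r (\<tau> - {v}) \<tau> (c' (\<tau> - {v}))"
      using hom_mult[OF r_hom[OF simplices_in[OF face] simplices_in[OF \<tau>]] cv] by blast
    thus ?thesis
      unfolding summand_def
      using r_face_closed[OF \<tau> v cv(1)] r_face_closed[OF \<tau> v cv(2)]
      by (simp add: G.int_pow_mult_distrib G.m_comm)
  qed
  hence "D k (\<lambda>\<sigma>. c \<sigma> \<otimes>\<^bsub>F \<sigma>\<^esub> c' \<sigma>) \<tau> =
      finprod (F \<tau>) (\<lambda>v. summand c \<tau> v \<otimes>\<^bsub>F \<tau>\<^esub> summand c' \<tau> v) \<tau>"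
    unfolding D_eq[OF \<tau> vals_mult[OF c]]
    by (intro G.finprod_cong') (use summand_closed[OF \<tau>] c in auto)
  also have "\<dots> = D k c \<tau> \<otimes>\<^bsub>F \<tau>\<^esub> D k c' \<tau>"
    unfolding D_eq[OF \<tau> c(1)] D_eq[OF \<tau> c(2)]
    by (rule G.finprod_multf) (use summand_closed[OF \<tau>] c in auto)
  finally show ?thesis .
qed

lemma summand_one:
  assumes \<tau>: "\<tau> \<in> simplices X (Suc k)" and v: "v \<in> \<tau>"
    and one: "c (\<tau> - {v}) = \<one>\<^bsub>F (\<tau> - {v})\<^esub>"
  shows "summand c \<tau> v = \<one>\<^bsub>F \<tau>\<^esub>"
proof -
  note face = simplices_face[OF complex \<tau> v]
  interpret G: comm_group "F \<tau>"
    by (rule F_group[OF simplices_in[OF \<tau>]])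
  interpret H: comm_group "F (\<tau> - {v})"
    by (rule F_group[OF simplices_in[OF face]])
  have "r (\<tau> - {v}) \<tau> \<in> hom (F (\<tau> - {v})) (F \<tau>)"
    by (rule r_hom[OF simplices_in[OF face] simplices_in[OF \<tau>]]) blast
  hence "r (\<tau> - {v}) \<tau> \<one>\<^bsub>F (\<tau> - {v})\<^esub> = \<one>\<^bsub>F \<tau>\<^esub>"
    by (rule hom_one[OF _ H.group_axioms G.group_axioms])
  thus ?thesis
    by (simp add: summand_def one)
qed

lemma D_one:
  assumes \<tau>: "\<tau> \<in> simplices X (Suc k)" and c: "vals k c"
    and one: "\<And>v. v \<in> \<tau> \<Longrightarrow> c (\<tau> - {v}) = \<one>\<^bsub>F (\<tau> - {v})\<^esub>"
  shows "D k c \<tau> = \<one>\<^bsub>F \<tau>\<^esub>"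
proof -
  interpret G: comm_group "F \<tau>"
    by (rule F_group[OF simplices_in[OF \<tau>]])
  show ?thesis
    unfolding D_eq[OF \<tau> c] by (rule G.finprod_one_eqI) (rule summand_one[where c = c, OF \<tau> _ one])
qed

lemma D_single:
  assumes \<tau>: "\<tau> \<in> simplices X (Suc k)" and c: "vals k c" and v: "v \<in> \<tau>"
    and one: "\<And>w. w \<in> \<tau> \<Longrightarrow> w \<noteq> v \<Longrightarrow> c (\<tau> - {w}) = \<one>\<^bsub>F (\<tau> - {w})\<^esub>"
  shows "D k c \<tau> = summand c \<tau> v"
proof -
  interpret G: comm_group "F \<tau>"
    by (rule F_group[OF simplices_in[OF \<tau>]])
  have "finprod (F \<tau>) (summand c \<tau>) \<tau> = finprod (F \<tau>) (\<lambda>w. if w = v then summand c \<tau> w else \<one>\<^bsub>F \<tau>\<^esub>) \<tau>"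
    by (rule G.finprod_cong') (use summand_closed[OF \<tau> _ c] summand_one[where c = c, OF \<tau> _ one] in auto)
  also have "\<dots> = summand c \<tau> v"
    by (rule G.finprod_singleton_swap[OF v simplices_finite[OF \<tau>]]) (use summand_closed[OF \<tau> _ c] in auto)
  finally show ?thesis
    using D_eq[OF \<tau> c] by simp
qed

lemma D_inv:
  assumes \<tau>: "\<tau> \<in> simplices X (Suc k)" and c: "vals k c"
  shows "D k (\<lambda>\<sigma>. inv\<^bsub>F \<sigma>\<^esub> c \<sigma>) \<tau> = inv\<^bsub>F \<tau>\<^esub> D k c \<tau>"
proof -
  interpret G: comm_group "F \<tau>"
    by (rule F_group[OF simplices_in[OF \<tau>]])
  have "D k (\<lambda>\<sigma>. c \<sigma> \<otimes>\<^bsub>F \<sigma>\<^esub> inv\<^bsub>F \<sigma>\<^esub> c \<sigma>) \<tau> = \<one>\<^bsub>F \<tau>\<^esub>"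
  proof (rule D_one[OF \<tau> vals_mult[OF c vals_inv[OF c]]])
    fix v assume "v \<in> \<tau>"
    note face = simplices_face[OF complex \<tau> this]
    interpret H: comm_group "F (\<tau> - {v})"
      by (rule F_group[OF simplices_in[OF face]])
    show "c (\<tau> - {v}) \<otimes>\<^bsub>F (\<tau> - {v})\<^esub> inv\<^bsub>F (\<tau> - {v})\<^esub> c (\<tau> - {v}) = \<one>\<^bsub>F (\<tau> - {v})\<^esub>"
      using c face by (simp add: vals_def)
  qed
  hence "D k c \<tau> \<otimes>\<^bsub>F \<tau>\<^esub> D k (\<lambda>\<sigma>. inv\<^bsub>F \<sigma>\<^esub> c \<sigma>) \<tau> = \<one>\<^bsub>F \<tau>\<^esub>"
    using D_mult[OF \<tau> c vals_inv[OF c]] by simp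
  thus ?thesis
    using G.inv_equality[of "D k (\<lambda>\<sigma>. inv\<^bsub>F \<sigma>\<^esub> c \<sigma>) \<tau>" "D k c \<tau>"] D_closed[OF \<tau> c] D_closed[OF \<tau> vals_inv[OF c]]
    by (simp add: G.m_comm)
qed

text \<open>Removing the vertex with the larger label leaves the position of the other one
  unchanged, while removing the smaller one moves the other by one place.\<close>

lemma sg_swap:
  assumes \<tau>: "\<tau> \<in> X" and vw: "v \<in> \<tau>" "w \<in> \<tau>" "v \<noteq> w"
  shows "sg (\<tau> - {w}) v * sg \<tau> w = - (sg (\<tau> - {v}) w * sg \<tau> v)"
proof -
  have fin: "finite \<tau>"
    by (rule simplicial_complex_finite[OF complex \<tau>])
  have *: "sg (\<tau> - {b}) a = sg \<tau> a" "sg (\<tau> - {a}) b = - sg \<tau> b"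
    if ab: "a \<in> \<tau>" "b \<in> \<tau>" "lab a < lab b" for a b
  proof -
    have "{u \<in> \<tau> - {b}. lab u < lab a} = {u \<in> \<tau>. lab u < lab a}"
      using ab by auto
    thus "sg (\<tau> - {b}) a = sg \<tau> a"
      by (simp add: sg_def)
    have "{u \<in> \<tau>. lab u < lab b} = insert a {u \<in> \<tau> - {a}. lab u < lab b}"
      using ab by auto
    hence "card {u \<in> \<tau>. lab u < lab b} = Suc (card {u \<in> \<tau> - {a}. lab u < lab b})"
      using fin by simp
    thus "sg (\<tau> - {a}) b = - sg \<tau> b"
      by (simp add: sg_def)
  qed
  have "lab v \<noteq> lab w"
    using lab_inj[OF \<tau>] vw by (auto dest: inj_onD)
  hence "lab v < lab w \<or> lab w < lab v"
    by auto
  thus ?thesis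
    using *[of v w] *[of w v] vw by auto
qed

lemma D_D:
  assumes \<tau>: "\<tau> \<in> simplices X (Suc (Suc k))" and c: "vals k c"
  shows "D (Suc k) (D k c) \<tau> = \<one>\<^bsub>F \<tau>\<^esub>"
proof -
  interpret G: comm_group "F \<tau>"
    by (rule F_group[OF simplices_in[OF \<tau>]])
  define e where "e v w = r (\<tau> - {v} - {w}) \<tau> (c (\<tau> - {v} - {w}))" for v w
  define g where "g v w = e v w [^]\<^bsub>F \<tau>\<^esub> (sg (\<tau> - {v}) w * sg \<tau> v)" for v w
  have face: "\<tau> - {v} \<in> simplices X (Suc k)" if "v \<in> \<tau>" for v
    by (rule simplices_face[OF complex \<tau> that])
  have face2: "\<tau> - {v} - {w} \<in> simplices X k" if "v \<in> \<tau>" "w \<in> \<tau> - {v}" for v w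
    by (rule simplices_face[OF complex face[OF that(1)] that(2)])
  have cl: "c (\<tau> - {v} - {w}) \<in> carrier (F (\<tau> - {v} - {w}))" if "v \<in> \<tau>" "w \<in> \<tau> - {v}" for v w
    using c face2[OF that] by (simp add: vals_def)
  have e_closed: "e v w \<in> carrier (F \<tau>)" if vw: "v \<in> \<tau>" "w \<in> \<tau> - {v}" for v w
    unfolding e_def
    by (rule hom_in_carrier[OF r_hom[OF simplices_in[OF face2[OF vw]] simplices_in[OF \<tau>]] cl[OF vw]]) blast
  have g_closed: "g v w \<in> carrier (F \<tau>)" if "v \<in> \<tau>" "w \<in> \<tau> - {v}" for v w
    using e_closed[OF that] by (simp add: g_def)
  have "summand (D k c) \<tau> v = finprod (F \<tau>) (g v) (\<tau> - {v})" if v: "v \<in> \<tau>" for v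
  proof -
    note fv = face[OF v]
    have grp: "comm_group (F (\<tau> - {v}))"
      by (rule F_group[OF simplices_in[OF fv]])
    interpret H: comm_group "F (\<tau> - {v})"
      by (rule grp)
    have hom: "r (\<tau> - {v}) \<tau> \<in> hom (F (\<tau> - {v})) (F \<tau>)"
      by (rule r_hom[OF simplices_in[OF fv] simplices_in[OF \<tau>]]) blast
    have sc: "summand c (\<tau> - {v}) w \<in> carrier (F (\<tau> - {v}))" if "w \<in> \<tau> - {v}" for w
      by (rule summand_closed[OF fv that c])
    have rw: "r (\<tau> - {v}) \<tau> (summand c (\<tau> - {v}) w) = e v w [^]\<^bsub>F \<tau>\<^esub> sg (\<tau> - {v}) w"
      if w: "w \<in> \<tau> - {v}" for w
    proof -
      have "r (\<tau> - {v}) \<tau> (summand c (\<tau> - {v}) w) =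
          r (\<tau> - {v}) \<tau> (r (\<tau> - {v} - {w}) (\<tau> - {v}) (c (\<tau> - {v} - {w}))) [^]\<^bsub>F \<tau>\<^esub> sg (\<tau> - {v}) w"
        unfolding summand_def
        by (rule hom_int_pow[OF hom r_face_closed[OF fv w cl[OF v w]] H.group_axioms G.group_axioms])
      also have "r (\<tau> - {v}) \<tau> (r (\<tau> - {v} - {w}) (\<tau> - {v}) (c (\<tau> - {v} - {w}))) = e v w"
        unfolding e_def
        by (rule r_comp[OF simplices_in[OF face2[OF v w]] simplices_in[OF fv] simplices_in[OF \<tau>] _ _ cl[OF v w]])
          blast+
      finally show ?thesis .
    qed
    have "r (\<tau> - {v}) \<tau> (D k c (\<tau> - {v})) =
        finprod (F \<tau>) (\<lambda>w. r (\<tau> - {v}) \<tau> (summand c (\<tau> - {v}) w)) (\<tau> - {v})"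
      unfolding D_eq[OF fv c]
      by (rule hom_finprod[OF grp G.comm_group_axioms hom])
        (use sc simplices_finite[OF fv] in auto)
    moreover have "(\<lambda>a. a [^]\<^bsub>F \<tau>\<^esub> sg \<tau> v) \<in> hom (F \<tau>) (F \<tau>)"
      by (rule homI) (simp_all add: G.int_pow_mult_distrib G.m_comm)
    ultimately have "summand (D k c) \<tau> v =
        finprod (F \<tau>) (\<lambda>w. r (\<tau> - {v}) \<tau> (summand c (\<tau> - {v}) w) [^]\<^bsub>F \<tau>\<^esub> sg \<tau> v) (\<tau> - {v})"
      unfolding summand_def[of "D k c"]
      using hom_finprod[OF G.comm_group_axioms G.comm_group_axioms,
          of "\<lambda>a. a [^]\<^bsub>F \<tau>\<^esub> sg \<tau> v" "\<lambda>w. r (\<tau> - {v}) \<tau> (summand c (\<tau> - {v}) w)" "\<tau> - {v}"]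
        hom_in_carrier[OF hom sc] simplices_finite[OF fv] by auto
    also have "\<dots> = finprod (F \<tau>) (g v) (\<tau> - {v})"
      by (rule G.finprod_cong')
        (use g_closed[OF v] rw e_closed[OF v] in \<open>auto simp: g_def G.int_pow_pow\<close>)
    finally show ?thesis .
  qed
  hence "D (Suc k) (D k c) \<tau> = finprod (F \<tau>) (\<lambda>v. finprod (F \<tau>) (g v) (\<tau> - {v})) \<tau>"
    unfolding D_eq[OF \<tau> vals_D[OF c]]
    by (intro G.finprod_cong') (use g_closed in \<open>auto intro!: G.finprod_closed\<close>)
  also have "\<dots> = \<one>\<^bsub>F \<tau>\<^esub>"
  proof (rule G.finprod_antisymmetric[OF simplices_finite[OF \<tau>]])
    fix v w assume vw: "v \<in> \<tau>" "w \<in> \<tau>" "v \<noteq> w"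
    have "\<tau> - {v} - {w} = \<tau> - {w} - {v}"
      by auto
    hence "e w v = e v w"
      by (simp add: e_def)
    hence "g w v = inv\<^bsub>F \<tau>\<^esub> (g v w)"
      using sg_swap[OF simplices_in[OF \<tau>] vw] e_closed[of v w] vw by (simp add: g_def G.int_pow_neg)
    thus "g v w \<in> carrier (F \<tau>) \<and> g w v = inv\<^bsub>F \<tau>\<^esub> (g v w)"
      using g_closed vw by simp
  qed
  finally show ?thesis .
qed

lemma vals_iff: "vals k c \<longleftrightarrow> restrict c (simplices X k) \<in> carrier (cochains X F k)"
  by (auto simp: vals_def cochains_def PiE_iff)

lemma D_restrict:
  assumes c: "vals k c"
  shows "D k (restrict c (simplices X k)) = D k c"
proof
  fix \<tau>
  show "D k (restrict c (simplices X k)) \<tau> = D k c \<tau>"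
  proof (cases "\<tau> \<in> simplices X (Suc k)")
    case True
    show ?thesis
      by (rule D_cong[OF True _ c])
        (use c simplices_face[OF complex True] in \<open>simp_all add: vals_def\<close>)
  qed (simp add: coboundary_def)
qed

lemma group_cochains: "group (cochains X F k)"
  unfolding cochains_def
  by (rule product_group) (rule comm_group.axioms(2)[OF F_group[OF simplices_in]])

lemma D_hom: "D k \<in> hom (cochains X F k) (cochains X F (Suc k))"
proof (rule homI)
  fix b assume "b \<in> carrier (cochains X F k)"
  hence "vals k b"
    by (auto simp: vals_def cochains_def PiE_iff)
  moreover have "restrict (D k b) (simplices X (Suc k)) = D k b"
    by (auto simp: coboundary_def)
  ultimately show "D k b \<in> carrier (cochains X F (Suc k))"
    using vals_D vals_iff by metis
next
  fix b b' assume "b \<in> carrier (cochains X F k)" "b' \<in> carrier (cochains X F k)"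
  hence v: "vals k b" "vals k b'"
    by (auto simp: vals_def cochains_def PiE_iff)
  have "b \<otimes>\<^bsub>cochains X F k\<^esub> b' = restrict (\<lambda>\<sigma>. b \<sigma> \<otimes>\<^bsub>F \<sigma>\<^esub> b' \<sigma>) (simplices X k)"
    by (simp add: cochains_def)
  hence eq: "D k (b \<otimes>\<^bsub>cochains X F k\<^esub> b') = D k (\<lambda>\<sigma>. b \<sigma> \<otimes>\<^bsub>F \<sigma>\<^esub> b' \<sigma>)"
    using D_restrict[OF vals_mult[OF v]] by simp
  show "D k (b \<otimes>\<^bsub>cochains X F k\<^esub> b') = D k b \<otimes>\<^bsub>cochains X F (Suc k)\<^esub> D k b'"
  proof
    fix \<tau>
    show "D k (b \<otimes>\<^bsub>cochains X F k\<^esub> b') \<tau> = (D k b \<otimes>\<^bsub>cochains X F (Suc k)\<^esub> D k b') \<tau>"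
      unfolding eq
      by (cases "\<tau> \<in> simplices X (Suc k)")
        (use D_mult[OF _ v] in \<open>simp_all add: cochains_def coboundary_def\<close>)
  qed
qed

lemma D_group_hom: "group_hom (cochains X F k) (cochains X F (Suc k)) (D k)"
  using group_cochains D_hom by (simp add: group_hom_def group_hom_axioms_def)

lemma trivial_cohomologyI:
  assumes "\<And>c. vals (Suc k) c \<Longrightarrow> (\<And>\<tau>. \<tau> \<in> simplices X (Suc (Suc k)) \<Longrightarrow> D (Suc k) c \<tau> = \<one>\<^bsub>F \<tau>\<^esub>) \<Longrightarrow>
    \<exists>b. vals k b \<and> (\<forall>\<sigma>\<in>simplices X (Suc k). D k b \<sigma> = c \<sigma>)"
  shows "trivial_group (cohomology X lab F r (Suc k))"
proof -
  let ?C = "cochains X F (Suc k)" and ?K = "kernel (cochains X F (Suc k)) (cochains X F (Suc (Suc k))) (D (Suc k))"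
  define H where "H = D k ` carrier (cochains X F k)"
  have group: "group ?C"
    by (rule group_cochains)
  have H: "subgroup H ?C"
    unfolding H_def by (rule group_hom.img_is_subgroup[OF D_group_hom])
  have "?K \<subseteq> H"
  proof
    fix c assume c: "c \<in> ?K"
    hence c1: "c \<in> carrier ?C" and c2: "D (Suc k) c = \<one>\<^bsub>cochains X F (Suc (Suc k))\<^esub>"
      by (auto simp: kernel_def)
    have "vals (Suc k) c"
      using c1 by (auto simp: vals_def cochains_def PiE_iff)
    moreover have "D (Suc k) c \<tau> = \<one>\<^bsub>F \<tau>\<^esub>" if "\<tau> \<in> simplices X (Suc (Suc k))" for \<tau>
      unfolding c2 using that by (simp add: cochains_def product_group_def)
    ultimately obtain b where b: "vals k b" "\<forall>\<sigma>\<in>simplices X (Suc k). D k b \<sigma> = c \<sigma>"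
      using assms by blast
    have "D k b \<tau> = c \<tau>" for \<tau>
      using b(2) c1
      by (cases "\<tau> \<in> simplices X (Suc k)") (auto simp: coboundary_def cochains_def PiE_iff extensional_def)
    hence "D k (restrict b (simplices X k)) = c"
      using D_restrict[OF b(1)] by auto
    thus "c \<in> H"
      using b(1) unfolding H_def vals_iff by blast
  qed
  moreover have "\<one>\<^bsub>?C\<^esub> \<in> ?K"
    by (rule subgroup.one_closed[OF group_hom.subgroup_kernel[OF D_group_hom]])
  \<comment> \<open>Each cocycle lies in the image \<open>H\<close>, so its coset is
    \<open>H\<close>; the unit shows that at least one coset occurs.\<close>
  ultimately have cosets: "{\<Union>h\<in>H. {h \<otimes>\<^bsub>?C\<^esub> a} | a. a \<in> ?K} = {H}"
    using subgroup.rcos_const[OF H group] unfolding r_coset_def by blast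
  let ?Q = "cohomology X lab F r (Suc k)"
  have carrier: "carrier ?Q = {H}"
    using cosets
    by (simp add: cohomology_def FactGroup_def RCOSETS_def r_coset_def H_def[symmetric] Setcompr_eq_image UNION_singleton_eq_range)
  have one: "\<one>\<^bsub>?Q\<^esub> = H"
    by (simp add: cohomology_def FactGroup_def H_def)
  have mult: "H \<otimes>\<^bsub>?Q\<^esub> H = H"
    using group.subgroup_mult_id[OF group H]
    by (simp add: cohomology_def FactGroup_def set_mult_def H_def[symmetric])
  have "group ?Q"
    by (rule groupI) (use carrier one mult in auto)
  thus ?thesis
    using carrier one by (simp add: trivial_group_def)
qed

subsection \<open>Vanishing of cohomology\<close>

lemma arg_min_base_face:
  assumes \<sigma>: "\<sigma> \<in> simplices X (Suc k)" and inj: "inj_on f \<sigma>"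
  defines "v \<equiv> arg_min_on f \<sigma>"
  shows "v \<in> \<sigma>" "base_face f \<sigma> = \<sigma> - {v}" "v \<in> closer_set X f (base_face f \<sigma>)" "insert v (base_face f \<sigma>) = \<sigma>"
proof -
  have fin: "finite \<sigma>" "\<sigma> \<noteq> {}"
    using \<sigma> by (auto simp: simplices_def)
  have v: "v \<in> \<sigma>" "\<And>y. y \<in> \<sigma> \<Longrightarrow> f v \<le> f y"
    using arg_min_if_finite[OF fin, of f] by (auto simp: v_def not_less)
  show b: "base_face f \<sigma> = \<sigma> - {v}"
    by (simp add: base_face_def v_def)
  show i: "insert v (base_face f \<sigma>) = \<sigma>"
    using v(1) b by auto
  have "f v < f y" if "y \<in> \<sigma>" "y \<noteq> v" for y
    using v(2)[OF that(1)] inj_onD[OF inj _ that(1) v(1)] that(2) by (metis order.not_eq_order_implies_strict)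
  thus "v \<in> closer_set X f (base_face f \<sigma>)"
    using i simplices_in[OF \<sigma>] b by (simp add: closer_set_def)
  show "v \<in> \<sigma>"
    by (fact v(1))
qed

text \<open>Removing a vertex other than the nearest one removes more from the sum. Among the faces
  of a simplex the base face thus has the largest sum, and it alone matters when values of that sum
  are corrected.\<close>

lemma sum_face_less:
  fixes f :: "'v \<Rightarrow> nat"
  assumes \<sigma>: "\<sigma> \<in> simplices X (Suc k)" and inj: "inj_on f \<sigma>" and w: "w \<in> \<sigma>" "\<sigma> - {w} \<noteq> base_face f \<sigma>"
  shows "sum f (\<sigma> - {w}) < sum f (base_face f \<sigma>)"
proof -
  define v where "v = arg_min_on f \<sigma>"
  note v = arg_min_base_face(1-3)[OF \<sigma> inj, folded v_def]
  have "w \<noteq> v"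
    using w(2) v(2) by auto
  hence "f v < f w"
    using v(2,3) w(1) by (auto simp: closer_set_def)
  moreover have "sum f \<sigma> = f w + sum f (\<sigma> - {w})" "sum f \<sigma> = f v + sum f (\<sigma> - {v})"
    using sum.remove[OF simplices_finite[OF \<sigma>]] w(1) v(1) by auto
  ultimately show ?thesis
    unfolding v(2) by simp
qed

text \<open>The restriction of \<open>e\<close> to the simplices belonging to \<open>\<eta>\<close>,
  extended trivially, is still annihilated on every simplex of \<open>T2\<close>, because
  \<open>e\<close> is trivial on the faces that were cut off. Exactness then provides an element of
  \<open>F \<eta>\<close>. On a simplex belonging to \<open>\<eta>\<close> its coboundary has a
  single factor, that of the face \<open>\<eta>\<close>.\<close>

lemma local_primitive:
  fixes f :: "'v \<Rightarrow> nat"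
  assumes S: "condition_S X ori lab F r (Suc k)"
    and inj: "\<And>\<sigma>. \<sigma> \<in> X \<Longrightarrow> inj_on f \<sigma>"
    and es: "pointed X ori k es" "set es = \<eta>" "stable X ori es (closer_set X f \<eta>)"
    and flag: "\<And>u w. u \<in> closer_set X f \<eta> \<Longrightarrow> w \<in> closer_set X f \<eta> \<Longrightarrow> {u, w} \<in> X \<Longrightarrow> {u, w} \<union> \<eta> \<in> X"
    and \<eta>: "\<eta> \<in> simplices X k"
    and e: "vals (Suc k) e" "\<And>\<tau>. \<tau> \<in> simplices X (Suc (Suc k)) \<Longrightarrow> D (Suc k) e \<tau> = \<one>\<^bsub>F \<tau>\<^esub>"
    and lower: "\<And>\<sigma>. \<sigma> \<in> simplices X (Suc k) \<Longrightarrow> sum f (base_face f \<sigma>) < sum f \<eta> \<Longrightarrow> e \<sigma> = \<one>\<^bsub>F \<sigma>\<^esub>"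
  shows "\<exists>a\<in>carrier (F \<eta>). \<forall>\<sigma>\<in>simplices X (Suc k). base_face f \<sigma> = \<eta> \<longrightarrow>
    r \<eta> \<sigma> a [^]\<^bsub>F \<sigma>\<^esub> sg \<sigma> (arg_min_on f \<sigma>) = e \<sigma>"
proof -
  define M where "M = closer_set X f \<eta>"
  define T0 where "T0 = {\<eta>}"
  define T1 where "T1 = {{z} \<union> \<eta> | z. z \<in> M}"
  define T2 where "T2 = {{z, z'} \<union> \<eta> | z z'. z \<in> M \<and> z' \<in> M \<and> {z, z'} \<in> simplices X 1}"
  have fin: "finite \<eta>" "card \<eta> = Suc k"
    using \<eta> by (auto simp: simplices_def)
  have notin: "z \<notin> \<eta>" if "z \<in> M" for z
    using that by (auto simp: M_def closer_set_def)
  have T1: "T1 \<subseteq> simplices X (Suc k)"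
    using notin fin by (auto simp: T1_def M_def closer_set_def simplices_def)
  have T2: "T2 \<subseteq> simplices X (Suc (Suc k))"
  proof
    fix \<tau> assume "\<tau> \<in> T2"
    then obtain z z' where z: "\<tau> = {z, z'} \<union> \<eta>" "z \<in> M" "z' \<in> M" "{z, z'} \<in> simplices X 1"
      by (auto simp: T2_def)
    have "z \<noteq> z'"
      using z(4) by (auto simp: simplices_def)
    thus "\<tau> \<in> simplices X (Suc (Suc k))"
      using z flag fin notin by (simp add: simplices_def M_def)
  qed
  have exact: "induced_coboundary X lab F r k T0 T1 ` carrier (product_group T0 F)
      = kernel (product_group T1 F) (product_group T2 F) (induced_coboundary X lab F r (Suc k) T1 T2)"
  proof -
    have "pointed X ori (Suc k - 1) es \<and> stable X ori es M"
      using es by (simp add: M_def)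
    from S[unfolded condition_S_def Let_def, rule_format, OF this] show ?thesis
      by (simp add: T0_def T1_def T2_def es(2))
  qed
  let ?x = "restrict e T1"
  define ex where "ex = extend_trivially X F (Suc k) T1 ?x"
  have one_closed: "\<one>\<^bsub>F \<sigma>\<^esub> \<in> carrier (F \<sigma>)" if "\<sigma> \<in> X" for \<sigma>
  proof -
    interpret G: comm_group "F \<sigma>"
      by (rule F_group[OF that])
    show ?thesis by simp
  qed
  have ex: "vals (Suc k) ex"
    using e(1) one_closed[OF simplices_in] T1
    by (auto simp: vals_def ex_def extend_trivially_def)
  have Dx: "D (Suc k) ex \<tau> = \<one>\<^bsub>F \<tau>\<^esub>" if \<tau>2: "\<tau> \<in> T2" for \<tau>
  proof -
    obtain z z' where z: "\<tau> = {z, z'} \<union> \<eta>" "z \<in> M" "z' \<in> M" "{z, z'} \<in> simplices X 1"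
      using \<tau>2 by (auto simp: T2_def)
    have zz': "z \<noteq> z'"
      using z(4) by (auto simp: simplices_def)
    have \<tau>: "\<tau> \<in> simplices X (Suc (Suc k))"
      using T2 \<tau>2 by blast
    have "D (Suc k) ex \<tau> = D (Suc k) e \<tau>"
    proof (rule D_cong[OF \<tau> ex e(1)])
      fix y assume y: "y \<in> \<tau>"
      let ?\<rho> = "\<tau> - {y}"
      note \<rho> = simplices_face[OF complex \<tau> y]
      consider "y = z" | "y = z'" | "y \<in> \<eta>"
        using y z(1) by auto
      hence "?\<rho> \<in> T1 \<or> e ?\<rho> = \<one>\<^bsub>F ?\<rho>\<^esub>"
      proof cases
        case 1
        hence "?\<rho> = {z'} \<union> \<eta>"
          using z(1) zz' notin[OF z(2)] by auto
        thus ?thesis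
          using z(3) by (auto simp: T1_def)
      next
        case 2
        hence "?\<rho> = {z} \<union> \<eta>"
          using z(1) zz' notin[OF z(3)] by auto
        thus ?thesis
          using z(2) by (auto simp: T1_def)
      next
        \<comment> \<open>The nearest vertex \<open>v\<close> of the face is \<open>z\<close> or
          \<open>z'\<close>. The rank of the face is the sum over \<open>\<eta>\<close>, with
          \<open>f y\<close> replaced by the value at the other of the two, which is
          smaller.\<close>
        case 3
        define v where "v = arg_min_on f ?\<rho>"
        note v = arg_min_base_face(1-3)[OF \<rho> inj[OF simplices_in[OF \<rho>]], folded v_def]
        have ne: "y \<noteq> z" "y \<noteq> z'"
          using 3 notin z(2,3) by auto
        have in_\<rho>: "z \<in> ?\<rho>" "z' \<in> ?\<rho>"
          using z(1) ne by auto
        have "f v \<le> f u" if "u \<in> ?\<rho>" for u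
          using v(2,3) that by (cases "u = v") (auto simp: closer_set_def less_imp_le)
        hence le: "f v \<le> f z" "f v \<le> f z'"
          using in_\<rho> by auto
        have lt: "f z < f u" "f z' < f u" if "u \<in> \<eta>" for u
          using z(2,3) that by (auto simp: M_def closer_set_def)
        have "v \<notin> \<eta>"
          using lt(1)[of v] le(1) by auto
        hence "v = z \<or> v = z'"
          using v(1) z(1) by auto
        moreover have "sum f \<tau> = f z + f z' + sum f \<eta>"
          using z(1) zz' notin z(2,3) fin(1) by simp
        moreover have "sum f \<tau> = f y + (f v + sum f (?\<rho> - {v}))"
          using sum.remove[OF simplices_finite[OF \<tau>] y, of f] sum.remove[OF simplices_finite[OF \<rho>] v(1), of f]
          by simp
        ultimately have "sum f (base_face f ?\<rho>) < sum f \<eta>"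
          using lt[OF 3] unfolding v(2) by auto
        thus ?thesis
          using lower[OF \<rho>] by blast
      qed
      thus "ex ?\<rho> = e ?\<rho>"
        using \<rho> by (auto simp: ex_def extend_trivially_def)
    qed
    thus ?thesis
      using e(2)[OF \<tau>] by simp
  qed
  have "?x \<in> carrier (product_group T1 F)"
    using e(1) T1 by (auto simp: vals_def)
  moreover have "induced_coboundary X lab F r (Suc k) T1 T2 ?x = \<one>\<^bsub>product_group T2 F\<^esub>"
    using Dx by (auto simp: induced_coboundary_def ex_def)
  ultimately have "?x \<in> induced_coboundary X lab F r k T0 T1 ` carrier (product_group T0 F)"
    unfolding exact kernel_def by blast
  then obtain y where y: "y \<in> carrier (product_group T0 F)" "?x = induced_coboundary X lab F r k T0 T1 y"
    by blast
  have a: "y \<eta> \<in> carrier (F \<eta>)"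
    using y(1) by (auto simp: T0_def)
  define ey where "ey = extend_trivially X F k T0 y"
  have ey: "vals k ey"
    using a one_closed[OF simplices_in] by (auto simp: vals_def ey_def extend_trivially_def T0_def)
  have "r \<eta> \<sigma> (y \<eta>) [^]\<^bsub>F \<sigma>\<^esub> sg \<sigma> (arg_min_on f \<sigma>) = e \<sigma>"
    if \<sigma>: "\<sigma> \<in> simplices X (Suc k)" "base_face f \<sigma> = \<eta>" for \<sigma>
  proof -
    define v where "v = arg_min_on f \<sigma>"
    note v = arg_min_base_face[OF \<sigma>(1) inj[OF simplices_in[OF \<sigma>(1)]], folded v_def]
    have \<sigma>1: "\<sigma> \<in> T1"
      using v(3,4) \<sigma>(2) by (auto simp: T1_def M_def)
    have "e \<sigma> = ?x \<sigma>"
      using \<sigma>1 by simp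
    also have "\<dots> = D k ey \<sigma>"
      unfolding y(2) using \<sigma>1 by (simp add: induced_coboundary_def ey_def)
    also have "\<dots> = summand ey \<sigma> v"
    proof (rule D_single[OF \<sigma>(1) ey v(1)])
      fix w assume w: "w \<in> \<sigma>" "w \<noteq> v"
      hence "\<sigma> - {w} \<noteq> \<eta>"
        using v(1,2) \<sigma>(2) by auto
      thus "ey (\<sigma> - {w}) = \<one>\<^bsub>F (\<sigma> - {w})\<^esub>"
        using simplices_face[OF complex \<sigma>(1) w(1)] by (simp add: ey_def extend_trivially_def T0_def)
    qed
    also have "\<dots> = r \<eta> \<sigma> (y \<eta>) [^]\<^bsub>F \<sigma>\<^esub> sg \<sigma> (arg_min_on f \<sigma>)"
      using v(2) \<sigma>(2) \<eta> by (simp add: v_def summand_def ey_def extend_trivially_def T0_def)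
    finally show ?thesis ..
  qed
  thus ?thesis
    using a by blast
qed

definition primitive_below :: "('v \<Rightarrow> nat) \<Rightarrow> nat \<Rightarrow> ('v set \<Rightarrow> 'a) \<Rightarrow> nat \<Rightarrow> ('v set \<Rightarrow> 'a) \<Rightarrow> bool" where
  "primitive_below f k c n b \<longleftrightarrow> vals k b \<and>
     (\<forall>\<sigma>\<in>simplices X (Suc k). sum f (base_face f \<sigma>) < n \<longrightarrow> D k b \<sigma> = c \<sigma>)"

text \<open>The remaining error \<open>e\<close> is a cocycle that is trivial below rank
  \<open>n\<close>, so on each \<open>\<eta>\<close> with sum \<open>n\<close> a local solution
  corrects it, independently of the others.\<close>

lemma primitive_step:
  fixes f :: "'v \<Rightarrow> nat"
  assumes S: "condition_S X ori lab F r (Suc k)"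
    and inj: "\<And>\<sigma>. \<sigma> \<in> X \<Longrightarrow> inj_on f \<sigma>"
    and geom: "\<And>\<eta>. \<eta> \<in> simplices X k \<Longrightarrow> \<exists>es. pointed X ori k es \<and> set es = \<eta> \<and>
      stable X ori es (closer_set X f \<eta>) \<and>
      (\<forall>u\<in>closer_set X f \<eta>. \<forall>w\<in>closer_set X f \<eta>. {u, w} \<in> X \<longrightarrow> {u, w} \<union> \<eta> \<in> X)"
    and c: "vals (Suc k) c" "\<And>\<tau>. \<tau> \<in> simplices X (Suc (Suc k)) \<Longrightarrow> D (Suc k) c \<tau> = \<one>\<^bsub>F \<tau>\<^esub>"
    and b: "primitive_below f k c n b"
  shows "\<exists>b'. primitive_below f k c (Suc n) b' \<and> (\<forall>\<eta>. sum f \<eta> \<noteq> n \<longrightarrow> b' \<eta> = b \<eta>)"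
proof -
  have vb: "vals k b" and Db: "\<And>\<sigma>. \<sigma> \<in> simplices X (Suc k) \<Longrightarrow> sum f (base_face f \<sigma>) < n \<Longrightarrow> D k b \<sigma> = c \<sigma>"
    using b by (auto simp: primitive_below_def)
  define e where "e = (\<lambda>\<sigma>. c \<sigma> \<otimes>\<^bsub>F \<sigma>\<^esub> inv\<^bsub>F \<sigma>\<^esub> D k b \<sigma>)"
  note vDb = vals_inv[OF vals_D[OF vb]]
  have ve: "vals (Suc k) e"
    unfolding e_def by (rule vals_mult[OF c(1) vDb])
  have De: "D (Suc k) e \<tau> = \<one>\<^bsub>F \<tau>\<^esub>" if \<tau>: "\<tau> \<in> simplices X (Suc (Suc k))" for \<tau>
  proof -
    interpret G: comm_group "F \<tau>"
      by (rule F_group[OF simplices_in[OF \<tau>]])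
    show ?thesis
      unfolding e_def D_mult[OF \<tau> c(1) vDb] D_inv[OF \<tau> vals_D[OF vb]] D_D[OF \<tau> vb] c(2)[OF \<tau>] by simp
  qed
  have e_low: "e \<sigma> = \<one>\<^bsub>F \<sigma>\<^esub>" if \<sigma>: "\<sigma> \<in> simplices X (Suc k)" "sum f (base_face f \<sigma>) < n" for \<sigma>
  proof -
    interpret G: comm_group "F \<sigma>"
      by (rule F_group[OF simplices_in[OF \<sigma>(1)]])
    show ?thesis
      using Db[OF \<sigma>] c(1) \<sigma>(1) by (simp add: e_def vals_def)
  qed
  define P where "P \<eta> a \<longleftrightarrow> a \<in> carrier (F \<eta>) \<and> (\<forall>\<sigma>\<in>simplices X (Suc k). base_face f \<sigma> = \<eta> \<longrightarrow>
    r \<eta> \<sigma> a [^]\<^bsub>F \<sigma>\<^esub> sg \<sigma> (arg_min_on f \<sigma>) = e \<sigma>)" for \<eta> a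
  have exP: "\<exists>a. P \<eta> a" if \<eta>: "\<eta> \<in> simplices X k" "sum f \<eta> = n" for \<eta>
  proof -
    obtain es where es: "pointed X ori k es" "set es = \<eta>" "stable X ori es (closer_set X f \<eta>)"
        "\<forall>u\<in>closer_set X f \<eta>. \<forall>w\<in>closer_set X f \<eta>. {u, w} \<in> X \<longrightarrow> {u, w} \<union> \<eta> \<in> X"
      using geom[OF \<eta>(1)] by (elim exE conjE)
    have "\<exists>a\<in>carrier (F \<eta>). \<forall>\<sigma>\<in>simplices X (Suc k). base_face f \<sigma> = \<eta> \<longrightarrow>
        r \<eta> \<sigma> a [^]\<^bsub>F \<sigma>\<^esub> sg \<sigma> (arg_min_on f \<sigma>) = e \<sigma>"
      by (rule local_primitive[OF S inj es(1-3) _ \<eta>(1) ve De]) (use es(4) e_low \<eta>(2) in auto)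
    thus ?thesis
      unfolding P_def by blast
  qed
  define a where "a \<eta> = (if sum f \<eta> = n then SOME x. P \<eta> x else \<one>\<^bsub>F \<eta>\<^esub>)" for \<eta>
  have a: "P \<eta> (a \<eta>)" if "\<eta> \<in> simplices X k" "sum f \<eta> = n" for \<eta>
    using someI_ex[OF exP[OF that]] that(2) by (simp add: a_def)
  have va: "vals k a"
    unfolding vals_def
  proof
    fix \<eta> assume \<eta>: "\<eta> \<in> simplices X k"
    interpret G: comm_group "F \<eta>"
      by (rule F_group[OF simplices_in[OF \<eta>]])
    show "a \<eta> \<in> carrier (F \<eta>)"
      using a[OF \<eta>] by (cases "sum f \<eta> = n") (auto simp: P_def a_def)
  qed
  define b' where "b' \<eta> = (if sum f \<eta> = n then b \<eta> \<otimes>\<^bsub>F \<eta>\<^esub> a \<eta> else b \<eta>)" for \<eta>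
  have b': "b' \<eta> = b \<eta> \<otimes>\<^bsub>F \<eta>\<^esub> a \<eta>" if \<eta>: "\<eta> \<in> simplices X k" for \<eta>
  proof -
    interpret G: comm_group "F \<eta>"
      by (rule F_group[OF simplices_in[OF \<eta>]])
    show ?thesis
      using vb \<eta> by (simp add: b'_def a_def vals_def)
  qed
  have vb': "vals k b'"
    using vals_mult[OF vb va] b' by (simp add: vals_def)
  have "D k b' \<sigma> = c \<sigma>" if \<sigma>: "\<sigma> \<in> simplices X (Suc k)" and low: "sum f (base_face f \<sigma>) < Suc n" for \<sigma>
  proof -
    interpret G: comm_group "F \<sigma>"
      by (rule F_group[OF simplices_in[OF \<sigma>]])
    note face = simplices_face[OF complex \<sigma>]
    note inj\<sigma> = inj[OF simplices_in[OF \<sigma>]]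
    define v where "v = arg_min_on f \<sigma>"
    note v = arg_min_base_face(1,2)[OF \<sigma> inj\<sigma>, folded v_def]
    \<comment> \<open>All faces other than the base face have sum below \<open>n\<close>, where no
      correction is made. This also leaves the coboundary on simplices of smaller rank
      unchanged.\<close>
    have other: "a (\<sigma> - {w}) = \<one>\<^bsub>F (\<sigma> - {w})\<^esub>" if w: "w \<in> \<sigma>" "w \<noteq> v" for w
    proof -
      have "\<sigma> - {w} \<noteq> base_face f \<sigma>"
        using w v by auto
      hence "sum f (\<sigma> - {w}) < n"
        using sum_face_less[OF \<sigma> inj\<sigma> w(1)] low by simp
      thus ?thesis
        by (simp add: a_def)
    qed
    have D: "D k b' \<sigma> = D k b \<sigma> \<otimes>\<^bsub>F \<sigma>\<^esub> D k a \<sigma>"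
      using D_cong[OF \<sigma> vb' vals_mult[OF vb va]] b' face D_mult[OF \<sigma> vb va] by simp
    have Da: "D k a \<sigma> = summand a \<sigma> v"
      by (rule D_single[OF \<sigma> va v(1) other])
    have cl: "c \<sigma> \<in> carrier (F \<sigma>)" "D k b \<sigma> \<in> carrier (F \<sigma>)"
      using c(1) D_closed[OF \<sigma> vb] \<sigma> by (auto simp: vals_def)
    show ?thesis
    proof (cases "sum f (base_face f \<sigma>) = n")
      case True
      hence "D k a \<sigma> = e \<sigma>"
        using a[OF face[OF v(1)]] \<sigma> v unfolding Da by (simp add: P_def summand_def v_def)
      thus ?thesis
        unfolding D e_def using cl by (simp add: G.m_lcomm)
    next
      case False
      hence "a (\<sigma> - {v}) = \<one>\<^bsub>F (\<sigma> - {v})\<^esub>"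
        by (simp add: a_def v(2)[symmetric])
      hence "D k a \<sigma> = \<one>\<^bsub>F \<sigma>\<^esub>"
        unfolding Da by (rule summand_one[OF \<sigma> v(1)])
      moreover have "D k b \<sigma> = c \<sigma>"
        using Db[OF \<sigma>] low False by simp
      ultimately show ?thesis
        unfolding D using cl by simp
    qed
  qed
  hence "primitive_below f k c (Suc n) b'"
    using vb' by (simp add: primitive_below_def)
  thus ?thesis
    by (intro exI[of _ b']) (simp add: b'_def)
qed

text \<open>The primitives for increasing \<open>n\<close> are chosen coherently, so the value at
  \<open>\<eta>\<close> is final from stage \<open>Suc (sum f \<eta>)\<close> on. The coboundary at
  \<open>\<sigma>\<close> involves only faces whose sum is at most that of its base face, so it can
  be computed at one finite stage.\<close>

theorem cohomology_vanishes:
  fixes f :: "'v \<Rightarrow> nat"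
  assumes S: "condition_S X ori lab F r (Suc k)"
    and inj: "\<And>\<sigma>. \<sigma> \<in> X \<Longrightarrow> inj_on f \<sigma>"
    and geom: "\<And>\<eta>. \<eta> \<in> simplices X k \<Longrightarrow> \<exists>es. pointed X ori k es \<and> set es = \<eta> \<and>
      stable X ori es (closer_set X f \<eta>) \<and>
      (\<forall>u\<in>closer_set X f \<eta>. \<forall>w\<in>closer_set X f \<eta>. {u, w} \<in> X \<longrightarrow> {u, w} \<union> \<eta> \<in> X)"
  shows "trivial_group (cohomology X lab F r (Suc k))"
proof (rule trivial_cohomologyI)
  fix c assume c: "vals (Suc k) c"
    "\<And>\<tau>. \<tau> \<in> simplices X (Suc (Suc k)) \<Longrightarrow> D (Suc k) c \<tau> = \<one>\<^bsub>F \<tau>\<^esub>"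
  have "vals k (\<lambda>\<sigma>. \<one>\<^bsub>F \<sigma>\<^esub>)"
    unfolding vals_def
  proof
    fix \<sigma> assume "\<sigma> \<in> simplices X k"
    then interpret G: comm_group "F \<sigma>"
      by (intro F_group simplices_in)
    show "\<one>\<^bsub>F \<sigma>\<^esub> \<in> carrier (F \<sigma>)"
      by simp
  qed
  hence base: "\<exists>b. primitive_below f k c 0 b"
    by (auto simp: primitive_below_def)
  obtain B where B: "\<And>n. primitive_below f k c n (B n)"
    and agree: "\<And>n \<eta>. sum f \<eta> \<noteq> n \<Longrightarrow> B (Suc n) \<eta> = B n \<eta>"
    using dependent_nat_choice[where P = "primitive_below f k c"
        and Q = "\<lambda>n b b'. \<forall>\<eta>. sum f \<eta> \<noteq> n \<longrightarrow> b' \<eta> = b \<eta>", OF base primitive_step[OF S inj geom c]]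
    by metis
  have stable: "B (Suc (sum f \<eta>) + m) \<eta> = B (Suc (sum f \<eta>)) \<eta>" for \<eta> m
    by (induction m) (simp_all add: agree)
  define b where "b \<eta> = B (Suc (sum f \<eta>)) \<eta>" for \<eta>
  have b: "b \<eta> = B n \<eta>" if "sum f \<eta> < n" for \<eta> n
    using stable[of \<eta> "n - Suc (sum f \<eta>)"] that by (simp add: b_def)
  have vB: "vals k (B n)" for n
    using B by (simp add: primitive_below_def)
  hence vb: "vals k b"
    by (simp add: vals_def b_def)
  have "D k b \<sigma> = c \<sigma>" if \<sigma>: "\<sigma> \<in> simplices X (Suc k)" for \<sigma>
  proof -
    let ?n = "Suc (sum f (base_face f \<sigma>))"
    have "D k b \<sigma> = D k (B ?n) \<sigma>"
    proof (rule D_cong[OF \<sigma> vb vB])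
      fix w assume w: "w \<in> \<sigma>"
      have "sum f (\<sigma> - {w}) \<le> sum f (base_face f \<sigma>)"
        using sum_face_less[OF \<sigma> inj[OF simplices_in[OF \<sigma>]] w] by (cases "\<sigma> - {w} = base_face f \<sigma>") auto
      thus "b (\<sigma> - {w}) = B ?n (\<sigma> - {w})"
        by (intro b) simp
    qed
    also have "\<dots> = c \<sigma>"
      using B[of ?n] \<sigma> by (simp add: primitive_below_def)
    finally show ?thesis .
  qed
  with vb show "\<exists>b. vals k b \<and> (\<forall>\<sigma>\<in>simplices X (Suc k). D k b \<sigma> = c \<sigma>)"
    by blast
qed

end

section \<open>The hypotheses of the vanishing criterion in the building\<close>

context oriented_building
begin

text \<open>Inside an apartment equal labels force equal types: a chamber at \<open>x\<close>
  contains a vertex with the type of \<open>u\<close>, and this vertex shares the label of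
  \<open>x\<close>, so it is \<open>x\<close>. But the types of adjacent vertices differ by the size
  of a direction, which lies between 1 and \<open>d\<close>.\<close>

lemma lab_inj_on_simplex:
  assumes \<sigma>: "\<sigma> \<in> X"
  shows "inj_on lab \<sigma>"
proof (rule inj_onI, rule ccontr)
  fix u x assume ux: "u \<in> \<sigma>" "x \<in> \<sigma>" "lab u = lab x" "u \<noteq> x"
  obtain A where A: "A \<in> \<A>" "\<sigma> \<subseteq> vertices A"
    using common_apartment_vertices[OF \<sigma> \<sigma>] .
  hence V: "x \<in> vertices A" "u \<in> vertices A"
    using ux by auto
  obtain C where C: "C \<in> A" "x \<in> C" "card C = Suc d"
    by (rule chamber_exists[OF A(1) V(1)])
  have "C \<in> X"
    using C(1) apartment_subset[OF A(1)] by blast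
  then obtain ys where ys: "pointed X ori (length ys) (ys @ [x])" "set (ys @ [x]) = C"
    using C(2) by (rule ex_pointed_last)
  have len: "length ys = d"
    using pointedD(2,3)[OF ys(1)] ys(2) C(3) distinct_card[of "ys @ [x]"] by simp
  have CV: "C \<subseteq> vertices A"
    by (rule vertices_subset[OF C(1)])
  obtain y where y: "y \<in> C" "tau A y = tau A u"
    using tau_chamber_cover[OF A(1) ys(1)[unfolded len]] CV unfolding ys(2) by blast
  have "lab y = lab u"
    by (rule label_eq_if_tau_eq[OF A(1) lab_apartment[OF A(1)] _ V(2) y(2)]) (use y(1) CV in blast)
  moreover have "inj_on lab C"
    using lab_apartment[OF A(1)] C by (simp add: apartment_labelling_def bij_betw_def)
  ultimately have "y = x"
    using ux(3) y(1) C(2) by (auto dest: inj_onD)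
  hence tau: "tau A u = tau A x"
    using y(2) by simp
  have "{u, x} \<in> X"
    using face_in[OF \<sigma>] ux by simp
  hence nb: "nb A x u"
    using edge_iff[OF A(1) V] ux(4) by simp
  have "(tau A x + int (card (dir A x u))) mod (int d + 1) = tau A x mod (int d + 1)"
    using tau_nb[OF nb] tau by (simp add: tau_def)
  hence "(int d + 1) dvd int (card (dir A x u))"
    by (metis add_diff_cancel_left' mod_eq_dvd_iff)
  hence "int d + 1 \<le> int (card (dir A x u))"
    using card_dir_pos[OF A(1) nb] by (intro zdvd_imp_le) simp_all
  thus False
    using card_dir_le[of A x u] by simp
qed

text \<open>The enumeration is rotated so that it ends in the vertex farthest from \<open>z\<close>;
  with respect to it the closer vertices are stable.\<close>

lemma ex_stable_closer_set:
  assumes z: "{z} \<in> X" and \<eta>: "\<eta> \<in> simplices X k"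
  defines "M \<equiv> closer_set X (\<lambda>x. dst x z) \<eta>"
  shows "\<exists>es. pointed X ori k es \<and> set es = \<eta> \<and> stable X ori es M \<and>
    (\<forall>u\<in>M. \<forall>w\<in>M. {u, w} \<in> X \<longrightarrow> {u, w} \<union> \<eta> \<in> X)"
proof -
  let ?f = "\<lambda>x. dst x z"
  have \<eta>': "\<eta> \<in> X" "finite \<eta>" "\<eta> \<noteq> {}" "card \<eta> = Suc k"
    using \<eta> by (auto simp: simplices_def)
  have "Max (?f ` \<eta>) \<in> ?f ` \<eta>"
    using \<eta>' by (intro Max_in) auto
  then obtain x where x: "x \<in> \<eta>" "?f x = Max (?f ` \<eta>)"
    by auto
  obtain ys where ys: "pointed X ori (length ys) (ys @ [x])" "set (ys @ [x]) = \<eta>"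
    using \<eta>'(1) x(1) by (rule ex_pointed_last)
  have max: "\<forall>y\<in>set ys. dst y z \<le> dst x z"
  proof
    fix y assume "y \<in> set ys"
    hence "y \<in> \<eta>"
      using ys(2) by auto
    thus "dst y z \<le> dst x z"
      unfolding x(2) using \<eta>'(2) by (intro Max_ge) auto
  qed
  have len: "length ys = k"
    using pointedD(3)[OF ys(1)] ys(2) \<eta>'(4) distinct_card[of "ys @ [x]"] by simp
  have "stable X ori (ys @ [x]) M"
    using closer_stable[OF z ys(1) max] unfolding ys(2) M_def closer_set_def .
  moreover have "{u, w} \<union> \<eta> \<in> X" if "u \<in> M" "w \<in> M" "{u, w} \<in> X" for u w
    using closer_adjacent_simplex[OF z ys(1) max, of u w] that unfolding ys(2) M_def closer_set_def by blast
  ultimately show ?thesis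
    using ys len by (intro exI[of _ "ys @ [x]"]) auto
qed

lemma ex_vertex: obtains z where "{z} \<in> X"
proof -
  obtain A where A: "A \<in> \<A>"
    using building unfolding building_affine_A_def by (elim conjE) blast
  obtain z k where "z \<in> vertices A" "\<forall>i\<in>{0..d}. crd A z i = 0 + k"
    by (rule crd_surj[OF A])
  thus ?thesis
    using that vertex_in[OF A] apartment_subset[OF A] by blast
qed

end

theorem theorem1p2:
  fixes d k :: nat
    and X :: "'v set set"
    and \<A> :: "'v set set set"
    and ori :: "'v set \<Rightarrow> 'v list set"
    and lab :: "'v \<Rightarrow> nat"
    and F :: "'v set \<Rightarrow> 'a monoid"
    and r :: "'v set \<Rightarrow> 'v set \<Rightarrow> 'a \<Rightarrow> 'a"
  assumes "d \<ge> 1"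
    and "building_affine_A d X \<A>"
    and "orientation d X \<A> ori"
    and "labelling d X lab"
    and "coefficient_system X F r"
    and "1 \<le> k" and "k \<le> d"
    and "condition_S X ori lab F r k"
  shows "trivial_group (cohomology X lab F r k)"
proof -
  interpret oriented_building d X \<A> ori lab
    using assms(2-4) by unfold_locales
  interpret coefficient_complex X lab F r
    using complex assms(5) lab_inj_on_simplex by unfold_locales
  obtain z where z: "{z} \<in> X"
    by (rule ex_vertex)
  obtain n where k: "k = Suc n"
    using assms(6) by (cases k) auto
  show ?thesis
    unfolding k
    by (rule cohomology_vanishes[OF assms(8)[unfolded k] dst_inj_on_simplex[OF z] ex_stable_closer_set[OF z]])
qed

end
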